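(* Let $f,f_1,\dots,f_m:\mathbb{R}^n\to\mathbb{R}$ be semi-algebraic $C^2$ functions with Lipschitz continuous gradients; let $L>0$ be a Lipschitz constant of $\nabla f$ and, for each $i=1,\dots,m$, let $L_i>0$ be a Lipschitz constant of $\nabla f_i$. Let $\mathcal{F}=\{x\in\mathbb{R}^n: f_i(x)\le 0,\ i=1,\dots,m\}$. Assume the Mangasarian-Fromovitz qualification condition: for every $x\in\mathcal{F}$ there is $d\in\mathbb{R}^n$ with $\langle\nabla f_i(x),d\rangle<0$ for all $i\in I(x)=\{i: f_i(x)=0\}$. Let $x_0\in\mathcal{F}$ be a feasible starting point such that $\{x\in\mathbb{R}^n: f(x)\le f(x_0)\}$ is bounded, and let $\{x_k\}_{k\in\mathbb{N}}$ be the sequence generated from $x_0$ by the moving balls method. Then: (i) The sequence $\{x_k\}$ converges to a point $x_\infty\in\mathcal{F}$ satisfying the KKT conditions for the problem $\min\{f(x): f_i(x)\le 0,\ i=1,\dots,m\}$, i.e. there exist $\lambda_1,\dots,\lambda_m\ge 0$ with $\nabla f(x_\infty)+\sum_{i=1}^m\lambda_i\nabla f_i(x_\infty)=0$ and $\lambda_i f_i(x_\infty)=0$ for all $i=1,\dots,m$. (ii) Either convergence occurs in a finite number of steps, or the rate is of one of the forms: (a) $\|x_k-x_\infty\|=O(q^k)$ for some $q\in(0,1)$; (b) $\|x_k-x_\infty\|=O(1/k^{\gamma})$ for some $\gamma>0$.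
   Context: Moving balls method: given $x_0\in\mathcal{F}$, for each $k\ge 0$ let $x_{k+1}$ be the solution of $$\min_{y\in\mathbb{R}^n}\ f(x_k)+\langle\nabla f(x_k),y-x_k\rangle+\tfrac{L}{2}\|y-x_k\|^2\quad\text{s.t.}\quad f_i(x_k)+\langle\nabla f_i(x_k),y-x_k\rangle+\tfrac{L_i}{2}\|y-x_k\|^2\le 0,\ i=1,\dots,m.$$ (The method is well defined and $x_k\in\mathcal{F}$ for all $k$.) Convergence in a finite number of steps means $x_k=x_\infty$ for all sufficiently large $k$. *)

theory Defs
  imports "HOL-Analysis.Analysis" "HOL-Library.Landau_Symbols"
begin

text \<open>The gradient is only meaningful at points of differentiability.\<close>

definition grad :: "('a::real_inner \<Rightarrow> real) \<Rightarrow> 'a \<Rightarrow> 'a" where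
  "grad f x = (THE D. GDERIV f x :> D)"

lemma GDERIV_unique:
  assumes "GDERIV f x :> D" "GDERIV f x :> E"
  shows "D = E"
proof -
  have "(\<lambda>h. inner h D) = (\<lambda>h. inner h E)"
    using assms unfolding gderiv_def by (rule has_derivative_unique)
  then have "inner (D - E) (D - E) = 0"
    by (metis inner_diff_right right_minus_eq)
  then show ?thesis by simp
qed

lemma grad_eq: "GDERIV f x :> D \<Longrightarrow> grad f x = D"
  unfolding grad_def by (blast intro: GDERIV_unique)

text \<open>For a differentiable \<open>f\<close>, the derivative of the gradient map is the Hessian, so
  this asks for a continuous second derivative; \<open>H\<close> takes values in the space of bounded
  linear maps with the operator norm.\<close>

definition C2_fun :: "('a::euclidean_space \<Rightarrow> real) \<Rightarrow> bool" where
  "C2_fun f \<longleftrightarrow> (\<forall>x. f differentiable (at x)) \<and>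
     (\<exists>H :: 'a \<Rightarrow> 'a \<Rightarrow>\<^sub>L 'a.
        (\<forall>x. (grad f has_derivative blinfun_apply (H x)) (at x)) \<and> continuous_on UNIV H)"

text \<open>A finite union of sets, each cut out by finitely many polynomial equations and
  strict inequalities; every pair \<open>(P, Q)\<close> in \<open>C\<close> describes one member of the union.
  On a Euclidean space, \<^const>\<open>real_polynomial_function\<close> holds of exactly the polynomials
  in the coordinates.\<close>

definition semialgebraic :: "'a::euclidean_space set \<Rightarrow> bool" where
  "semialgebraic S \<longleftrightarrow>
     (\<exists>C :: (('a \<Rightarrow> real) set \<times> ('a \<Rightarrow> real) set) set.
        finite C \<and>
        (\<forall>(P, Q) \<in> C. finite P \<and> finite Q \<and> (\<forall>p \<in> P \<union> Q. real_polynomial_function p)) \<and>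
        S = (\<Union>(P, Q) \<in> C. {x. (\<forall>p \<in> P. p x = 0) \<and> (\<forall>q \<in> Q. q x < 0)}))"

definition semialgebraic_fun :: "('a::euclidean_space \<Rightarrow> real) \<Rightarrow> bool" where
  "semialgebraic_fun f \<longleftrightarrow> semialgebraic {(x, y). y = f x}"

definition feasible_set :: "nat \<Rightarrow> (nat \<Rightarrow> 'a \<Rightarrow> real) \<Rightarrow> 'a set" where
  "feasible_set m fc = {x. \<forall>i\<in>{1..m}. fc i x \<le> 0}"

definition active_set :: "nat \<Rightarrow> (nat \<Rightarrow> 'a \<Rightarrow> real) \<Rightarrow> 'a \<Rightarrow> nat set" where
  "active_set m fc x = {i\<in>{1..m}. fc i x = 0}"

definition MFCQ :: "nat \<Rightarrow> (nat \<Rightarrow> 'a::euclidean_space \<Rightarrow> real) \<Rightarrow> bool" where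
  "MFCQ m fc \<longleftrightarrow>
     (\<forall>x \<in> feasible_set m fc. \<exists>d. \<forall>i \<in> active_set m fc x. inner (grad (fc i) x) d < 0)"

definition KKT_point ::
  "nat \<Rightarrow> ('a::euclidean_space \<Rightarrow> real) \<Rightarrow> (nat \<Rightarrow> 'a \<Rightarrow> real) \<Rightarrow> 'a \<Rightarrow> bool" where
  "KKT_point m f fc x \<longleftrightarrow> x \<in> feasible_set m fc \<and>
     (\<exists>lam :: nat \<Rightarrow> real.
        (\<forall>i\<in>{1..m}. lam i \<ge> 0) \<and>
        grad f x + (\<Sum>i=1..m. lam i *\<^sub>R grad (fc i) x) = 0 \<and>
        (\<forall>i\<in>{1..m}. lam i * fc i x = 0))"

definition quad_model ::
  "('a::euclidean_space \<Rightarrow> real) \<Rightarrow> real \<Rightarrow> 'a \<Rightarrow> 'a \<Rightarrow> real" where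
  "quad_model f L x y = f x + inner (grad f x) (y - x) + L / 2 * (norm (y - x))\<^sup>2"

text \<open>When the gradients are Lipschitz with the given positive constants, the subproblem at
  a feasible point minimizes a strongly convex function over a nonempty intersection of closed
  balls (the whole space if \<open>m = 0\<close>), so it has exactly one solution, which is again feasible.
  The relation below therefore determines the sequence uniquely from its starting point.\<close>

definition moving_balls_sequence ::
  "nat \<Rightarrow> ('a::euclidean_space \<Rightarrow> real) \<Rightarrow> (nat \<Rightarrow> 'a \<Rightarrow> real) \<Rightarrow> real \<Rightarrow> (nat \<Rightarrow> real) \<Rightarrow>
   'a \<Rightarrow> (nat \<Rightarrow> 'a) \<Rightarrow> bool" where
  "moving_balls_sequence m f fc L Lc x0 x \<longleftrightarrow> x 0 = x0 \<and>
     (\<forall>k. is_arg_min (quad_model f L (x k))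
             (\<lambda>y. \<forall>i\<in>{1..m}. quad_model (fc i) (Lc i) (x k) y \<le> 0) (x (Suc k)))"

end

theory Submission
  imports Defs
begin

text \<open>Let \<open>F x\<close> be the optimal value of the subproblem at \<open>x\<close> and \<open>r x\<close> the length of the step it
  proposes. By compactness and the qualification condition the multipliers of the subproblems are
  bounded, and weak duality gives \<open>F x - F x' \<le> c (r x |x - x'| + |x - x'|^2)\<close>. For semialgebraic
  data this inequality alone forces \<open>(F - v)^\<theta> \<le> C r\<close> just above every level \<open>v\<close>, with
  some \<open>\<theta> < 1\<close>: otherwise, by the Tarski-Seidenberg theorem, every small level \<open>F = v + t\<close> contains a
  point with \<open>r \<le> c0 t\<close>; such points can be selected along a semialgebraic curve, which has finite
  variation, while the inequality summed over a geometric sequence of levels makes the variation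
  infinite. Together with the descent \<open>F x\<^sub>k\<^sub>+\<^sub>1 + L/2 |x\<^sub>k\<^sub>+\<^sub>2 - x\<^sub>k\<^sub>+\<^sub>1|^2 \<le> F x\<^sub>k\<close> this makes the steps summable.
  Since \<open>\<theta>\<close> may be enlarged to at least \<open>1/2\<close>, a sublinear rate covers every case without finite
  termination.\<close>

section \<open>Sign patterns of univariate polynomials\<close>

text \<open>The optimal value \<open>F\<close> need not be differentiable, so the classical
  Lojasiewicz inequality and the chain rule along curves are replaced by the inequality between two
  points. Its quadratic term is absorbed when consecutive points of the curve are closer than the
  level; otherwise they are far enough apart anyway. The exponent comes from a dichotomy in the
  plane of levels \<open>t\<close> and step bounds \<open>t * w\<close>: finitely many polynomials
  in \<open>t\<close> and \<open>w\<close> have constant signs where \<open>w >= c\<close> and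
  \<open>t * w ^ n <= \<eta>\<close>, so the pairs met by points of \<open>K\<close> fill this
  sector or avoid it. Filling it would give linear fibers along the lower edge \<open>w = c\<close>;
  avoiding it keeps \<open>r\<close> above the upper edge, a power of \<open>t\<close> with exponent
  \<open>1 - 1 / n\<close>. Quantifiers are eliminated without formula syntax: a predicate counts as
  quantifier free when its truth depends only on the signs of finitely many ring elements, and the
  induction compares the sign patterns of one family of polynomials at two parameter values.\<close>

text \<open>A pair in \<open>Q\<close> consists of the specializations of one polynomial at two parameter values. In a
  family closed under derivatives, the sets on which all signs are constant are points and open
  intervals; the last clause of \<open>sign_similar\<close> says that they come in the same order for both
  parameter values.\<close>

definition same_signs :: "(real poly \<times> real poly) set \<Rightarrow> real \<Rightarrow> real \<Rightarrow> bool" where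
  "same_signs Q y y' \<longleftrightarrow> (\<forall>(a, b)\<in>Q. sgn (poly a y) = sgn (poly b y'))"

definition sign_similar :: "(real poly \<times> real poly) set \<Rightarrow> bool" where
  "sign_similar Q \<longleftrightarrow> (\<forall>y. \<exists>y'. same_signs Q y y') \<and> (\<forall>y'. \<exists>y. same_signs Q y y') \<and>
     (\<forall>y1 y2 y1' y2'. y1 \<le> y2 \<longrightarrow> y2' \<le> y1' \<longrightarrow> same_signs Q y1 y1' \<longrightarrow> same_signs Q y2 y2' \<longrightarrow>
        same_signs Q y1 y2' \<and> same_signs Q y2 y1')"

lemma sign_similar_left: "sign_similar Q \<Longrightarrow> \<exists>y'. same_signs Q y y'"
  and sign_similar_right: "sign_similar Q \<Longrightarrow> \<exists>y. same_signs Q y y'"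
  and sign_similar_C: "sign_similar Q \<Longrightarrow> y1 \<le> y2 \<Longrightarrow> y2' \<le> y1' \<Longrightarrow> same_signs Q y1 y1' \<Longrightarrow>
    same_signs Q y2 y2' \<Longrightarrow> same_signs Q y1 y2' \<and> same_signs Q y2 y1'"
  unfolding sign_similar_def by blast+

text \<open>The relation links points of two different lines, so composing it takes three links:
  \<open>y1\<close> and \<open>y2\<close> lie in the same cell because both match
  \<open>z1\<close>.\<close>

lemma same_signs_trans:
  "same_signs Q y1 z1 \<Longrightarrow> same_signs Q y2 z1 \<Longrightarrow> same_signs Q y2 z2 \<Longrightarrow> same_signs Q y1 z2"
  unfolding same_signs_def by (auto split: prod.splits)

lemma same_signs_swap: "same_signs (prod.swap ` Q) y' y \<longleftrightarrow> same_signs Q y y'"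
  unfolding same_signs_def by (auto split: prod.splits)

lemma sign_similar_swap: "sign_similar Q \<Longrightarrow> sign_similar (prod.swap ` Q)"
  by (simp add: sign_similar_def same_signs_swap)

text \<open>Reversing the line turns right ends of cells into left ends, so that only the latter
  need a direct argument.\<close>

definition reflect :: "real poly \<Rightarrow> real poly" where
  "reflect p = pcompose p [:0, -1:]"

lemma poly_reflect [simp]: "poly (reflect p) y = poly p (- y)"
  by (simp add: reflect_def poly_pcompose)

lemma same_signs_reflect:
  "same_signs ((\<lambda>(a, b). (reflect a, reflect b)) ` Q) y y' \<longleftrightarrow> same_signs Q (- y) (- y')"
  unfolding same_signs_def by (auto split: prod.splits)

lemma sign_similar_reflect:
  assumes "sign_similar Q"
  shows "sign_similar ((\<lambda>(a, b). (reflect a, reflect b)) ` Q)"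
proof -
  have "\<exists>y'. same_signs Q (- y) (- y')" for y
    using sign_similar_left[OF assms, of "- y"] by (metis minus_minus)
  moreover have "\<exists>y. same_signs Q (- y) (- y')" for y'
    using sign_similar_right[OF assms, of "- y'"] by (metis minus_minus)
  moreover have "same_signs Q (- y1) (- y2') \<and> same_signs Q (- y2) (- y1')"
    if "y1 \<le> y2" "y2' \<le> y1'" "same_signs Q (- y1) (- y1')" "same_signs Q (- y2) (- y2')" for y1 y2 y1' y2'
    using sign_similar_C[OF assms, of "- y2" "- y1" "- y1'" "- y2'"] that by simp
  ultimately show ?thesis
    unfolding sign_similar_def same_signs_reflect by blast
qed

lemma sgn_poly_cont:
  fixes a :: "real poly"
  assumes "poly a z \<noteq> 0"
  shows "eventually (\<lambda>y. sgn (poly a y) = sgn (poly a z)) (nhds z)"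
proof -
  have t: "((\<lambda>y. poly a y) \<longlongrightarrow> poly a z) (nhds z)"
    using poly_isCont[of z a] unfolding isCont_def tendsto_at_iff_tendsto_nhds .
  show ?thesis
  proof (cases "poly a z > 0")
    case True
    then show ?thesis using order_tendstoD(1)[OF t True] by (auto elim!: eventually_mono)
  next
    case False
    then have "poly a z < 0" using assms by simp
    then show ?thesis using order_tendstoD(2)[OF t, of 0] by (auto elim!: eventually_mono)
  qed
qed

lemma same_signs_nhds:
  assumes "finite Q" "same_signs Q y y'" "\<And>a b. (a, b) \<in> Q \<Longrightarrow> a \<noteq> 0 \<Longrightarrow> poly a y \<noteq> 0"
  shows "eventually (\<lambda>u. same_signs Q u y') (nhds y)"
proof -
  have "eventually (\<lambda>u. \<forall>c\<in>Q. sgn (poly (fst c) u) = sgn (poly (fst c) y)) (nhds y)"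
  proof (rule eventually_ball_finite[OF assms(1)], rule ballI)
    fix c assume "c \<in> Q"
    show "eventually (\<lambda>u. sgn (poly (fst c) u) = sgn (poly (fst c) y)) (nhds y)"
    proof (cases "fst c = 0")
      case False
      then show ?thesis using assms(3)[of "fst c" "snd c"] \<open>c \<in> Q\<close> by (intro sgn_poly_cont) simp
    qed simp
  qed
  then show ?thesis
    by eventually_elim (use assms(2) in \<open>force simp: same_signs_def\<close>)
qed

text \<open>Serves a cell that is unbounded below: a nonconstant polynomial cannot stay bounded on
  it.\<close>

lemma poly_bounded_below_ray:
  fixes p :: "real poly"
  assumes "\<And>u. u \<le> y \<Longrightarrow> \<bar>poly p u\<bar> \<le> B"
  shows "degree p = 0"
proof (rule ccontr)
  assume "degree p \<noteq> 0"
  then have "filterlim (poly p) at_infinity at_infinity"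
    by (intro filterlim_poly_at_infinity) simp
  then have "filterlim (poly p) at_infinity at_bot"
    by (rule filterlim_mono) (simp_all add: at_bot_le_at_infinity)
  then have "eventually (\<lambda>u. norm (poly p u) \<ge> B + 1) at_bot"
    using filterlim_at_infinity_imp_norm_at_top[of "poly p" at_bot] unfolding filterlim_at_top by blast
  moreover have "eventually (\<lambda>u. u \<le> y) at_bot" by (rule eventually_le_at_bot)
  ultimately have "eventually (\<lambda>u. False) (at_bot :: real filter)"
    by eventually_elim (use assms in force)
  then show False by simp
qed

text \<open>Let \<open>y'\<close> match \<open>y\<close>. It lies on one side of \<open>z\<close>,
  so \<open>y\<close> together with \<open>y1\<close> or \<open>y2\<close> appears in the order
  opposite to that of \<open>y'\<close> and \<open>z\<close>, and the order clause exchanges the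
  partners.\<close>

lemma sign_similar_convex:
  assumes "sign_similar Q" "same_signs Q y1 z" "same_signs Q y2 z" "y1 \<le> y" "y \<le> y2"
  shows "same_signs Q y z"
proof -
  obtain y' where y': "same_signs Q y y'" using sign_similar_left[OF assms(1)] by blast
  show ?thesis
  proof (cases "y' \<le> z")
    case True
    then show ?thesis using sign_similar_C[OF assms(1) assms(4) True assms(2) y'] by blast
  next
    case False
    then show ?thesis using sign_similar_C[OF assms(1) assms(5) _ y' assms(3)] by simp
  qed
qed

text \<open>The induction step of the elimination: one pair \<open>(p, p')\<close> joins
  \<open>Q\<close>. By \<open>deriv_zero\<close> the derivative has no zero in an open cell, so
  \<open>p\<close> is strictly monotone there; by \<open>at_zeros\<close> the signs at the point
  cells agree in advance, which pseudo-remainders will guarantee.\<close>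

locale sign_extension =
  fixes Q :: "(real poly \<times> real poly) set" and p p' :: "real poly"
  assumes sim: "sign_similar Q"
    and fin: "finite Q"
    and zero_iff: "\<And>a b. (a, b) \<in> Q \<Longrightarrow> a = 0 \<longleftrightarrow> b = 0"
    and nonconst: "degree p > 0" "degree p' > 0"
    and deriv_sgn: "\<And>y y'. same_signs Q y y' \<Longrightarrow> sgn (poly (pderiv p) y) = sgn (poly (pderiv p') y')"
    and deriv_zero: "\<And>y. poly (pderiv p) y = 0 \<Longrightarrow> \<exists>(a, b)\<in>Q. a \<noteq> 0 \<and> poly a y = 0"
    and at_zeros: "\<And>y y' a b. same_signs Q y y' \<Longrightarrow> (a, b) \<in> Q \<Longrightarrow> a \<noteq> 0 \<Longrightarrow> poly a y = 0 \<Longrightarrow>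
      sgn (poly p y) = sgn (poly p' y')"
begin

text \<open>The cell of such a \<open>y\<close> is the single point \<open>y\<close>; the other
  cells are open intervals.\<close>

definition crit :: "real \<Rightarrow> bool" where
  "crit y \<longleftrightarrow> (\<exists>(a, b)\<in>Q. a \<noteq> 0 \<and> poly a y = 0)"

definition crit' :: "real \<Rightarrow> bool" where
  "crit' y \<longleftrightarrow> (\<exists>(a, b)\<in>Q. b \<noteq> 0 \<and> poly b y = 0)"

lemma crit_iff: "same_signs Q y y' \<Longrightarrow> crit y \<longleftrightarrow> crit' y'"
  unfolding crit_def crit'_def same_signs_def
  using zero_iff by (fastforce simp: sgn_zero_iff split: prod.splits)

lemma crit_sgn: "same_signs Q y y' \<Longrightarrow> crit y \<Longrightarrow> sgn (poly p y) = sgn (poly p' y')"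
  using at_zeros unfolding crit_def by blast

text \<open>Exchanging the two parameters, reversing the line and negating the new pair are the
  symmetries that reduce both nonzero signs and both ends of a cell to
  \<open>meets_negative\<close>.\<close>

lemma swapped: "sign_extension (prod.swap ` Q) p' p"
proof
  show "sign_similar (prod.swap ` Q)" using sim by (rule sign_similar_swap)
  show "sgn (poly p' y) = sgn (poly p y')"
    if "same_signs (prod.swap ` Q) y y'" "(a, b) \<in> prod.swap ` Q" "a \<noteq> 0" "poly a y = 0" for y y' a b
  proof -
    have m: "same_signs Q y' y" using that by (auto simp: same_signs_swap)
    have "crit' y" using that by (auto simp: crit'_def)
    then show ?thesis using crit_sgn[OF m] crit_iff[OF m] by simp
  qed
  show "\<exists>(a, b)\<in>prod.swap ` Q. a \<noteq> 0 \<and> poly a y = 0" if "poly (pderiv p') y = 0" for y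
  proof -
    obtain u where u: "same_signs Q u y" using sign_similar_right[OF sim] by blast
    then have "poly (pderiv p) u = 0" using deriv_sgn[OF u] that by (simp add: sgn_zero_iff)
    then have "crit' y" using crit_iff[OF u] deriv_zero unfolding crit_def by blast
    then show ?thesis unfolding crit'_def by force
  qed
qed (use fin zero_iff deriv_sgn nonconst in \<open>auto simp: same_signs_swap\<close>)

lemma reflected:
  "sign_extension ((\<lambda>(a, b). (reflect a, reflect b)) ` Q) (reflect p) (reflect p')"
proof
  have r0: "reflect a = 0 \<longleftrightarrow> a = 0" for a :: "real poly"
    by (simp add: reflect_def pcompose_eq_0_iff)
  have rd: "poly (pderiv (reflect a)) y = - poly (pderiv a) (- y)" for a y
    by (simp add: reflect_def pderiv_pcompose poly_pcompose pderiv_pCons)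
  show "sign_similar ((\<lambda>(a, b). (reflect a, reflect b)) ` Q)" using sim by (rule sign_similar_reflect)
  show "degree (reflect p) > 0" "degree (reflect p') > 0"
    using nonconst by (simp_all add: reflect_def degree_pcompose)
  show "\<exists>(a, b)\<in>(\<lambda>(a, b). (reflect a, reflect b)) ` Q. a \<noteq> 0 \<and> poly a y = 0"
    if "poly (pderiv (reflect p)) y = 0" for y
    using deriv_zero[of "- y"] that by (force simp: r0 rd)
  show "sgn (poly (reflect p) y) = sgn (poly (reflect p') y')"
    if "same_signs ((\<lambda>(a, b). (reflect a, reflect b)) ` Q) y y'"
      "(a, b) \<in> (\<lambda>(a, b). (reflect a, reflect b)) ` Q" "a \<noteq> 0" "poly a y = 0" for y y' a b
    using that at_zeros[of "- y" "- y'"] by (auto simp: same_signs_reflect r0)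
  show "sgn (poly (pderiv (reflect p)) y) = sgn (poly (pderiv (reflect p')) y')"
    if "same_signs ((\<lambda>(a, b). (reflect a, reflect b)) ` Q) y y'" for y y'
    using that deriv_sgn[of "- y" "- y'"] by (simp add: same_signs_reflect rd sgn_minus)
  show "finite ((\<lambda>(a, b). (reflect a, reflect b)) ` Q)" using fin by simp
  show "a = 0 \<longleftrightarrow> b = 0" if "(a, b) \<in> (\<lambda>(a, b). (reflect a, reflect b)) ` Q" for a b
    using that zero_iff by (auto simp: r0)
qed

lemma negated: "sign_extension Q (- p) (- p')"
  by unfold_locales (use sim fin zero_iff nonconst deriv_sgn deriv_zero at_zeros in \<open>auto simp: pderiv_minus sgn_minus\<close>)

lemma open_cell:
  assumes "same_signs Q y y'" "\<not> crit y"
  shows "eventually (\<lambda>u. same_signs Q u y') (nhds y)"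
  by (rule same_signs_nhds) (use fin assms in \<open>auto simp: crit_def\<close>)

text \<open>Otherwise convexity of cells would make the nonzero polynomial \<open>a\<close> vanish
  on a whole interval.\<close>

lemma crit_cell:
  assumes "same_signs Q y z" "same_signs Q u z" "crit y" "y < u"
  shows False
proof -
  obtain a b where ab: "(a, b) \<in> Q" "a \<noteq> 0" "poly a y = 0" using assms(3) unfolding crit_def by blast
  have "poly a w = 0" if "w \<in> {y..u}" for w
  proof -
    have "same_signs Q w z" using sign_similar_convex[OF sim assms(1,2)] that by simp
    then have "same_signs Q w z" "same_signs Q y z" using assms by auto
    then show ?thesis using ab by (fastforce simp: same_signs_def sgn_zero_iff)
  qed
  then have "{y..u} \<subseteq> {w. poly a w = 0}" by blast
  then show False using poly_roots_finite[OF ab(2)] assms(4) finite_subset infinite_Icc by blast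
qed

lemma increasing_cell:
  assumes "\<And>u. u \<in> {y1<..<y2} \<Longrightarrow> poly (pderiv q) u > (0::real)" "y1 < y2"
  shows "poly q y1 < poly q y2"
  by (rule DERIV_pos_imp_increasing_open[OF assms(2)])
     (use assms(1) poly_DERIV in \<open>fastforce intro!: continuous_intros\<close>)+

end

text \<open>If \<open>p'\<close> were nonnegative on the matching cell \<open>A\<close>, it would
  stay so at the left end of \<open>A\<close> by continuity. That end corresponds to the left end of
  the cell of \<open>y\<close>, where \<open>p\<close> and \<open>p'\<close> have equal signs, and
  \<open>p\<close> increases from there to \<open>y\<close>, against \<open>poly p y < 0\<close>. If
  \<open>A\<close> has no left end, \<open>p'\<close> is bounded on a ray and hence
  constant.\<close>

lemma (in sign_extension) meets_negative:
  assumes y: "same_signs Q y y'" "\<not> crit y" and neg: "poly p y < 0" and pos: "poly (pderiv p) y > 0"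
  shows "\<exists>u. same_signs Q y u \<and> poly p' u < 0"
proof (rule ccontr)
  interpret sw: sign_extension "prod.swap ` Q" p' p by (rule swapped)
  assume "\<not> ?thesis"
  then have nn: "poly p' u \<ge> 0" if "same_signs Q y u" for u using that by force
  define A where "A = {u. same_signs Q y u}"
  have posA: "poly (pderiv p') u > 0" if "u \<in> A" for u
    using deriv_sgn[of y u] that pos by (simp add: A_def sgn_1_pos)
  have swcrit: "sw.crit u = crit' u" for u
    by (force simp: sw.crit_def crit'_def)
  have conv: "w \<in> A" if "u \<in> A" "v \<in> A" "u \<le> w" "w \<le> v" for u v w
    using sign_similar_convex[OF sw.sim, of u y v w] that unfolding same_signs_swap A_def by simp
  show False
  proof (cases "bdd_below A")
    case False
    have "u \<in> A" if "u \<le> y'" for u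
    proof -
      obtain v where "v \<in> A" "v < u" using False unfolding bdd_below_def by (meson not_le)
      then show ?thesis using conv[of v y' u] y that by (simp add: A_def)
    qed
    then have ray: "poly p' u \<le> poly p' y'" if "u \<le> y'" for u
      using increasing_cell[of u y' p'] posA that by (cases "u = y'") force+
    have "degree p' = 0"
      by (rule poly_bounded_below_ray[of y' _ "poly p' y'"])
         (use ray nn \<open>\<And>u. u \<le> y' \<Longrightarrow> u \<in> A\<close> in \<open>force simp: A_def\<close>)
    then show False using nonconst by simp
  next
    case True
    define c where "c = Inf A"
    have yA: "y' \<in> A" using y by (simp add: A_def)
    have cl: "c \<le> u" if "u \<in> A" for u using True that by (simp add: c_def cInf_lower)
    have near: "\<exists>w\<in>A. w < u" if "c < u" for u
      using cInf_less_iff[of A u] True yA that unfolding c_def by blast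
    have cA: "c \<notin> A"
    proof
      assume "c \<in> A"
      then have "eventually (\<lambda>u. u \<in> A) (nhds c)"
        using sw.open_cell[of c y] crit_iff[of y c] y by (simp add: same_signs_swap swcrit A_def)
      then obtain e where "e > 0" "\<And>u. dist u c < e \<Longrightarrow> u \<in> A" unfolding eventually_nhds_metric by blast
      then show False using cl[of "c - e / 2"] by (simp add: dist_real_def)
    qed
    \<comment> \<open>\<open>v\<close> will turn out to be the left end of the cell of
      \<open>y\<close>.\<close>
    obtain v where v: "same_signs Q v c" using sign_similar_right[OF sim] by blast
    have vy: "v < y"
    proof (rule ccontr)
      assume "\<not> v < y"
      then have "same_signs Q y c" using sign_similar_C[OF sim _ cl[OF yA] y(1) v] by simp
      then show False using cA by (simp add: A_def)
    qed
    \<comment> \<open>An open cell around \<open>c\<close> would reach into \<open>A\<close> and put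
      \<open>c\<close> itself in \<open>A\<close>.\<close>
    have critv: "crit v"
    proof (rule ccontr)
      assume "\<not> crit v"
      then have "eventually (\<lambda>u. same_signs Q v u) (nhds c)"
        using sw.open_cell[of c v] crit_iff[OF v] v by (simp add: same_signs_swap swcrit)
      then obtain e where e: "e > 0" "\<And>u. dist u c < e \<Longrightarrow> same_signs Q v u" unfolding eventually_nhds_metric by blast
      then obtain w where "w \<in> A" "w < c + e" using near[of "c + e"] by auto
      then have "same_signs Q v w" using e(2)[of w] cl[of w] by (simp add: dist_real_def)
      then have "same_signs Q y c" using \<open>w \<in> A\<close> v same_signs_trans unfolding A_def by blast
      then show False using cA by (simp add: A_def)
    qed
    have "poly p' c \<ge> 0"
    proof (rule ccontr)
      assume "\<not> poly p' c \<ge> 0"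
      then have "eventually (\<lambda>u. sgn (poly p' u) = - 1) (nhds c)"
        using sgn_poly_cont[of p' c] by simp
      then obtain e where e: "e > 0" "\<And>u. dist u c < e \<Longrightarrow> sgn (poly p' u) = -1" unfolding eventually_nhds_metric by blast
      then obtain w where "w \<in> A" "w < c + e" using near[of "c + e"] by auto
      then have "poly p' w < 0" using e(2)[of w] cl[of w] by (simp add: dist_real_def sgn_1_neg)
      then show False using nn[of w] \<open>w \<in> A\<close> by (simp add: A_def)
    qed
    then have pv: "poly p v \<ge> 0"
      using crit_sgn[OF v critv] by (metis linorder_not_less sgn_less)
    \<comment> \<open>No cell boundary lies between \<open>v\<close> and \<open>y\<close>: a point
      \<open>u'\<close> matching \<open>u\<close> is right of \<open>c\<close>, and \<open>A\<close>
      has points below \<open>u'\<close>, so the order clause identifies the cells of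
      \<open>u\<close> and \<open>y\<close>.\<close>
    have "poly (pderiv p) u > 0" if u: "u \<in> {v<..<y}" for u
    proof -
      obtain u' where u': "same_signs Q u u'" using sign_similar_left[OF sim] by blast
      have "c < u'"
      proof (rule ccontr)
        assume "\<not> c < u'"
        then have "same_signs Q u c" using sign_similar_C[OF sim _ _ v u'] u by simp
        then show False using crit_cell[OF v _ critv, of u] u by simp
      qed
      then obtain w where w: "w \<in> A" "w < u'" using near by blast
      then have "same_signs Q y u'" using sign_similar_C[OF sim _ _ u', of y w] u by (simp add: A_def)
      then have "same_signs Q u y'" using same_signs_trans u' y by blast
      then show ?thesis using deriv_sgn[of u y'] deriv_sgn[OF y(1)] pos by (simp add: sgn_1_pos)
    qed
    then have "poly p v < poly p y" by (rule increasing_cell[OF _ vy])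
    then show False using pv neg by simp
  qed
qed

context sign_extension
begin

text \<open>The negative product says that the absolute value of \<open>p\<close> grows towards the
  left end of the cell, the situation of \<open>meets_negative\<close>; negation covers the other
  sign.\<close>

lemma meets_left:
  assumes y: "same_signs Q y y'" "\<not> crit y" and neg: "poly p y * poly (pderiv p) y < 0"
  shows "\<exists>u. same_signs Q y u \<and> sgn (poly p' u) = sgn (poly p y)"
proof (cases "poly p y < 0")
  case True
  then show ?thesis using meets_negative[OF y] neg by (auto simp: mult_less_0_iff)
next
  case False
  interpret neg: sign_extension Q "- p" "- p'" by (rule negated)
  have "neg.crit = crit" by (simp add: neg.crit_def crit_def fun_eq_iff)
  then show ?thesis using neg.meets_negative[OF y(1)] y neg False
    by (auto simp: mult_less_0_iff pderiv_minus)
qed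

lemma meets_right:
  assumes y: "same_signs Q y y'" "\<not> crit y" and pos: "poly p y * poly (pderiv p) y > 0"
  shows "\<exists>u. same_signs Q y u \<and> sgn (poly p' u) = sgn (poly p y)"
proof -
  interpret r: sign_extension "(\<lambda>(a, b). (reflect a, reflect b)) ` Q" "reflect p" "reflect p'" by (rule reflected)
  have "r.crit (- y) \<longleftrightarrow> crit y"
    unfolding r.crit_def crit_def by (simp add: reflect_def pcompose_eq_0_iff poly_pcompose case_prod_beta)
  moreover have "poly (pderiv (reflect p)) (- y) = - poly (pderiv p) y"
    by (simp add: reflect_def pderiv_pcompose poly_pcompose pderiv_pCons)
  ultimately obtain u where "same_signs Q y (- u)" "sgn (poly p' (- u)) = sgn (poly p y)"
    using r.meets_left[of "- y" "- y'"] y pos by (auto simp: same_signs_reflect)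
  then show ?thesis by blast
qed

text \<open>Just left and right of \<open>y\<close> the polynomial \<open>p\<close> takes both
  nonzero signs inside the cell. Both occur in the matching cell too, which is convex, so
  \<open>p'\<close> has a zero there by the intermediate value theorem.\<close>

lemma meets_zero:
  assumes y: "same_signs Q y y'" "\<not> crit y" and "poly p y = 0" "poly (pderiv p) y > 0"
  shows "\<exists>u. same_signs Q y u \<and> poly p' u = 0"
proof -
  interpret sw: sign_extension "prod.swap ` Q" p' p by (rule swapped)
  obtain e where e: "e > 0" "\<And>u. dist u y < e \<Longrightarrow> same_signs Q u y'"
    using open_cell[OF y] unfolding eventually_nhds_metric by blast
  have cell: "same_signs Q u y'" "\<not> crit u" "poly (pderiv p) u > 0" if "\<bar>u - y\<bar> < e" for u
  proof -
    show u: "same_signs Q u y'" using e(2)[of u] that by (simp add: dist_real_def)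
    then show "\<not> crit u" using crit_iff y by blast
    show "poly (pderiv p) u > 0" using deriv_sgn[OF u] deriv_sgn[OF y(1)] assms(4) by (simp add: sgn_1_pos)
  qed
  have l: "poly p (y - e / 2) < poly p y"
    by (rule increasing_cell) (use cell e(1) in \<open>auto simp: abs_if\<close>)
  have r: "poly p y < poly p (y + e / 2)"
    by (rule increasing_cell) (use cell e(1) in \<open>auto simp: abs_if\<close>)
  obtain u1 where u1: "same_signs Q (y - e / 2) u1" "sgn (poly p' u1) = sgn (poly p (y - e / 2))"
    using meets_left[of "y - e / 2" y'] cell[of "y - e / 2"] l assms(3) e(1) by (auto simp: mult_less_0_iff)
  obtain u2 where u2: "same_signs Q (y + e / 2) u2" "sgn (poly p' u2) = sgn (poly p (y + e / 2))"
    using meets_right[of "y + e / 2" y'] cell[of "y + e / 2"] r assms(3) e(1) by (auto simp: zero_less_mult_iff)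
  have m: "same_signs Q y u1" "same_signs Q y u2"
    using same_signs_trans[OF y(1) cell(1) u1(1)] same_signs_trans[OF y(1) cell(1) u2(1)] e(1) by simp_all
  have s: "poly p' u1 < 0" "poly p' u2 > 0"
    using u1 u2 l r assms(3) by (simp_all add: sgn_1_pos sgn_1_neg)
  have "\<exists>u. (u1 \<le> u \<and> u \<le> u2 \<or> u2 \<le> u \<and> u \<le> u1) \<and> poly p' u = 0"
    using poly_IVT_pos[of u1 u2 p', OF _ s] poly_IVT_neg[of u2 u1 p', OF _ s(2,1)] s
    by (cases u1 u2 rule: linorder_cases) (auto intro: less_imp_le)
  then obtain u where u: "u1 \<le> u \<and> u \<le> u2 \<or> u2 \<le> u \<and> u \<le> u1" "poly p' u = 0" by blast
  have "same_signs Q y u"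
    using sign_similar_convex[OF sw.sim, of u1 y u2 u] sign_similar_convex[OF sw.sim, of u2 y u1 u] u m
    unfolding same_signs_swap by blast
  then show ?thesis using u by blast
qed

lemma meets:
  assumes y: "same_signs Q y y'"
  shows "\<exists>u. same_signs Q y u \<and> sgn (poly p' u) = sgn (poly p y)"
proof (cases "crit y")
  case True
  then show ?thesis using crit_sgn[OF y True] y by (intro exI[of _ y']) simp
next
  case False
  then have d: "poly (pderiv p) y \<noteq> 0" using deriv_zero unfolding crit_def by blast
  consider "poly p y * poly (pderiv p) y < 0" | "poly p y * poly (pderiv p) y > 0" | "poly p y = 0"
    using d mult_eq_0_iff[of "poly p y" "poly (pderiv p) y"] by linarith
  then show ?thesis
  proof cases
    case 3
    interpret neg: sign_extension Q "- p" "- p'" by (rule negated)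
    have "neg.crit = crit" by (simp add: neg.crit_def crit_def fun_eq_iff)
    then show ?thesis
      using meets_zero[OF y False 3] neg.meets_zero[OF y] False d 3
      by (cases "poly (pderiv p) y > 0") (auto simp: pderiv_minus)
  qed (use meets_left[OF y False] meets_right[OF y False] in auto)
qed

lemma monotone_cell:
  assumes "y1 \<le> y2" "y2' \<le> y1'" "same_signs Q y1 y1'" "same_signs Q y2 y2'" "same_signs Q y1 y2'" "same_signs Q y2 y1'"
    and "\<not> crit y1" "poly (pderiv p) y1 > 0"
  shows "poly p y1 \<le> poly p y2 \<and> poly p' y2' \<le> poly p' y1'"
proof -
  interpret sw: sign_extension "prod.swap ` Q" p' p by (rule swapped)
  have 1: "poly (pderiv p) u > 0" if "u \<in> {y1<..<y2}" for u
    using deriv_sgn[OF sign_similar_convex[OF sim assms(3,6), of u]] deriv_sgn[OF assms(3)] assms(8) that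
    by (simp add: sgn_1_pos)
  have 2: "poly (pderiv p') u > 0" if u: "u \<in> {y2'<..<y1'}" for u
  proof -
    have "same_signs Q y1 u"
      using sign_similar_convex[OF sw.sim, of y2' y1 y1' u] assms u unfolding same_signs_swap by simp
    then show ?thesis using deriv_sgn[of y1 u] assms(8) by (simp add: sgn_1_pos)
  qed
  show ?thesis
    using increasing_cell[of y1 y2 p, OF 1] increasing_cell[of y2' y1' p', OF 2] assms(1,2)
    by (cases "y1 = y2"; cases "y2' = y1'") auto
qed

text \<open>This is the order clause for the enlarged family. Both polynomials are monotone in the
  same direction on the cell; in the increasing case \<open>sgn (p y1) <= sgn (p y2) = sgn (p' y2')
  <= sgn (p' y1') = sgn (p y1)\<close>, so all four signs coincide.\<close>

lemma sgn_cell: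
  assumes "y1 \<le> y2" "y2' \<le> y1'" "same_signs Q y1 y1'" "same_signs Q y2 y2'"
    and "sgn (poly p y1) = sgn (poly p' y1')" "sgn (poly p y2) = sgn (poly p' y2')"
  shows "sgn (poly p y1) = sgn (poly p' y2') \<and> sgn (poly p y2) = sgn (poly p' y1')"
proof -
  have m: "same_signs Q y1 y2'" "same_signs Q y2 y1'"
    using sign_similar_C[OF sim assms(1-4)] by auto
  show ?thesis
  proof (cases "crit y1")
    case True
    then have "crit y2" using crit_iff m assms by blast
    then show ?thesis using True m crit_sgn by blast
  next
    case False
    then have d: "poly (pderiv p) y1 \<noteq> 0" using deriv_zero unfolding crit_def by blast
    interpret neg: sign_extension Q "- p" "- p'" by (rule negated)
    have nc: "neg.crit = crit" by (simp add: neg.crit_def crit_def fun_eq_iff)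
    have "poly p y1 \<le> poly p y2 \<and> poly p' y2' \<le> poly p' y1' \<or> poly p y2 \<le> poly p y1 \<and> poly p' y1' \<le> poly p' y2'"
      using monotone_cell[OF assms(1-4) m] neg.monotone_cell[OF assms(1-4) m] False d nc
      by (cases "poly (pderiv p) y1 > 0") (auto simp: pderiv_minus)
    then show ?thesis using assms(5,6) by (auto simp: sgn_if split: if_splits)
  qed
qed

theorem sign_similar_insert: "sign_similar (insert (p, p') Q)"
proof -
  interpret sw: sign_extension "prod.swap ` Q" p' p by (rule swapped)
  have ins: "same_signs (insert (p, p') Q) y y' \<longleftrightarrow> sgn (poly p y) = sgn (poly p' y') \<and> same_signs Q y y'" for y y'
    by (auto simp: same_signs_def)
  have "\<exists>y'. same_signs (insert (p, p') Q) y y'" for y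
    using sign_similar_left[OF sim, of y] meets[of y] unfolding ins by force
  moreover have "\<exists>y. same_signs (insert (p, p') Q) y y'" for y'
    using sign_similar_right[OF sim, of y'] sw.meets[of y'] unfolding ins same_signs_swap by force
  moreover have "same_signs (insert (p, p') Q) y1 y2' \<and> same_signs (insert (p, p') Q) y2 y1'"
    if "y1 \<le> y2" "y2' \<le> y1'" "same_signs (insert (p, p') Q) y1 y1'" "same_signs (insert (p, p') Q) y2 y2'"
    for y1 y2 y1' y2'
  proof -
    have m: "same_signs Q y1 y1'" "same_signs Q y2 y2'"
      and s: "sgn (poly p y1) = sgn (poly p' y1')" "sgn (poly p y2) = sgn (poly p' y2')"
      using that(3,4) unfolding ins by auto
    show ?thesis
      using sgn_cell[OF that(1,2) m s] sign_similar_C[OF sim that(1,2) m] unfolding ins by blast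
  qed
  ultimately show ?thesis unfolding sign_similar_def by blast
qed

end

section \<open>Quantifier elimination\<close>

locale function_ring =
  fixes R :: "('x \<Rightarrow> real) set"
  assumes const: "(\<lambda>_. c) \<in> R"
    and add: "f \<in> R \<Longrightarrow> g \<in> R \<Longrightarrow> (\<lambda>x. f x + g x) \<in> R"
    and mult: "f \<in> R \<Longrightarrow> g \<in> R \<Longrightarrow> (\<lambda>x. f x * g x) \<in> R"
begin

lemma diff: "f \<in> R \<Longrightarrow> g \<in> R \<Longrightarrow> (\<lambda>x. f x - g x) \<in> R"
  using add[of f "\<lambda>x. (- 1) * g x"] mult[OF const[of "- 1"], of g] by simp

lemma sum: "(\<And>i. i \<in> I \<Longrightarrow> f i \<in> R) \<Longrightarrow> (\<lambda>x. \<Sum>i\<in>I. f i x) \<in> R"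
  by (induction I rule: infinite_finite_induct) (auto intro: const add)

text \<open>\<open>d\<close> is only a formal degree: the coefficient of order \<open>d\<close> may
  vanish at some parameters. This is why the families below consist of pairs of a degree and a
  polynomial.\<close>

definition fpoly :: "nat \<Rightarrow> ('x \<Rightarrow> real poly) set" where
  "fpoly d = {p. (\<forall>x. degree (p x) \<le> d) \<and> (\<forall>j. (\<lambda>x. coeff (p x) j) \<in> R)}"

lemma fpolyI: "(\<And>x. degree (p x) \<le> d) \<Longrightarrow> (\<And>j. (\<lambda>x. coeff (p x) j) \<in> R) \<Longrightarrow> p \<in> fpoly d"
  and fpoly_degree: "p \<in> fpoly d \<Longrightarrow> degree (p x) \<le> d"
  and fpoly_coeff: "p \<in> fpoly d \<Longrightarrow> (\<lambda>x. coeff (p x) j) \<in> R"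
  by (auto simp: fpoly_def)

lemma fpoly_mono: "p \<in> fpoly d \<Longrightarrow> d \<le> e \<Longrightarrow> p \<in> fpoly e"
  by (auto simp: fpoly_def intro: order_trans)

lemma fpoly_const:
  assumes "f \<in> R"
  shows "(\<lambda>x. [:f x:]) \<in> fpoly d"
proof (rule fpolyI)
  show "(\<lambda>x. coeff [:f x:] j) \<in> R" for j
    by (cases j) (auto simp: assms const)
qed simp

lemma fpoly_X: "(\<lambda>x. [:0, 1:]) \<in> fpoly 1"
  by (rule fpolyI) (auto simp: const)

lemma fpoly_add: "p \<in> fpoly d \<Longrightarrow> q \<in> fpoly e \<Longrightarrow> (\<lambda>x. p x + q x) \<in> fpoly (max d e)"
  by (rule fpolyI) (auto intro!: degree_add_le add intro: fpoly_coeff fpoly_degree le_max_iff_disj[THEN iffD2])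

lemma fpoly_mult: "p \<in> fpoly d \<Longrightarrow> q \<in> fpoly e \<Longrightarrow> (\<lambda>x. p x * q x) \<in> fpoly (d + e)"
  by (rule fpolyI, rule order_trans[OF degree_mult_le])
     (auto simp: coeff_mult intro!: sum mult fpoly_coeff add_mono fpoly_degree)

lemma fpoly_pderiv: "p \<in> fpoly d \<Longrightarrow> (\<lambda>x. pderiv (p x)) \<in> fpoly (d - 1)"
  by (rule fpolyI) (auto simp: degree_pderiv coeff_pderiv intro!: mult[OF const] fpoly_coeff diff_le_mono fpoly_degree)

definition truncate :: "nat \<Rightarrow> ('x \<Rightarrow> real poly) \<Rightarrow> 'x \<Rightarrow> real poly" where
  "truncate d p x = p x - monom (coeff (p x) d) d"

lemma degree_le_pred:
  fixes q :: "real poly"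
  assumes "degree q \<le> d" "coeff q d = 0" "d > 0"
  shows "degree q \<le> d - 1"
  using assms by (metis Suc_pred' eq_zero_or_degree_less degree_0 le_zero_eq less_Suc_eq_le zero_le)

lemma fpoly_truncate: "p \<in> fpoly d \<Longrightarrow> d > 0 \<Longrightarrow> truncate d p \<in> fpoly (d - 1)"
proof (rule fpolyI)
  assume p: "p \<in> fpoly d" "d > 0"
  show "degree (truncate d p x) \<le> d - 1" for x
    unfolding truncate_def using p
    by (intro degree_le_pred degree_diff_le degree_monom_le) (auto intro: fpoly_degree)
  show "(\<lambda>x. coeff (truncate d p x) j) \<in> R" for j
    using p by (cases "d = j") (auto simp: truncate_def const intro: fpoly_coeff)
qed

text \<open>Each reduction multiplies \<open>p\<close> by the square of the formal leading
  coefficient of \<open>q\<close>, rather than by that coefficient, so that signs at the zeros of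
  \<open>q\<close> survive.\<close>

lemma pseudo_remainder:
  assumes q: "q \<in> fpoly e" "e > 0" and p: "p \<in> fpoly d"
  shows "\<exists>r\<in>fpoly (e - 1). \<forall>x z. coeff (q x) e \<noteq> 0 \<longrightarrow> poly (q x) z = 0 \<longrightarrow> sgn (poly (r x) z) = sgn (poly (p x) z)"
  using p
proof (induction d arbitrary: p rule: less_induct)
  case (less d)
  show ?case
  proof (cases "d < e")
    case True
    then show ?thesis using fpoly_mono[OF less.prems, of "e - 1"] by auto
  next
    case False
    define c where "c x = coeff (q x) e" for x
    define a where "a x = coeff (p x) d" for x
    define p1 where "p1 x = [:c x * c x:] * p x - monom (a x * c x) (d - e) * q x" for x
    have cR: "c \<in> R" "a \<in> R"
      using fpoly_coeff[OF q(1), of e] fpoly_coeff[OF less.prems, of d] by (simp_all add: c_def[abs_def] a_def[abs_def])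
    have lead: "coeff (monom (a x * c x) (d - e) * q x) d = a x * c x * c x" for x
      using False by (simp add: coeff_monom_mult c_def)
    have "p1 \<in> fpoly (d - 1)"
    proof (rule fpolyI)
      fix x
      have "degree (monom (a x * c x) (d - e) * q x) \<le> (d - e) + e"
        by (rule order_trans[OF degree_mult_le]) (intro add_mono degree_monom_le fpoly_degree q)
      moreover have "degree ([:c x * c x:] * p x) \<le> d"
        by (rule order_trans[OF degree_mult_le]) (simp add: fpoly_degree less.prems)
      ultimately show "degree (p1 x) \<le> d - 1"
        unfolding p1_def using False q(2) lead[of x]
        by (intro degree_le_pred degree_diff_le) (auto simp: a_def algebra_simps)
    next
      fix j
      have "(\<lambda>x. c x * c x * coeff (p x) j - (if j < d - e then 0 else a x * c x * coeff (q x) (j - (d - e)))) \<in> R"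
        by (cases "j < d - e") (auto intro!: diff mult cR const fpoly_coeff q less.prems)
      then show "(\<lambda>x. coeff (p1 x) j) \<in> R"
        by (simp add: p1_def coeff_monom_mult if_distrib cong: if_cong)
    qed
    moreover have "d - 1 < d" using False q(2) by simp
    ultimately obtain r where r: "r \<in> fpoly (e - 1)"
      "\<And>x z. c x \<noteq> 0 \<Longrightarrow> poly (q x) z = 0 \<Longrightarrow> sgn (poly (r x) z) = sgn (poly (p1 x) z)"
      using less.IH[of "d - 1" p1] unfolding c_def by blast
    have "sgn (poly (p1 x) z) = sgn (poly (p x) z)" if "c x \<noteq> 0" "poly (q x) z = 0" for x z
    proof -
      have "poly (p1 x) z = (c x * c x) * poly (p x) z" using that by (simp add: p1_def)
      moreover have "c x * c x > 0" using that(1) by (auto simp: zero_less_mult_iff linorder_neq_iff)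
      ultimately show ?thesis using sgn_mult[of "c x * c x" "poly (p x) z"] by simp
    qed
    then show ?thesis using r unfolding c_def by (intro bexI[of _ r]) auto
  qed
qed

text \<open>A fixed choice makes the remainder a function of its arguments, so that finite families
  have finite derived families.\<close>

definition prem :: "nat \<Rightarrow> ('x \<Rightarrow> real poly) \<Rightarrow> ('x \<Rightarrow> real poly) \<Rightarrow> 'x \<Rightarrow> real poly" where
  "prem e q p = (SOME r. r \<in> fpoly (e - 1) \<and>
     (\<forall>x z. coeff (q x) e \<noteq> 0 \<longrightarrow> poly (q x) z = 0 \<longrightarrow> sgn (poly (r x) z) = sgn (poly (p x) z)))"

lemma prem:
  assumes "q \<in> fpoly e" "e > 0" and "p \<in> fpoly d"
  shows fpoly_prem: "prem e q p \<in> fpoly (e - 1)"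
    and sgn_prem: "coeff (q x) e \<noteq> 0 \<Longrightarrow> poly (q x) z = 0 \<Longrightarrow> sgn (poly (prem e q p x) z) = sgn (poly (p x) z)"
  using someI_ex[OF pseudo_remainder[OF assms, unfolded Bex_def]] unfolding prem_def by blast+

text \<open>Every operation applied to a polynomial of formal degree \<open>e\<close> yields formal degree \<open>e - 1\<close>, and
  divides only polynomials of formal degree at least \<open>e\<close>; so the closure is reached by
  descending once through the degrees.\<close>

definition derived :: "nat \<Rightarrow> (nat \<times> ('x \<Rightarrow> real poly)) set \<Rightarrow> (nat \<times> ('x \<Rightarrow> real poly)) set" where
  "derived e S = {(e - 1, r) | r q. (e, q) \<in> S \<and> e > 0 \<and>
     (r = truncate e q \<or> r = (\<lambda>x. pderiv (q x)) \<or> (\<exists>d p. e \<le> d \<and> (d, p) \<in> S \<and> r = prem e q p))}"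

definition formal :: "(nat \<times> ('x \<Rightarrow> real poly)) set \<Rightarrow> bool" where
  "formal S \<longleftrightarrow> finite S \<and> (\<forall>(d, p)\<in>S. p \<in> fpoly d)"

lemma formal_derived:
  assumes "formal S"
  shows "formal (derived e S)"
proof -
  let ?f = "\<lambda>q. (e - 1, truncate e q)" and ?g = "\<lambda>q. (e - 1, \<lambda>x. pderiv (q x))"
    and ?h = "\<lambda>(q, p). (e - 1, prem e q p)"
  have "u \<in> ?f ` snd ` S \<union> ?g ` snd ` S \<union> ?h ` (snd ` S \<times> snd ` S)" if "u \<in> derived e S" for u
  proof -
    from that obtain q r where u: "u = (e - 1, r)" and q: "(e, q) \<in> S"
      and r: "r = truncate e q \<or> r = (\<lambda>x. pderiv (q x)) \<or> (\<exists>d p. e \<le> d \<and> (d, p) \<in> S \<and> r = prem e q p)"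
      unfolding derived_def by blast
    have qS: "q \<in> snd ` S" using q by (rule image_eqI[rotated]) simp
    from r show ?thesis
    proof (elim disjE exE conjE)
      fix d p assume "(d, p) \<in> S" "r = prem e q p"
      then have "p \<in> snd ` S" by (intro image_eqI[of _ _ "(d, p)"]) simp_all
      then have "u \<in> ?h ` (snd ` S \<times> snd ` S)"
        using qS u \<open>r = prem e q p\<close> by (intro image_eqI[of _ _ "(q, p)"]) simp_all
      then show ?thesis by blast
    qed (use qS u in blast)+
  qed
  then have "derived e S \<subseteq> ?f ` snd ` S \<union> ?g ` snd ` S \<union> ?h ` (snd ` S \<times> snd ` S)" by blast
  moreover have "finite S" using assms by (simp add: formal_def)
  ultimately have "finite (derived e S)"
    by (elim finite_subset) (intro finite_UnI finite_imageI finite_cartesian_product)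
  then show ?thesis
    using assms unfolding formal_def derived_def
    by (auto intro: fpoly_truncate[simplified] fpoly_pderiv[simplified] fpoly_prem[simplified])
qed

lemma degree_derived: "(d, p) \<in> derived e S \<Longrightarrow> d = e - 1 \<and> e > 0"
  unfolding derived_def by auto

lemma derived_cong:
  assumes "\<And>d p. e \<le> d \<Longrightarrow> (d, p) \<in> S \<longleftrightarrow> (d, p) \<in> T"
  shows "derived e S = derived e T"
  unfolding derived_def by (simp add: assms cong: conj_cong)

lemma derived_closure_upto:
  assumes "formal S"
  shows "\<exists>T. S \<subseteq> T \<and> formal T \<and> (\<forall>d p. (d, p) \<in> T \<longrightarrow> (d, p) \<in> S \<or> d < e) \<and> (\<forall>e'\<le>e. derived e' T \<subseteq> T)"
  using assms
proof (induction e arbitrary: S)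
  case 0
  then show ?case by (intro exI[of _ S]) (auto simp: derived_def)
next
  case (Suc e)
  have "formal (S \<union> derived (Suc e) S)"
    using Suc.prems formal_derived[of S "Suc e"] by (auto simp: formal_def)
  then obtain T where T: "S \<union> derived (Suc e) S \<subseteq> T" "formal T"
    "\<forall>d p. (d, p) \<in> T \<longrightarrow> (d, p) \<in> S \<union> derived (Suc e) S \<or> d < e" "\<forall>e'\<le>e. derived e' T \<subseteq> T"
    using Suc.IH by meson
  have "(d, p) \<in> T \<longrightarrow> (d, p) \<in> S \<or> d < Suc e" for d p
    using T(3)[rule_format, of d p] degree_derived[of d p "Suc e" S] by auto
  \<comment> \<open>Whatever the closure adds later has formal degree at most \<open>e\<close>,
    while \<open>derived (Suc e)\<close> reads only degrees above \<open>e\<close>.\<close>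
  moreover from this have "derived (Suc e) T = derived (Suc e) S"
    using T(1) by (intro derived_cong) fastforce
  ultimately show ?case using T by (intro exI[of _ T]) (auto simp: le_Suc_eq)
qed

lemma derived_closure:
  assumes "formal S"
  obtains T where "S \<subseteq> T" "formal T" "\<And>e. derived e T \<subseteq> T"
proof -
  have "finite S" using assms by (simp add: formal_def)
  define e where "e = Max (insert 0 (fst ` S))"
  have e: "d \<le> e" if "(d, p) \<in> S" for d p
    unfolding e_def using \<open>finite S\<close> that by (intro Max_ge) (auto intro: image_eqI[of _ _ "(d, p)"])
  obtain T where T: "S \<subseteq> T" "formal T" "\<And>d p. (d, p) \<in> T \<Longrightarrow> (d, p) \<in> S \<or> d < e" "\<forall>e'\<le>e. derived e' T \<subseteq> T"
    using derived_closure_upto[OF assms, of e] by blast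
  have "derived e' T = {}" if "e' > e" for e'
    using T(3)[of e'] e[of e'] that unfolding derived_def by fastforce
  then show ?thesis using T that by (metis empty_subsetI not_le)
qed

text \<open>The semantic counterpart of a quantifier-free formula over the signs of
  \<open>G\<close>. One implication suffices because the sign condition is symmetric in
  \<open>x\<close> and \<open>x'\<close>.\<close>

definition determined :: "('x \<Rightarrow> bool) \<Rightarrow> bool" where
  "determined P \<longleftrightarrow> (\<exists>G. finite G \<and> G \<subseteq> R \<and>
     (\<forall>x x'. (\<forall>g\<in>G. sgn (g x) = sgn (g x')) \<longrightarrow> P x \<longrightarrow> P x'))"

context
  fixes T :: "(nat \<times> ('x \<Rightarrow> real poly)) set" and x x' :: 'x
  assumes T: "formal T" and closed: "\<And>e. derived e T \<subseteq> T"
    and signs: "\<And>d p j. (d, p) \<in> T \<Longrightarrow> j \<le> d \<Longrightarrow> sgn (coeff (p x) j) = sgn (coeff (p x') j)"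
begin

abbreviation pairs :: "(nat \<times> ('x \<Rightarrow> real poly)) set \<Rightarrow> (real poly \<times> real poly) set" where
  "pairs S \<equiv> (\<lambda>(d, p). (p x, p x')) ` S"

lemma coeff_signs:
  assumes "(d, p) \<in> T"
  shows "sgn (coeff (p x) j) = sgn (coeff (p x') j)"
proof (cases "j \<le> d")
  case False
  have "p \<in> fpoly d" using assms T by (auto simp: formal_def)
  then have "degree (p x) < j" "degree (p x') < j"
    using False fpoly_degree[of p d] by (meson le_less_trans not_le)+
  then show ?thesis by (simp add: coeff_eq_0)
qed (use signs assms in blast)

lemma pairs_zero_iff: "(d, p) \<in> T \<Longrightarrow> p x = 0 \<longleftrightarrow> p x' = 0"
  using coeff_signs[of d p] by (simp add: poly_eq_iff) (metis sgn_zero_iff)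

text \<open>Vanishing formal leading terms are stripped one by one. Equal coefficient signs make
  them vanish at both parameters at once, so one element of \<open>T\<close> serves both.\<close>

lemma full_degree:
  assumes "(d, q) \<in> T" "q x \<noteq> 0"
  shows "\<exists>e r. e \<le> d \<and> (e, r) \<in> T \<and> r x = q x \<and> r x' = q x' \<and> coeff (r x) e \<noteq> 0"
  using assms
proof (induction d arbitrary: q rule: less_induct)
  case (less d)
  show ?case
  proof (cases "coeff (q x) d = 0")
    case True
    then have z': "coeff (q x') d = 0" using coeff_signs[OF less.prems(1), of d] by (simp add: sgn_zero_iff)
    have "d > 0"
    proof (rule ccontr)
      assume "\<not> d > 0"
      then have "degree (q x) = 0" using fpoly_degree[of q d x] T less.prems(1) by (auto simp: formal_def)
      then show False using True \<open>\<not> d > 0\<close> less.prems(2) by (elim degree_eq_zeroE) simp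
    qed
    then have "(d - 1, truncate d q) \<in> derived d T" using less.prems(1) unfolding derived_def by blast
    then have "(d - 1, truncate d q) \<in> T" using closed by blast
    moreover have "truncate d q x = q x" "truncate d q x' = q x'" using True z' by (simp_all add: truncate_def)
    ultimately obtain e r where "e \<le> d - 1" "(e, r) \<in> T" "r x = q x" "r x' = q x'" "coeff (r x) e \<noteq> 0"
      using less.IH[of "d - 1" "truncate d q"] less.prems(2) \<open>d > 0\<close> by auto
    then show ?thesis by (intro exI[of _ e] exI[of _ r]) simp
  qed (use less.prems in blast)
qed

text \<open>A vanishing formal leading coefficient makes \<open>p\<close> coincide with a truncation
  already present. Otherwise the derivative of \<open>p\<close> and its remainders modulo elements
  of \<open>T\<close> of degree at most \<open>e\<close> lie in \<open>S\<close> and provide what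
  \<open>sign_extension\<close> asks for.\<close>

lemma sign_similar_step:
  assumes S: "S \<subseteq> T" "\<And>d p. (d, p) \<in> T \<Longrightarrow> d < e \<Longrightarrow> (d, p) \<in> S" "\<And>d p. (d, p) \<in> S \<Longrightarrow> d \<le> e"
    and sim: "sign_similar (pairs S)" and p: "(e, p) \<in> T"
  shows "sign_similar (pairs (insert (e, p) S))"
proof -
  have deg: "degree (p x) \<le> e" "degree (p x') \<le> e" "p \<in> fpoly e"
    using p T fpoly_degree[of p e] by (auto simp: formal_def)
  have pairsD: "sgn (poly (q x) y) = sgn (poly (q x') y')" if "same_signs (pairs S) y y'" "(d, q) \<in> S" for d q y y'
    using that unfolding same_signs_def by force
  consider "e = 0" | "e > 0" "coeff (p x) e = 0" | "e > 0" "coeff (p x) e \<noteq> 0" by blast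
  then show ?thesis
  proof cases
    case 1
    have "degree (p x) = 0" "degree (p x') = 0" using deg 1 by simp_all
    then obtain c c' where "p x = [:c:]" "p x' = [:c':]" by (elim degree_eq_zeroE)
    then have "sgn (poly (p x) y) = sgn (poly (p x') y')" for y y'
      using coeff_signs[OF p, of 0] by simp
    then have "same_signs (pairs (insert (e, p) S)) = same_signs (pairs S)"
      by (intro ext) (auto simp: same_signs_def)
    then show ?thesis using sim unfolding sign_similar_def by simp
  next
    case 2
    then have "coeff (p x') e = 0" using coeff_signs[OF p, of e] by (simp add: sgn_zero_iff)
    then have t: "truncate e p x = p x" "truncate e p x' = p x'" using 2 by (simp_all add: truncate_def)
    have "(e - 1, truncate e p) \<in> derived e T" using p 2 unfolding derived_def by blast
    then have "(e - 1, truncate e p) \<in> S" using closed S(2) 2 by force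
    then have "(p x, p x') \<in> pairs S" using t by (force intro: image_eqI[of _ _ "(e - 1, truncate e p)"])
    then have "pairs (insert (e, p) S) = pairs S" by auto
    then show ?thesis using sim by simp
  next
    case 3
    then have "coeff (p x') e \<noteq> 0" using coeff_signs[OF p, of e] by (auto simp: sgn_if split: if_splits)
    then have dp: "degree (p x) > 0" "degree (p x') > 0"
      using 3 le_degree[of "p x" e] le_degree[of "p x'" e] by linarith+
    have "(e - 1, \<lambda>x. pderiv (p x)) \<in> derived e T" using p 3 unfolding derived_def by blast
    then have D: "(e - 1, \<lambda>x. pderiv (p x)) \<in> S" using closed S(2) 3 by force
    interpret sign_extension "pairs S" "p x" "p x'"
    proof
      show "finite (pairs S)" using S(1) T unfolding formal_def by (meson finite_imageI finite_subset)
      show "a = 0 \<longleftrightarrow> b = 0" if "(a, b) \<in> pairs S" for a b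
        using that S(1) pairs_zero_iff by auto
      show "sgn (poly (pderiv (p x)) y) = sgn (poly (pderiv (p x')) y')" if "same_signs (pairs S) y y'" for y y'
        using pairsD[OF that D] .
      show "\<exists>(a, b)\<in>pairs S. a \<noteq> 0 \<and> poly a y = 0" if "poly (pderiv (p x)) y = 0" for y
        using D that dp by (force simp: pderiv_eq_0_iff)
      show "sgn (poly (p x) y) = sgn (poly (p x') y')"
        if m: "same_signs (pairs S) y y'" and ab: "(a, b) \<in> pairs S" "a \<noteq> 0" "poly a y = 0" for y y' a b
      proof -
        obtain d q where q: "(d, q) \<in> S" "a = q x" using ab(1) by auto
        \<comment> \<open>Division needs a divisor whose formal leading coefficient is nonzero at
          both parameters.\<close>
        then obtain d' r where r: "d' \<le> d" "(d', r) \<in> T" "r x = q x" "r x' = q x'" "coeff (r x) d' \<noteq> 0"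
          using full_degree[of d q] S(1) ab(2) by blast
        have rf: "r \<in> fpoly d'" using r(2) T by (auto simp: formal_def)
        have z: "poly (r x) y = 0" using ab(3) q(2) r(3) by simp
        then have z': "poly (r x') y' = 0" using pairsD[OF m q(1)] r(3,4) by (simp add: sgn_zero_iff)
        have c': "coeff (r x') d' \<noteq> 0" using coeff_signs[OF r(2), of d'] r(5) by (auto simp: sgn_if split: if_splits)
        have "d' > 0"
        proof (rule ccontr)
          assume "\<not> d' > 0"
          then have "degree (r x) = 0" using fpoly_degree[OF rf, of x] by simp
          then show False using z r(5) \<open>\<not> d' > 0\<close> by (elim degree_eq_zeroE) simp
        qed
        moreover have "d' \<le> e" using r(1) S(3)[OF q(1)] by simp
        ultimately have "(d' - 1, prem d' r p) \<in> derived d' T" using p r(2) unfolding derived_def by blast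
        then have "(d' - 1, prem d' r p) \<in> S" using closed S(2) \<open>d' \<le> e\<close> \<open>d' > 0\<close> by force
        from pairsD[OF m this] show ?thesis
          using sgn_prem[OF rf \<open>d' > 0\<close> deg(3) r(5) z] sgn_prem[OF rf \<open>d' > 0\<close> deg(3) c' z'] by simp
      qed
    qed (use sim dp in auto)
    show ?thesis using sign_similar_insert by simp
  qed
qed

lemma sign_similar_below: "sign_similar (pairs {(d, p) \<in> T. d < e})"
proof (induction e)
  case 0
  then show ?case by (simp add: sign_similar_def same_signs_def)
next
  case (Suc e)
  have "sign_similar (pairs ({(d, p) \<in> T. d < e} \<union> U))" if "finite U" "U \<subseteq> {(d, p) \<in> T. d = e}" for U
    using that
  proof (induction U rule: finite_induct)
    case empty
    then show ?case using Suc.IH by simp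
  next
    case (insert u U)
    then show ?case using sign_similar_step[of "{(d, p) \<in> T. d < e} \<union> U" e "snd u"] by force
  qed
  moreover have "{(d, p) \<in> T. d < Suc e} = {(d, p) \<in> T. d < e} \<union> {(d, p) \<in> T. d = e}" by auto
  moreover have "finite {(d, p) \<in> T. d = e}"
    by (rule finite_subset[of _ T]) (use T in \<open>auto simp: formal_def\<close>)
  ultimately show ?case by simp
qed

lemma sign_similar_closed: "sign_similar (pairs T)"
proof -
  have "finite T" using T by (simp add: formal_def)
  then have "{(d, p) \<in> T. d < Suc (Max (fst ` T))} = T"
    by (auto simp: less_Suc_eq_le intro!: Max_ge image_eqI[of _ fst])
  then show ?thesis using sign_similar_below[of "Suc (Max (fst ` T))"] by simp
qed

end

text \<open>The coefficients of the closure of \<open>F\<close> under \<open>derived\<close> are the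
  ring elements sought: equal signs of all of them make the two specialized families sign-similar,
  and so every \<open>y\<close> has a match \<open>y'\<close>.\<close>

theorem quantifier_elimination:
  assumes "finite F" and F: "\<And>p. p \<in> F \<Longrightarrow> \<exists>d. p \<in> fpoly d"
    and Q: "\<And>x x' y y'. (\<And>p. p \<in> F \<Longrightarrow> sgn (poly (p x) y) = sgn (poly (p x') y')) \<Longrightarrow> Q x y \<Longrightarrow> Q x' y'"
  shows "determined (\<lambda>x. \<exists>y. Q x y)"
proof -
  obtain deg where deg: "\<And>p. p \<in> F \<Longrightarrow> p \<in> fpoly (deg p)" using F by metis
  have "formal ((\<lambda>p. (deg p, p)) ` F)" using assms(1) deg by (auto simp: formal_def)
  then obtain T where T: "(\<lambda>p. (deg p, p)) ` F \<subseteq> T" "formal T" "\<And>e. derived e T \<subseteq> T"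
    by (rule derived_closure) blast
  define G where "G = (\<Union>(d, p)\<in>T. (\<lambda>j x. coeff (p x) j) ` {..d})"
  have G: "finite G" "G \<subseteq> R"
    using T(2) fpoly_coeff unfolding G_def formal_def by (auto split: prod.splits)
  have "\<exists>y'. Q x' y'" if "\<forall>g\<in>G. sgn (g x) = sgn (g x')" "Q x y" for x x' y
  proof -
    have "sign_similar ((\<lambda>(d, p). (p x, p x')) ` T)"
      by (rule sign_similar_closed[OF T(2,3)]) (use that(1) in \<open>fastforce simp: G_def\<close>)
    then obtain y' where "same_signs ((\<lambda>(d, p). (p x, p x')) ` T) y y'" using sign_similar_left by blast
    then have "sgn (poly (p x) y) = sgn (poly (p x') y')" if "p \<in> F" for p
      using T(1) that unfolding same_signs_def by fastforce
    then show ?thesis using Q that(2) by blast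
  qed
  then show ?thesis
    unfolding determined_def by (intro exI[of _ G] conjI allI impI G) (elim exE, simp only:)
qed

end

section \<open>First-order combinations of sign conditions\<close>

context function_ring
begin

lemma determinedE:
  assumes "determined P"
  obtains G where "finite G" "G \<subseteq> R" "\<And>x x'. (\<And>g. g \<in> G \<Longrightarrow> sgn (g x) = sgn (g x')) \<Longrightarrow> P x \<longleftrightarrow> P x'"
proof -
  obtain G where G: "finite G" "G \<subseteq> R" "\<And>x x'. (\<forall>g\<in>G. sgn (g x) = sgn (g x')) \<Longrightarrow> P x \<Longrightarrow> P x'"
    using assms unfolding determined_def by blast
  have "P x \<longleftrightarrow> P x'" if "\<And>g. g \<in> G \<Longrightarrow> sgn (g x) = sgn (g x')" for x x'
    using G(3)[of x x'] G(3)[of x' x] that by auto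
  then show ?thesis using that G(1,2) by blast
qed

lemma determinedI:
  assumes "finite G" "G \<subseteq> R" "\<And>x x'. (\<And>g. g \<in> G \<Longrightarrow> sgn (g x) = sgn (g x')) \<Longrightarrow> P x \<Longrightarrow> P x'"
  shows "determined P"
  unfolding determined_def by (intro exI[of _ G] conjI allI impI assms(1,2)) (rule assms(3), auto)

lemma determined_const [intro]: "determined (\<lambda>_. b)"
  by (rule determinedI[of "{}"]) auto

lemma determined_less [intro]:
  assumes "f \<in> R" "g \<in> R"
  shows "determined (\<lambda>x. f x < g x)"
proof (rule determinedI[of "{\<lambda>x. f x - g x}"])
  show "f x' < g x'" if "\<And>h. h \<in> {\<lambda>x. f x - g x} \<Longrightarrow> sgn (h x) = sgn (h x')" "f x < g x" for x x'
    using that(1)[OF singletonI] that(2) by (simp add: sgn_if split: if_splits)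
qed (use assms diff in auto)

lemma determined_not [intro]:
  assumes "determined P"
  shows "determined (\<lambda>x. \<not> P x)"
proof -
  from assms obtain G where G: "finite G" "G \<subseteq> R" "\<And>x x'. (\<And>g. g \<in> G \<Longrightarrow> sgn (g x) = sgn (g x')) \<Longrightarrow> P x \<longleftrightarrow> P x'"
    by (rule determinedE) blast
  show ?thesis
  proof (rule determinedI[OF G(1,2)])
    show "\<not> P x'" if "\<And>g. g \<in> G \<Longrightarrow> sgn (g x) = sgn (g x')" "\<not> P x" for x x'
      using G(3)[of x x'] that by simp
  qed
qed

lemma determined_conj [intro]:
  assumes "determined P" "determined Q"
  shows "determined (\<lambda>x. P x \<and> Q x)"
proof -
  from assms(1) obtain G where G: "finite G" "G \<subseteq> R" "\<And>x x'. (\<And>g. g \<in> G \<Longrightarrow> sgn (g x) = sgn (g x')) \<Longrightarrow> P x \<longleftrightarrow> P x'"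
    by (rule determinedE) blast
  from assms(2) obtain H where H: "finite H" "H \<subseteq> R" "\<And>x x'. (\<And>g. g \<in> H \<Longrightarrow> sgn (g x) = sgn (g x')) \<Longrightarrow> Q x \<longleftrightarrow> Q x'"
    by (rule determinedE) blast
  show ?thesis
  proof (rule determinedI[of "G \<union> H"])
    show "P x' \<and> Q x'" if "\<And>g. g \<in> G \<union> H \<Longrightarrow> sgn (g x) = sgn (g x')" "P x \<and> Q x" for x x'
      using G(3)[of x x'] H(3)[of x x'] that by simp
  qed (use G H in auto)
qed

lemma determined_disj [intro]: "determined P \<Longrightarrow> determined Q \<Longrightarrow> determined (\<lambda>x. P x \<or> Q x)"
  using determined_not[OF determined_conj[OF determined_not determined_not], of P Q] by simp

lemma determined_imp [intro]: "determined P \<Longrightarrow> determined Q \<Longrightarrow> determined (\<lambda>x. P x \<longrightarrow> Q x)"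
  using determined_disj[OF determined_not, of P Q] by (simp only: imp_conv_disj)

lemma determined_le [intro]: "f \<in> R \<Longrightarrow> g \<in> R \<Longrightarrow> determined (\<lambda>x. f x \<le> g x)"
  using determined_not[OF determined_less, of g f] by (simp add: not_less)

lemma determined_eq [intro]: "f \<in> R \<Longrightarrow> g \<in> R \<Longrightarrow> determined (\<lambda>x. f x = g x)"
  using determined_conj[OF determined_le determined_le, of f g g f] by (simp add: order_eq_iff)

lemma determined_ball [intro]: "finite I \<Longrightarrow> (\<And>i. i \<in> I \<Longrightarrow> determined (P i)) \<Longrightarrow> determined (\<lambda>x. \<forall>i\<in>I. P i x)"
  by (induction I rule: finite_induct) auto

lemma determined_bex [intro]: "finite I \<Longrightarrow> (\<And>i. i \<in> I \<Longrightarrow> determined (P i)) \<Longrightarrow> determined (\<lambda>x. \<exists>i\<in>I. P i x)"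
  by (induction I rule: finite_induct) auto

lemma determined_comp:
  assumes "determined P" "\<And>g. g \<in> R \<Longrightarrow> (\<lambda>x. g (\<tau> x)) \<in> R"
  shows "determined (\<lambda>x. P (\<tau> x))"
proof -
  from assms(1) obtain G where G: "finite G" "G \<subseteq> R" "\<And>x x'. (\<And>g. g \<in> G \<Longrightarrow> sgn (g x) = sgn (g x')) \<Longrightarrow> P x \<longleftrightarrow> P x'"
    by (rule determinedE) blast
  show ?thesis
  proof (rule determinedI[of "(\<lambda>g x. g (\<tau> x)) ` G"])
    show "P (\<tau> x')" if "\<And>h. h \<in> (\<lambda>g x. g (\<tau> x)) ` G \<Longrightarrow> sgn (h x) = sgn (h x')" "P (\<tau> x)" for x x'
      using G(3)[of "\<tau> x" "\<tau> x'", OF that(1)[OF imageI]] that(2) by simp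
  qed (use G assms(2) in auto)
qed

text \<open>\<open>\<tau>\<close> substitutes a scalar \<open>y\<close> into the parameter. Along
  \<open>y\<close> every ring element becomes a polynomial whose coefficients are again ring
  elements.\<close>

lemma determined_family:
  assumes "determined P" and \<tau>: "\<And>g. g \<in> R \<Longrightarrow> \<exists>d. \<exists>p\<in>fpoly d. \<forall>x y. g (\<tau> x y) = poly (p x) y"
  obtains F where "finite F" "\<forall>p\<in>F. \<exists>d. p \<in> fpoly d"
    "\<forall>x x' y y'. (\<forall>p\<in>F. sgn (poly (p x) y) = sgn (poly (p x') y')) \<longrightarrow> (P (\<tau> x y) \<longleftrightarrow> P (\<tau> x' y'))"
proof -
  from assms(1) obtain G where G: "finite G" "G \<subseteq> R" "\<And>x x'. (\<And>g. g \<in> G \<Longrightarrow> sgn (g x) = sgn (g x')) \<Longrightarrow> P x \<longleftrightarrow> P x'"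
    by (rule determinedE) blast
  obtain p where p: "\<And>g. g \<in> G \<Longrightarrow> \<exists>d. p g \<in> fpoly d" "\<And>g x y. g \<in> G \<Longrightarrow> g (\<tau> x y) = poly (p g x) y"
    using \<tau> G(2) by (metis subsetD)
  have "P (\<tau> x y) \<longleftrightarrow> P (\<tau> x' y')"
    if "\<forall>q\<in>p ` G. sgn (poly (q x) y) = sgn (poly (q x') y')" for x x' y y'
    using that p(2) by (intro G(3)) simp
  moreover have "finite (p ` G)" "\<forall>q\<in>p ` G. \<exists>d. q \<in> fpoly d" using G(1) p(1) by simp_all
  ultimately show ?thesis by (intro that[of "p ` G"] allI impI)
qed

lemma determined_ex:
  assumes "determined P" and "\<And>g. g \<in> R \<Longrightarrow> \<exists>d. \<exists>p\<in>fpoly d. \<forall>x y. g (\<tau> x y) = poly (p x) y"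
  shows "determined (\<lambda>x. \<exists>y. P (\<tau> x y))"
proof -
  obtain F where F: "finite F" "\<forall>p\<in>F. \<exists>d. p \<in> fpoly d"
    "\<forall>x x' y y'. (\<forall>p\<in>F. sgn (poly (p x) y) = sgn (poly (p x') y')) \<longrightarrow> (P (\<tau> x y) \<longleftrightarrow> P (\<tau> x' y'))"
    by (rule determined_family[of P \<tau>, OF assms])
  show ?thesis
  proof (rule quantifier_elimination[OF F(1)])
    show "P (\<tau> x' y')" if "\<And>p. p \<in> F \<Longrightarrow> sgn (poly (p x) y) = sgn (poly (p x') y')" "P (\<tau> x y)" for x x' y y'
      using F(3)[rule_format, of x y x' y'] that by blast
  qed (use F(2) in blast)
qed

text \<open>A root shared by two consecutive intervals is counted once as a left and once as a right end,
  whence the flag.\<close>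

lemma bounded_crossings:
  assumes "determined P" and "\<And>g. g \<in> R \<Longrightarrow> \<exists>d. \<exists>p\<in>fpoly d. \<forall>x y. g (\<tau> x y) = poly (p x) y"
  obtains M where "\<And>x N t. (\<And>j. j < N \<Longrightarrow> t (Suc j) < t j) \<Longrightarrow>
    card {j. j < N \<and> P (\<tau> x (t j)) \<noteq> P (\<tau> x (t (Suc j)))} \<le> M"
proof -
  obtain F where F: "finite F" "\<forall>p\<in>F. \<exists>d. p \<in> fpoly d"
    "\<forall>x x' y y'. (\<forall>p\<in>F. sgn (poly (p x) y) = sgn (poly (p x') y')) \<longrightarrow> (P (\<tau> x y) \<longleftrightarrow> P (\<tau> x' y'))"
    by (rule determined_family[of P \<tau>, OF assms])
  obtain d where d: "\<And>p. p \<in> F \<Longrightarrow> p \<in> fpoly (d p)" using F(2) by metis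
  define M where "M = (\<Sum>p\<in>F. d p) * 2"
  show ?thesis
  proof (rule that[of M])
    fix x N and t :: "nat \<Rightarrow> real"
    assume t: "\<And>j. j < N \<Longrightarrow> t (Suc j) < t j"
    define J where "J = {j. j < N \<and> P (\<tau> x (t j)) \<noteq> P (\<tau> x (t (Suc j)))}"
    define Z where "Z = (\<Union>p\<in>{p\<in>F. p x \<noteq> 0}. {z. poly (p x) z = 0})"
    have cardZ: "card Z \<le> (\<Sum>p\<in>F. d p)"
    proof -
      have "card Z \<le> (\<Sum>p\<in>{p\<in>F. p x \<noteq> 0}. card {z. poly (p x) z = 0})"
        unfolding Z_def by (rule card_UN_le) (simp add: F(1))
      also have "\<dots> \<le> (\<Sum>p\<in>{p\<in>F. p x \<noteq> 0}. d p)"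
        using d fpoly_degree by (intro sum_mono) (force intro: order_trans[OF card_poly_roots_bound])
      also have "\<dots> \<le> (\<Sum>p\<in>F. d p)" by (rule sum_mono2) (use F(1) in auto)
      finally show ?thesis .
    qed
    have finZ: "finite Z" unfolding Z_def using F(1) by (auto intro: poly_roots_finite)
    have "\<exists>z\<in>Z. t (Suc j) \<le> z \<and> z \<le> t j" if "j \<in> J" for j
    proof -
      have lt: "t (Suc j) < t j" using t that by (simp add: J_def)
      have "P (\<tau> x (t j)) \<noteq> P (\<tau> x (t (Suc j)))" using that by (simp add: J_def)
      then have "\<not> (\<forall>p\<in>F. sgn (poly (p x) (t j)) = sgn (poly (p x) (t (Suc j))))" using F(3) by blast
      then obtain p where p: "p \<in> F" "sgn (poly (p x) (t j)) \<noteq> sgn (poly (p x) (t (Suc j)))" by blast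
      then have "p x \<noteq> 0" by auto
      have "\<exists>z. t (Suc j) \<le> z \<and> z \<le> t j \<and> poly (p x) z = 0"
      proof (cases "poly (p x) (t j) = 0 \<or> poly (p x) (t (Suc j)) = 0")
        case False
        then have "poly (p x) (t (Suc j)) < 0 \<and> poly (p x) (t j) > 0 \<or> poly (p x) (t (Suc j)) > 0 \<and> poly (p x) (t j) < 0"
          using p(2) by (auto simp: sgn_if split: if_splits)
        then show ?thesis
          using poly_IVT_pos[OF lt] poly_IVT_neg[OF lt] by (meson less_imp_le)
      qed (use lt in \<open>auto intro: less_imp_le\<close>)
      then show ?thesis using p(1) \<open>p x \<noteq> 0\<close> unfolding Z_def by blast
    qed
    then obtain z where z: "\<And>j. j \<in> J \<Longrightarrow> z j \<in> Z" "\<And>j. j \<in> J \<Longrightarrow> t (Suc j) \<le> z j" "\<And>j. j \<in> J \<Longrightarrow> z j \<le> t j"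
      by metis
    have dec: "t l < t j" if "j < l" "l \<le> N" for j l
      using that
    proof (induction l)
      case (Suc l)
      then show ?case using t[of l] by (cases "j = l") (auto intro: less_trans)
    qed simp
    have neq: "(z j, z j = t (Suc j)) \<noteq> (z l, z l = t (Suc l))" if "j \<in> J" "l \<in> J" "j < l" for j l
    proof
      assume eq: "(z j, z j = t (Suc j)) = (z l, z l = t (Suc l))"
      have lN: "l < N" using that by (simp add: J_def)
      have "t l \<le> t (Suc j)" using dec[of "Suc j" l] that lN by (cases "Suc j = l") auto
      then have "z l = t (Suc j)" "z l = t l" using z(2)[OF that(1)] z(3)[OF that(2)] eq by auto
      then show False using eq t[OF lN] by auto
    qed
    have "inj_on (\<lambda>j. (z j, z j = t (Suc j))) J"
      by (rule linorder_inj_onI) (use neq in auto)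
    moreover have "(\<lambda>j. (z j, z j = t (Suc j))) ` J \<subseteq> Z \<times> UNIV" using z(1) by auto
    ultimately have "card J \<le> card (Z \<times> (UNIV :: bool set))"
      using finZ by (intro card_inj_on_le) auto
    then show "card {j. j < N \<and> P (\<tau> x (t j)) \<noteq> P (\<tau> x (t (Suc j)))} \<le> M"
      using cardZ by (simp add: J_def M_def card_cartesian_product)
  qed
qed

end

section \<open>Definable sets\<close>

text \<open>Formulas are predicates of a state assigning a vector to every variable; a scalar variable
  is a vector of which only one coordinate is used.\<close>

inductive_set coord_poly :: "((nat \<Rightarrow> real ^ 'n) \<Rightarrow> real) set" where
  const: "(\<lambda>_. c) \<in> coord_poly"
| coord: "(\<lambda>s. s k $ i) \<in> coord_poly"
| add: "f \<in> coord_poly \<Longrightarrow> g \<in> coord_poly \<Longrightarrow> (\<lambda>s. f s + g s) \<in> coord_poly"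
| mult: "f \<in> coord_poly \<Longrightarrow> g \<in> coord_poly \<Longrightarrow> (\<lambda>s. f s * g s) \<in> coord_poly"

global_interpretation cp: function_ring coord_poly
  defines definable = cp.determined
  by unfold_locales (auto intro: coord_poly.intros)

lemma coord_poly_inner: "(\<And>i. (\<lambda>s. a s $ i) \<in> coord_poly) \<Longrightarrow> (\<And>i. (\<lambda>s. b s $ i) \<in> coord_poly) \<Longrightarrow>
    (\<lambda>s. inner (a s) (b s)) \<in> coord_poly"
  by (simp add: inner_vec_def cp.sum coord_poly.mult)

lemma coord_poly_comp:
  assumes "g \<in> coord_poly" "\<And>k i. (\<lambda>s. \<tau> s k $ i) \<in> coord_poly"
  shows "(\<lambda>s. g (\<tau> s)) \<in> coord_poly"
  using assms(1) by induction (auto intro: coord_poly.intros assms(2))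

lemma coord_poly_subst:
  assumes "g \<in> coord_poly" and \<tau>: "\<And>k i. \<exists>d. \<exists>p\<in>cp.fpoly d. \<forall>s y. \<tau> s y k $ i = poly (p s) y"
  shows "\<exists>d. \<exists>p\<in>cp.fpoly d. \<forall>s y. g (\<tau> s y) = poly (p s) y"
  using assms(1)
proof induction
  case (const c)
  show ?case
    by (intro exI[of _ 0] bexI[of _ "\<lambda>s. [:c:]"]) (auto intro: cp.fpoly_const coord_poly.const)
next
  case (coord k i)
  show ?case by (rule \<tau>)
next
  case (add f g)
  then obtain d p e q where "p \<in> cp.fpoly d" "q \<in> cp.fpoly e"
    "\<And>s y. f (\<tau> s y) = poly (p s) y" "\<And>s y. g (\<tau> s y) = poly (q s) y" by blast
  then show ?case
    by (intro exI[of _ "max d e"] bexI[of _ "\<lambda>s. p s + q s"]) (auto intro: cp.fpoly_add)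
next
  case (mult f g)
  then obtain d p e q where "p \<in> cp.fpoly d" "q \<in> cp.fpoly e"
    "\<And>s y. f (\<tau> s y) = poly (p s) y" "\<And>s y. g (\<tau> s y) = poly (q s) y" by blast
  then show ?case
    by (intro exI[of _ "d + e"] bexI[of _ "\<lambda>s. p s * q s"]) (auto intro: cp.fpoly_mult)
qed

text \<open>\<open>J\<close> is a singleton when the coordinates of a vector are quantified one at a
  time, and all coordinates when a scalar is substituted.\<close>

lemma coord_poly_upd:
  assumes "g \<in> coord_poly"
  shows "\<exists>d. \<exists>p\<in>cp.fpoly d. \<forall>s y. g (s(k := \<chi> j. if j \<in> J then y else s k $ j)) = poly (p s) y"
proof (rule coord_poly_subst[OF assms])
  fix l i
  show "\<exists>d. \<exists>p\<in>cp.fpoly d. \<forall>s y. (s(k := \<chi> j. if j \<in> J then y else s k $ j)) l $ i = poly (p s) y"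
  proof (cases "l = k \<and> i \<in> J")
    case True
    then show ?thesis
      by (intro exI[of _ 1] bexI[of _ "\<lambda>s. [:0, 1:]"]) (auto intro: cp.fpoly_X[simplified])
  next
    case False
    then show ?thesis
      by (intro exI[of _ 0] bexI[of _ "\<lambda>s. [:s l $ i:]"]) (auto intro: cp.fpoly_const coord_poly.coord)
  qed
qed

text \<open>A vector quantifier is a chain of scalar ones. In the induction the coordinates in
  \<open>J\<close> are already quantified and the others still belong to the state.\<close>

lemma definable_ex_vec:
  assumes "definable P"
  shows "definable (\<lambda>s. \<exists>v. P (s(k := v)))"
proof -
  have "definable (\<lambda>s. \<exists>v. P (s(k := \<chi> j. if j \<in> J then v $ j else s k $ j)))" if "finite J" for J
    using that
  proof (induction J rule: finite_induct)
    case empty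
    then show ?case using assms by simp
  next
    case (insert i J)
    define \<tau> where "\<tau> s y = s(k := \<chi> j. if j \<in> {i} then y else s k $ j)" for s :: "nat \<Rightarrow> real ^ 'a" and y
    have "definable (\<lambda>s. \<exists>y. \<exists>v. P ((\<tau> s y)(k := \<chi> j. if j \<in> J then v $ j else \<tau> s y k $ j)))"
      unfolding \<tau>_def by (rule cp.determined_ex[OF insert.IH coord_poly_upd])
    moreover have "(\<exists>y. \<exists>v. P ((\<tau> s y)(k := \<chi> j. if j \<in> J then v $ j else \<tau> s y k $ j))) \<longleftrightarrow>
      (\<exists>v. P (s(k := \<chi> j. if j \<in> insert i J then v $ j else s k $ j)))" for s
    proof -
      have e1: "(\<tau> s y)(k := \<chi> j. if j \<in> J then v $ j else \<tau> s y k $ j) =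
          s(k := \<chi> j. if j \<in> insert i J then (\<chi> j. if j = i then y else v $ j) $ j else s k $ j)" for y v
        using insert.hyps(2) by (auto simp: \<tau>_def fun_eq_iff vec_eq_iff)
      have e2: "s(k := \<chi> j. if j \<in> insert i J then v $ j else s k $ j) =
          (\<tau> s (v $ i))(k := \<chi> j. if j \<in> J then v $ j else \<tau> s (v $ i) k $ j)" for v
        by (auto simp: \<tau>_def fun_eq_iff vec_eq_iff)
      show ?thesis
      proof
        assume "\<exists>y v. P ((\<tau> s y)(k := \<chi> j. if j \<in> J then v $ j else \<tau> s y k $ j))"
        then obtain y v where "P ((\<tau> s y)(k := \<chi> j. if j \<in> J then v $ j else \<tau> s y k $ j))" by blast
        from this[unfolded e1] show "\<exists>v. P (s(k := \<chi> j. if j \<in> insert i J then v $ j else s k $ j))" by (rule exI)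
      next
        assume "\<exists>v. P (s(k := \<chi> j. if j \<in> insert i J then v $ j else s k $ j))"
        then obtain v where "P (s(k := \<chi> j. if j \<in> insert i J then v $ j else s k $ j))" by blast
        from this[unfolded e2[of v]] show "\<exists>y v. P ((\<tau> s y)(k := \<chi> j. if j \<in> J then v $ j else \<tau> s y k $ j))"
          by (intro exI)
      qed
    qed
    ultimately show ?case by (simp only:)
  qed
  from this[of UNIV] show ?thesis by (simp add: vec_lambda_eta)
qed

text \<open>Index \<open>k\<close> plays the bound variable: a formula is first built with
  \<open>s k\<close> in its place and then quantified.\<close>

lemma definable_ex:
  assumes "definable Q" "\<And>s v. Q (s(k := v)) \<longleftrightarrow> P s v"
  shows "definable (\<lambda>s. \<exists>v. P s v)"
  using definable_ex_vec[OF assms(1), of k] assms(2) by simp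

lemma definable_all:
  assumes "definable Q" "\<And>s v. Q (s(k := v)) \<longleftrightarrow> P s v"
  shows "definable (\<lambda>s. \<forall>v. P s v)"
  using cp.determined_not[OF definable_ex[OF cp.determined_not[OF assms(1)], of k "\<lambda>s v. \<not> P s v"]] assms(2)
  by simp

lemma definable_rename: "definable P \<Longrightarrow> definable (\<lambda>s. P (\<lambda>k. s (\<sigma> k)))"
  by (rule cp.determined_comp) (auto intro: coord_poly_comp coord_poly.coord)

section \<open>A Lojasiewicz inequality\<close>

text \<open>Banach's indicatrix: the length of each jump is the measure of the levels
  \<open>c\<close> that it crosses, so the variation is the integral over \<open>c\<close> of the
  number of crossings.\<close>

lemma variation_le_crossings:
  fixes a :: "nat \<Rightarrow> real"
  assumes range: "\<And>j. j \<le> N \<Longrightarrow> a j \<in> {lo..hi}"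
    and M: "\<And>c. card {j. j < N \<and> (a j > c) \<noteq> (a (Suc j) > c)} \<le> M"
  shows "(\<Sum>j<N. \<bar>a j - a (Suc j)\<bar>) \<le> real M * (hi - lo)"
proof -
  define I where "I j c = (if (a j > c) \<noteq> (a (Suc j) > c) then 1 else 0 :: real)" for j c
  have "(I j has_integral \<bar>a j - a (Suc j)\<bar>) {lo..hi}" if "j < N" for j
  proof -
    define u v where "u = min (a j) (a (Suc j))" and "v = max (a j) (a (Suc j))"
    have uv: "u \<le> v" "{u..v} \<subseteq> {lo..hi}" "v - u = \<bar>a j - a (Suc j)\<bar>"
      using range[of j] range[of "Suc j"] that by (auto simp: u_def v_def)
    have a: "((\<lambda>c. if c \<in> {u..v} then 1 else 0 :: real) has_integral (v - u)) {lo..hi}"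
      using has_integral_restrict_closed_subinterval[of "\<lambda>_. 1 :: real" "v - u" u v lo hi]
        has_integral_const_real[of "1 :: real" u v] uv(1,2) by simp
    \<comment> \<open>The crossed levels form a half-open interval; the closed one differs from it
      at \<open>v\<close> only.\<close>
    have b: "I j c = (if c \<in> {u..v} then 1 else 0)" if "c \<in> {lo..hi} - {v}" for c
      using that by (auto simp: I_def u_def v_def)
    have "(I j has_integral (v - u)) {lo..hi}"
      by (rule has_integral_spike_finite[of "{v}", OF _ b a]) simp
    then show ?thesis using uv(3) by simp
  qed
  then have "((\<lambda>c. \<Sum>j<N. I j c) has_integral (\<Sum>j<N. \<bar>a j - a (Suc j)\<bar>)) {lo..hi}"
    by (intro has_integral_sum) auto
  moreover have "((\<lambda>c. real M) has_integral real M * (hi - lo)) {lo..hi}"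
    using has_integral_const_real[of "real M" lo hi] range[of 0] by (simp add: mult.commute)
  moreover have "(\<Sum>j<N. I j c) \<le> real M" for c
  proof -
    have "(\<Sum>j<N. I j c) = (\<Sum>j\<in>{j. j < N \<and> (a j > c) \<noteq> (a (Suc j) > c)}. 1)"
      unfolding I_def by (intro sum.mono_neutral_cong_right) auto
    then show ?thesis using M[of c] by simp
  qed
  ultimately show ?thesis by (rule has_integral_le)
qed

section \<open>Signs of bivariate polynomials in sectors near the origin\<close>

lemma poly_abs_le_power:
  fixes p :: "real poly"
  shows "\<exists>B. \<exists>n. B \<ge> 0 \<and> (\<forall>w\<ge>1. \<bar>poly p w\<bar> \<le> B * w ^ n)"
proof (induction p)
  case 0
  then show ?case by (intro exI[of _ 0]) simp
next
  case (pCons a p)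
  then obtain B n where B: "B \<ge> 0" "\<And>w. w \<ge> 1 \<Longrightarrow> \<bar>poly p w\<bar> \<le> B * w ^ n" by blast
  have "\<bar>poly (pCons a p) w\<bar> \<le> (\<bar>a\<bar> + B) * w ^ Suc n" if "w \<ge> 1" for w
  proof -
    have "\<bar>poly (pCons a p) w\<bar> \<le> \<bar>a\<bar> + \<bar>w * poly p w\<bar>" by simp
    also have "\<bar>w * poly p w\<bar> \<le> w * (B * w ^ n)" using B(2)[OF that] that by (simp add: abs_mult mult_left_mono)
    also have "\<bar>a\<bar> \<le> \<bar>a\<bar> * w ^ Suc n" using one_le_power[OF that, of "Suc n"] by (simp add: mult_le_cancel_left1)
    finally show ?thesis by (simp add: algebra_simps)
  qed
  then show ?case using B(1) by (intro exI[of _ "\<bar>a\<bar> + B"] exI[of _ "Suc n"]) simp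
qed

text \<open>The outer variable of \<open>P\<close> is \<open>t\<close>, and its coefficients are
  polynomials in \<open>w\<close>.\<close>

lemma poly2_abs_le_power:
  fixes P :: "real poly poly"
  shows "\<exists>B. \<exists>n. B \<ge> 0 \<and> (\<forall>t w. 0 \<le> t \<longrightarrow> t \<le> 1 \<longrightarrow> w \<ge> 1 \<longrightarrow> \<bar>poly (poly P [:t:]) w\<bar> \<le> B * w ^ n)"
proof (induction P)
  case 0
  then show ?case by (intro exI[of _ 0]) simp
next
  case (pCons h P)
  then obtain B n where B: "B \<ge> 0" "\<And>t w. 0 \<le> t \<Longrightarrow> t \<le> 1 \<Longrightarrow> w \<ge> 1 \<Longrightarrow> \<bar>poly (poly P [:t:]) w\<bar> \<le> B * w ^ n" by blast
  obtain B' n' where B': "B' \<ge> 0" "\<And>w. w \<ge> 1 \<Longrightarrow> \<bar>poly h w\<bar> \<le> B' * w ^ n'"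
    using poly_abs_le_power[of h] by blast
  have "\<bar>poly (poly (pCons h P) [:t:]) w\<bar> \<le> (B' + B) * w ^ (n' + n)" if "0 \<le> t" "t \<le> 1" "w \<ge> 1" for t w
  proof -
    have "\<bar>poly (poly (pCons h P) [:t:]) w\<bar> \<le> \<bar>poly h w\<bar> + \<bar>t * poly (poly P [:t:]) w\<bar>" by simp
    also have "\<bar>poly h w\<bar> \<le> B' * w ^ n'" using B'(2) that by simp
    also have "\<dots> \<le> B' * w ^ (n' + n)" using B'(1) that by (intro mult_left_mono power_increasing) auto
    also have "\<bar>t * poly (poly P [:t:]) w\<bar> \<le> 1 * (B * w ^ n)"
      unfolding abs_mult using B that by (intro mult_mono) auto
    also have "1 * (B * w ^ n) \<le> B * w ^ (n' + n)" using B(1) that by (simp add: mult_left_mono power_increasing)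
    finally show ?thesis by (simp add: algebra_simps)
  qed
  then show ?case using B(1) B'(1) by (intro exI[of _ "B' + B"] exI[of _ "n' + n"]) simp
qed

lemma poly_sign_at_top:
  fixes h :: "real poly"
  assumes "h \<noteq> 0"
  shows "\<exists>c>0. \<exists>n. \<exists>\<sigma>. \<forall>w\<ge>n. \<bar>poly h w\<bar> \<ge> c \<and> sgn (poly h w) = \<sigma>"
proof -
  have pos: "\<exists>c>0. \<exists>n. \<forall>w\<ge>n. poly h w \<ge> c" if "lead_coeff h > 0" for h :: "real poly"
    using poly_pinfty_gt_lc[OF that] that by blast
  show ?thesis
  proof (cases "lead_coeff h > 0")
    case True
    from pos[OF this] obtain c n where c: "c > 0" "\<And>w. w \<ge> n \<Longrightarrow> poly h w \<ge> c" by blast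
    then have "\<bar>poly h w\<bar> \<ge> c \<and> sgn (poly h w) = 1" if "w \<ge> n" for w using c(2)[OF that] by simp
    then show ?thesis using c(1) by blast
  next
    case False
    moreover have "lead_coeff h \<noteq> 0" using assms by simp
    ultimately have "lead_coeff (- h) > 0" unfolding degree_minus coeff_minus by linarith
    from pos[OF this] obtain c n where c: "c > 0" "\<And>w. w \<ge> n \<Longrightarrow> poly (- h) w \<ge> c" by blast
    then have "\<bar>poly h w\<bar> \<ge> c \<and> sgn (poly h w) = -1" if "w \<ge> n" for w using c(2)[OF that] by simp
    then show ?thesis using c(1) by blast
  qed
qed

text \<open>The lowest power of \<open>t\<close> dominates where \<open>t\<close> is small compared with a negative power of \<open>w\<close>.\<close>

lemma poly2_sign:
  fixes P :: "real poly poly"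
  shows "\<exists>c\<ge>1. \<exists>n. \<exists>\<eta>>0. \<exists>\<sigma>. \<forall>t w. 0 < t \<longrightarrow> w \<ge> c \<longrightarrow> t * w ^ n \<le> \<eta> \<longrightarrow> sgn (poly (poly P [:t:]) w) = \<sigma>"
proof (induction P)
  case 0
  then show ?case by (intro exI[of _ 1] conjI exI[of _ 0]) auto
next
  case (pCons h P)
  show ?case
  proof (cases "h = 0")
    case True
    then have "sgn (poly (poly (pCons h P) [:t:]) w) = sgn (poly (poly P [:t:]) w)" if "0 < t" for t w
      using that by (simp add: sgn_mult)
    then show ?thesis using pCons.IH by simp
  next
    case False
    obtain d n \<sigma> where d: "d > 0" "\<And>w. w \<ge> n \<Longrightarrow> \<bar>poly h w\<bar> \<ge> d" "\<And>w. w \<ge> n \<Longrightarrow> sgn (poly h w) = \<sigma>"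
      using poly_sign_at_top[OF False] by blast
    obtain B k where B: "B \<ge> 0" "\<And>t w. 0 \<le> t \<Longrightarrow> t \<le> 1 \<Longrightarrow> w \<ge> 1 \<Longrightarrow> \<bar>poly (poly P [:t:]) w\<bar> \<le> B * w ^ k"
      using poly2_abs_le_power[of P] by blast
    \<comment> \<open>With this bound the terms of positive order in \<open>t\<close> stay below
      \<open>d\<close>, which bounds the term of order zero from below.\<close>
    define \<eta> where "\<eta> = min 1 (d / (2 * (B + 1)))"
    have \<eta>: "\<eta> > 0" "\<eta> \<le> 1" "\<eta> * B < d"
    proof -
      have "\<eta> * B \<le> d / (2 * (B + 1)) * B" using B(1) by (intro mult_right_mono) (auto simp: \<eta>_def)
      also have "\<dots> < d" using B(1) d(1) by (simp add: field_simps add_nonneg_pos)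
      finally show "\<eta> * B < d" .
    qed (use B(1) d(1) in \<open>auto simp: \<eta>_def\<close>)
    have "sgn (poly (poly (pCons h P) [:t:]) w) = \<sigma>" if "0 < t" "w \<ge> max 1 n" "t * w ^ k \<le> \<eta>" for t w
    proof -
      have w: "w \<ge> 1" "w \<ge> n" using that(2) by auto
      have "t * 1 \<le> t * w ^ k" using that(1) one_le_power[OF w(1), of k] by (intro mult_left_mono) auto
      then have "t \<le> 1" using that(3) \<eta>(2) by simp
      then have "\<bar>t * poly (poly P [:t:]) w\<bar> \<le> t * (B * w ^ k)"
        unfolding abs_mult using B(2)[of t w] that w by (intro mult_mono) auto
      also have "\<dots> = (t * w ^ k) * B" by simp
      also have "\<dots> \<le> \<eta> * B" using that(3) B(1) by (rule mult_right_mono)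
      finally have "\<bar>t * poly (poly P [:t:]) w\<bar> < \<bar>poly h w\<bar>" using \<eta>(3) d(2)[OF w(2)] by simp
      then have "sgn (poly h w + t * poly (poly P [:t:]) w) = sgn (poly h w)"
        by (auto simp: sgn_if split: if_splits)
      then show ?thesis using d(3)[OF w(2)] by simp
    qed
    then show ?thesis using \<eta>(1) by (intro exI[of _ "max 1 n"] conjI exI[of _ k] exI[of _ \<eta>] exI[of _ \<sigma>]) auto
  qed
qed

text \<open>Variable 0 holds a level \<open>t\<close> and variable 1 a bound \<open>t * w\<close> on
  the step length, so \<open>w\<close> is a slope. For positive \<open>n\<close> the conditions
  \<open>w >= c\<close> and \<open>t * w ^ n <= \<eta>\<close> describe the sector between a line
  and a multiple of the power \<open>1 - 1 / n\<close> of \<open>t\<close>.\<close>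

definition ray_state :: "real \<Rightarrow> real \<Rightarrow> nat \<Rightarrow> real ^ 'n" where
  "ray_state t w = (\<lambda>_. 0)(0 := vec t, 1 := vec (t * w))"

lemma coord_poly_poly2:
  assumes "g \<in> coord_poly"
  shows "\<exists>P. \<forall>t w. g (ray_state t w) = poly (poly P [:t:]) w"
  using assms
proof induction
  case (const c)
  show ?case by (intro exI[of _ "[:[:c:]:]"]) simp
next
  case (coord k i)
  consider "k = 0" | "k = 1" | "k \<noteq> 0" "k \<noteq> 1" by blast
  then show ?case
  proof cases
    case 1
    then show ?thesis by (intro exI[of _ "[:0, 1:]"]) (simp add: ray_state_def)
  next
    case 2
    then show ?thesis by (intro exI[of _ "[:0, [:0, 1:]:]"]) (simp add: ray_state_def)
  next
    case 3
    then show ?thesis by (intro exI[of _ 0]) (simp add: ray_state_def)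
  qed
next
  case (add f g)
  then obtain P Q where "\<And>t w. f (ray_state t w) = poly (poly P [:t:]) w"
    "\<And>t w. g (ray_state t w) = poly (poly Q [:t:]) w" by blast
  then show ?case by (intro exI[of _ "P + Q"]) simp
next
  case (mult f g)
  then obtain P Q where "\<And>t w. f (ray_state t w) = poly (poly P [:t:]) w"
    "\<And>t w. g (ray_state t w) = poly (poly Q [:t:]) w" by blast
  then show ?case by (intro exI[of _ "P * Q"]) simp
qed

text \<open>Each of finitely many signs is constant on a region of this shape, and the intersection
  of two such regions contains a third: larger \<open>c\<close> and \<open>n\<close>, smaller
  \<open>\<eta>\<close>.\<close>

lemma definable_region:
  assumes "definable P"
  shows "\<exists>c\<ge>1. \<exists>n. \<exists>\<eta>>0. \<exists>b. \<forall>t w. 0 < t \<longrightarrow> w \<ge> c \<longrightarrow> t * w ^ n \<le> \<eta> \<longrightarrow>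
    P (ray_state t w) = b"
proof -
  from assms obtain G where G: "finite G" "G \<subseteq> coord_poly"
    "\<And>x x'. (\<And>g. g \<in> G \<Longrightarrow> sgn (g x) = sgn (g x')) \<Longrightarrow> P x \<longleftrightarrow> P x'"
    by (rule cp.determinedE) blast
  have "\<exists>c\<ge>1. \<exists>n. \<exists>\<eta>>0. \<exists>\<sigma>. \<forall>t w. 0 < t \<longrightarrow> w \<ge> c \<longrightarrow> t * w ^ n \<le> \<eta> \<longrightarrow> (\<forall>g\<in>G. sgn (g (ray_state t w)) = \<sigma> g)"
    using G(1,2)
  proof (induction G rule: finite_induct)
    case empty
    show ?case by (intro exI[of _ 1] conjI exI[of _ 0]) auto
  next
    case (insert g G)
    from insert.prems have "G \<subseteq> coord_poly" by simp
    from insert.IH[OF this] obtain c n \<eta> \<sigma> where c: "c \<ge> 1" "\<eta> > 0"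
      "\<And>t w. 0 < t \<Longrightarrow> w \<ge> c \<Longrightarrow> t * w ^ n \<le> \<eta> \<Longrightarrow> (\<forall>g\<in>G. sgn (g (ray_state t w)) = \<sigma> g)" by blast
    obtain p where p: "\<And>t w. g (ray_state t w) = poly (poly p [:t:]) w"
      using coord_poly_poly2[of g] insert.prems by blast
    obtain c' n' \<eta>' \<sigma>' where c': "c' \<ge> 1" "\<eta>' > 0"
      "\<And>t w. 0 < t \<Longrightarrow> w \<ge> c' \<Longrightarrow> t * w ^ n' \<le> \<eta>' \<Longrightarrow> sgn (poly (poly p [:t:]) w) = \<sigma>'"
      using poly2_sign[of p] by blast
    have "\<forall>h\<in>insert g G. sgn (h (ray_state t w)) = (\<sigma>(g := \<sigma>')) h"
      if "0 < t" "w \<ge> max c c'" "t * w ^ (max n n') \<le> min \<eta> \<eta>'" for t w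
    proof -
      have w: "w \<ge> c" "w \<ge> c'" "w \<ge> 1" using that(2) c(1) by auto
      have "t * w ^ n \<le> t * w ^ (max n n')" "t * w ^ n' \<le> t * w ^ (max n n')"
        using that(1) w(3) by (auto intro!: mult_left_mono power_increasing)
      then have "t * w ^ n \<le> \<eta>" "t * w ^ n' \<le> \<eta>'" using that(3) by auto
      then show ?thesis
        using c(3)[OF that(1) w(1)] c'(3)[OF that(1) w(2)] p insert.hyps(2) by auto
    qed
    then show ?case using c c'
      by (intro exI[of _ "max c c'"] conjI exI[of _ "max n n'"] exI[of _ "min \<eta> \<eta>'"] exI[of _ "\<sigma>(g := \<sigma>')"]) auto
  qed
  then obtain c n \<eta> \<sigma> where c: "c \<ge> 1" "\<eta> > 0"
    "\<And>t w. 0 < t \<Longrightarrow> w \<ge> c \<Longrightarrow> t * w ^ n \<le> \<eta> \<Longrightarrow> (\<forall>g\<in>G. sgn (g (ray_state t w)) = \<sigma> g)" by blast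
  have eq: "P (ray_state t w) = P (ray_state t' w')"
    if "0 < t" "w \<ge> c" "t * w ^ n \<le> \<eta>" "0 < t'" "w' \<ge> c" "t' * w' ^ n \<le> \<eta>" for t w t' w'
    using c(3)[OF that(1-3)] c(3)[OF that(4-6)] by (intro G(3)) simp
  \<comment> \<open>The corner \<open>w = c\<close>, \<open>t = \<eta> / c ^ n\<close> of the region
    serves as the sample point.\<close>
  have lo: "0 < \<eta> / c ^ n" "(\<eta> / c ^ n) * c ^ n \<le> \<eta>" using c(1,2) by simp_all
  have H: "\<forall>t w. 0 < t \<longrightarrow> w \<ge> c \<longrightarrow> t * w ^ n \<le> \<eta> \<longrightarrow> P (ray_state t w) = P (ray_state (\<eta> / c ^ n) c)"
  proof (intro allI impI)
    fix t w assume "0 < t" "w \<ge> c" "t * w ^ n \<le> \<eta>"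
    from eq[OF this lo(1) order_refl lo(2)] show "P (ray_state t w) = P (ray_state (\<eta> / c ^ n) c)" .
  qed
  show ?thesis
    by (rule exI[of _ c], rule conjI[OF c(1)], rule exI[of _ n], rule exI[of _ \<eta>], rule conjI[OF c(2)], rule exI, rule H)
qed

section \<open>Definable curves and their variation\<close>

lemma compact_coordinate_minimizers:
  fixes S :: "(real ^ 'n) set"
  assumes "compact S" "S \<noteq> {}"
  shows "compact {x\<in>S. \<forall>z\<in>S. x $ i \<le> z $ i}" "{x\<in>S. \<forall>z\<in>S. x $ i \<le> z $ i} \<noteq> {}"
proof -
  have "continuous_on S (\<lambda>x. x $ i)" by (intro continuous_intros)
  then show "{x\<in>S. \<forall>z\<in>S. x $ i \<le> z $ i} \<noteq> {}"
    using continuous_attains_inf[OF assms] by auto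
  have "{x\<in>S. \<forall>z\<in>S. x $ i \<le> z $ i} = S \<inter> (\<Inter>z\<in>S. {x. x $ i \<le> z $ i})" by auto
  moreover have "closed (\<Inter>z\<in>S. {x. x $ i \<le> z $ i})"
    by (intro closed_INT ballI closed_Collect_le continuous_intros)
  ultimately show "compact {x\<in>S. \<forall>z\<in>S. x $ i \<le> z $ i}"
    using assms(1) by (simp add: compact_Int_closed)
qed

text \<open>Fibers are made compact by taking closures, and a point is singled out by minimizing one
  coordinate after the other.\<close>

lemma definable_selection:
  fixes W :: "real \<Rightarrow> real ^ 'n \<Rightarrow> bool" and i0 :: 'n
  assumes W: "definable (\<lambda>s. W (s 0 $ i0) (s 1))"
    and fibers: "\<And>t. t \<in> I \<Longrightarrow> \<exists>x. W t x" and bdd: "\<And>t. bounded {x. W t x}"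
  shows "\<exists>V \<xi>. definable (\<lambda>s. V (s 0 $ i0) (s 1)) \<and>
    (\<forall>t\<in>I. \<xi> t \<in> closure {x. W t x} \<and> (\<forall>x. V t x \<longleftrightarrow> x = \<xi> t))"
proof -
  have "\<exists>V. definable (\<lambda>s. V (s 0 $ i0) (s 1)) \<and> (\<forall>t\<in>I. compact {x. V t x} \<and> {x. V t x} \<noteq> {} \<and>
      {x. V t x} \<subseteq> closure {x. W t x} \<and> (\<forall>x y. V t x \<longrightarrow> V t y \<longrightarrow> (\<forall>i\<in>J. x $ i = y $ i)))"
    if "finite J" for J :: "'n set"
    using that
  proof (induction J rule: finite_induct)
    case empty
    \<comment> \<open>The closure of the fiber in polynomial terms: squared distances, and a
      tolerance read off coordinate \<open>i0\<close> of the vector \<open>e\<close>.\<close>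
    define V where "V t x \<longleftrightarrow> (\<forall>e :: real ^ 'n. 0 < e $ i0 \<longrightarrow> (\<exists>z. W t z \<and> inner (z - x) (z - x) < e $ i0))" for t x
    have V: "V t x \<longleftrightarrow> x \<in> closure {x. W t x}" for t x
    proof
      assume "V t x"
      show "x \<in> closure {x. W t x}"
        unfolding closure_approachable
      proof (intro allI impI)
        fix e :: real assume "e > 0"
        then obtain z where "W t z" "inner (z - x) (z - x) < e\<^sup>2"
          using \<open>V t x\<close>[unfolded V_def, rule_format, of "vec (e\<^sup>2)"] by auto
        then have "norm (z - x) < e"
          using \<open>e > 0\<close> power_less_imp_less_base[of "norm (z - x)" 2 e] by (simp add: power2_norm_eq_inner)
        then show "\<exists>y\<in>{x. W t x}. dist y x < e" using \<open>W t z\<close> by (auto simp: dist_norm)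
      qed
    next
      assume x: "x \<in> closure {x. W t x}"
      show "V t x"
        unfolding V_def
      proof (intro allI impI)
        fix e :: "real ^ 'n" assume e: "0 < e $ i0"
        then obtain z where z: "W t z" "dist z x < sqrt (e $ i0)"
          using x unfolding closure_approachable by (metis mem_Collect_eq real_sqrt_gt_zero)
        then have "(norm (z - x))\<^sup>2 < (sqrt (e $ i0))\<^sup>2"
          by (intro power_strict_mono) (auto simp: dist_norm)
        then show "\<exists>z. W t z \<and> inner (z - x) (z - x) < e $ i0"
          using z(1) e by (auto simp: power2_norm_eq_inner)
      qed
    qed
    have "definable (\<lambda>s. W (s 0 $ i0) (s 2))"
      using definable_rename[OF W, of "\<lambda>k. if k = 1 then 2 else k"] by simp
    then have "definable (\<lambda>s. W (s 0 $ i0) (s 2) \<and> inner (s 2 - s 1) (s 2 - s 1) < s 3 $ i0)"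
      by (intro cp.determined_conj cp.determined_less coord_poly_inner)
        (auto intro: coord_poly.coord cp.diff)
    then have "definable (\<lambda>s. \<exists>z. W (s 0 $ i0) z \<and> inner (z - s 1) (z - s 1) < s 3 $ i0)"
      by (rule definable_ex[where k = 2]) simp
    then have "definable (\<lambda>s. 0 < s 3 $ i0 \<longrightarrow> (\<exists>z. W (s 0 $ i0) z \<and> inner (z - s 1) (z - s 1) < s 3 $ i0))"
      by (intro cp.determined_imp cp.determined_less) (auto intro: coord_poly.intros)
    then have "definable (\<lambda>s. V (s 0 $ i0) (s 1))"
      unfolding V_def by (rule definable_all[where k = 3]) simp
    moreover have "compact {x. V t x} \<and> {x. V t x} \<noteq> {}" if "t \<in> I" for t
      using bdd[of t] fibers[OF that] by (auto simp: V compact_eq_bounded_closed)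
    ultimately show ?case by (intro exI[of _ V]) (auto simp: V)
  next
    case (insert i J)
    then obtain V where V: "definable (\<lambda>s. V (s 0 $ i0) (s 1))"
      "\<And>t. t \<in> I \<Longrightarrow> compact {x. V t x} \<and> {x. V t x} \<noteq> {} \<and>
      {x. V t x} \<subseteq> closure {x. W t x} \<and> (\<forall>x y. V t x \<longrightarrow> V t y \<longrightarrow> (\<forall>i\<in>J. x $ i = y $ i))" by blast
    define U where "U t x \<longleftrightarrow> V t x \<and> (\<forall>z. V t z \<longrightarrow> x $ i \<le> z $ i)" for t x
    have U: "{x. U t x} = {x\<in>{x. V t x}. \<forall>z\<in>{x. V t x}. x $ i \<le> z $ i}" for t
      by (auto simp: U_def)
    have "definable (\<lambda>s. V (s 0 $ i0) (s 2))"
      using definable_rename[OF V(1), of "\<lambda>k. if k = 1 then 2 else k"] by simp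
    then have "definable (\<lambda>s. V (s 0 $ i0) (s 2) \<longrightarrow> s 1 $ i \<le> s 2 $ i)"
      by (intro cp.determined_imp cp.determined_le coord_poly.coord)
    then have "definable (\<lambda>s. \<forall>z. V (s 0 $ i0) z \<longrightarrow> s 1 $ i \<le> z $ i)"
      by (rule definable_all[where k = 2]) simp
    then have "definable (\<lambda>s. U (s 0 $ i0) (s 1))"
      unfolding U_def by (intro cp.determined_conj V(1))
    moreover have "compact {x. U t x} \<and> {x. U t x} \<noteq> {}" if "t \<in> I" for t
      using compact_coordinate_minimizers[of "{x. V t x}" i] V(2)[OF that] unfolding U by blast
    moreover have "{x. U t x} \<subseteq> closure {x. W t x} \<and> (\<forall>x y. U t x \<longrightarrow> U t y \<longrightarrow> (\<forall>j\<in>insert i J. x $ j = y $ j))"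
      if "t \<in> I" for t
      using V(2)[OF that] unfolding U_def by (auto intro: antisym)
    ultimately show ?case by blast
  qed
  from this[OF finite[of UNIV]] obtain V where V: "definable (\<lambda>s. V (s 0 $ i0) (s 1))"
    "\<forall>t\<in>I. compact {x. V t x} \<and> {x. V t x} \<noteq> {} \<and> {x. V t x} \<subseteq> closure {x. W t x} \<and>
      (\<forall>x y. V t x \<longrightarrow> V t y \<longrightarrow> (\<forall>i\<in>UNIV. x $ i = y $ i))" by blast
  define \<xi> where "\<xi> t = (SOME x. V t x)" for t
  have \<xi>: "V t (\<xi> t)" if "t \<in> I" for t
    unfolding \<xi>_def using V(2) that by (intro someI_ex[of "V t"]) blast
  have "\<xi> t \<in> closure {x. W t x}" if "t \<in> I" for t
    using V(2) \<xi>[OF that] that by blast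
  moreover have "V t x \<longleftrightarrow> x = \<xi> t" if "t \<in> I" for t x
  proof -
    have "\<forall>x y. V t x \<longrightarrow> V t y \<longrightarrow> (\<forall>i\<in>UNIV. x $ i = y $ i)" using bspec[OF V(2) that] by (elim conjE)
    from this[rule_format, OF _ \<xi>[OF that]] have "x = \<xi> t" if "V t x"
      unfolding vec_eq_iff using that by blast
    then show ?thesis using \<xi>[OF that] by auto
  qed
  ultimately show ?thesis
    using V(1) by (intro exI[of _ V] exI[of _ \<xi>] conjI ballI allI)
qed

text \<open>For each coordinate the set of \<open>t\<close> with \<open>\<xi> t $ i > c\<close> is
  definable with \<open>c\<close> as a parameter. The number of its crossings is therefore bounded
  uniformly in \<open>c\<close>, and \<open>variation_le_crossings\<close> applies.\<close>

lemma definable_finite_variation: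
  fixes V :: "real \<Rightarrow> real ^ 'n \<Rightarrow> bool" and i0 :: 'n
  assumes V: "definable (\<lambda>s. V (s 0 $ i0) (s 1))"
    and \<xi>: "\<And>t x. t \<in> I \<Longrightarrow> V t x \<longleftrightarrow> x = \<xi> t" and bdd: "\<And>t. t \<in> I \<Longrightarrow> norm (\<xi> t) \<le> b"
  shows "\<exists>B. \<forall>N t. (\<forall>j\<le>N. t j \<in> I) \<longrightarrow> (\<forall>j<N. t (Suc j) < t j) \<longrightarrow>
    (\<Sum>j<N. norm (\<xi> (t j) - \<xi> (t (Suc j)))) \<le> B"
proof -
  have "\<exists>M. \<forall>N t. (\<forall>j\<le>N. t j \<in> I) \<longrightarrow> (\<forall>j<N. t (Suc j) < t j) \<longrightarrow>
    (\<Sum>j<N. \<bar>\<xi> (t j) $ i - \<xi> (t (Suc j)) $ i\<bar>) \<le> M" for i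
  proof -
    have "definable (\<lambda>s. V (s 0 $ i0) (s 1) \<and> s 2 $ i < s 1 $ i)"
      by (intro cp.determined_conj V cp.determined_less coord_poly.coord)
    then have def: "definable (\<lambda>s. \<exists>x. V (s 0 $ i0) x \<and> s 2 $ i < x $ i)"
      by (rule definable_ex[where k = 1]) simp
    define P where "P s \<longleftrightarrow> (\<exists>x. V (s 0 $ i0) x \<and> s 2 $ i < x $ i)" for s :: "nat \<Rightarrow> real ^ 'n"
    define \<tau> where "\<tau> s y = s(0 := \<chi> j. if j \<in> UNIV then y else s 0 $ j)" for s :: "nat \<Rightarrow> real ^ 'n" and y
    have \<tau>: "\<exists>d. \<exists>p\<in>cp.fpoly d. \<forall>s y. g (\<tau> s y) = poly (p s) y" if "g \<in> coord_poly" for g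
      unfolding \<tau>_def by (rule coord_poly_upd[OF that])
    obtain M where M: "\<And>x N t. (\<And>j. j < N \<Longrightarrow> t (Suc j) < t j) \<Longrightarrow>
        card {j. j < N \<and> P (\<tau> x (t j)) \<noteq> P (\<tau> x (t (Suc j)))} \<le> M"
      by (rule cp.bounded_crossings[of P \<tau>]) (use def \<tau> in \<open>auto simp: P_def[abs_def]\<close>)
    have "(\<Sum>j<N. \<bar>\<xi> (t j) $ i - \<xi> (t (Suc j)) $ i\<bar>) \<le> real M * (b - (- b))"
      if tI: "\<forall>j\<le>N. t j \<in> I" and t: "\<forall>j<N. t (Suc j) < t j" for N t
    proof (rule variation_le_crossings)
      show "\<xi> (t j) $ i \<in> {- b..b}" if "j \<le> N" for j
        using bdd[of "t j"] component_le_norm_cart[of "\<xi> (t j)" i] tI that by fastforce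
      fix c
      have P: "P (\<tau> (\<lambda>_. vec c) (t j)) \<longleftrightarrow> \<xi> (t j) $ i > c" if "j \<le> N" for j
        using \<xi>[of "t j"] tI that by (simp add: P_def \<tau>_def)
      have "{j. j < N \<and> (c < \<xi> (t j) $ i) \<noteq> (c < \<xi> (t (Suc j)) $ i)} =
          {j. j < N \<and> P (\<tau> (\<lambda>_. vec c) (t j)) \<noteq> P (\<tau> (\<lambda>_. vec c) (t (Suc j)))}"
        using P by auto
      then show "card {j. j < N \<and> (c < \<xi> (t j) $ i) \<noteq> (c < \<xi> (t (Suc j)) $ i)} \<le> M"
        using M[of N t "\<lambda>_. vec c"] t by simp
    qed
    then show ?thesis by blast
  qed
  then have "\<forall>i. \<exists>M. \<forall>N t. (\<forall>j\<le>N. t j \<in> I) \<longrightarrow> (\<forall>j<N. t (Suc j) < t j) \<longrightarrow>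
    (\<Sum>j<N. \<bar>\<xi> (t j) $ i - \<xi> (t (Suc j)) $ i\<bar>) \<le> M" by (rule allI)
  from choice[OF this] obtain M where M: "\<forall>i N t. (\<forall>j\<le>N. t j \<in> I) \<longrightarrow> (\<forall>j<N. t (Suc j) < t j) \<longrightarrow>
    (\<Sum>j<N. \<bar>\<xi> (t j) $ i - \<xi> (t (Suc j)) $ i\<bar>) \<le> M i" by (elim exE)
  have "(\<Sum>j<N. norm (\<xi> (t j) - \<xi> (t (Suc j)))) \<le> (\<Sum>i\<in>UNIV. M i)"
    if "\<forall>j\<le>N. t j \<in> I" "\<forall>j<N. t (Suc j) < t j" for N t
  proof -
    have "(\<Sum>j<N. norm (\<xi> (t j) - \<xi> (t (Suc j)))) \<le> (\<Sum>j<N. \<Sum>i\<in>UNIV. \<bar>\<xi> (t j) $ i - \<xi> (t (Suc j)) $ i\<bar>)"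

    proof (rule sum_mono)
      show "norm (\<xi> (t j) - \<xi> (t (Suc j))) \<le> (\<Sum>i\<in>UNIV. \<bar>\<xi> (t j) $ i - \<xi> (t (Suc j)) $ i\<bar>)" for j
        using norm_le_l1_cart[of "\<xi> (t j) - \<xi> (t (Suc j))"] by simp
    qed
    also have "\<dots> = (\<Sum>i\<in>UNIV. \<Sum>j<N. \<bar>\<xi> (t j) $ i - \<xi> (t (Suc j)) $ i\<bar>)" by (rule sum.swap)
    also have "\<dots> \<le> (\<Sum>i\<in>UNIV. M i)"
      by (rule sum_mono) (rule M[THEN spec, THEN spec, THEN spec, THEN mp, THEN mp, OF that])
    finally show ?thesis .
  qed
  then show ?thesis by (intro exI[of _ "\<Sum>i\<in>UNIV. M i"] allI impI)
qed

text \<open>By Bernoulli's inequality \<open>n\<close> factors leave at least one half. In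
  \<open>no_linear_fibers\<close> this keeps \<open>2 * n * A\<close> geometric levels above
  \<open>T * (1 / 4) ^ A\<close>, a bound free of \<open>n\<close>.\<close>

lemma quarter_power_le:
  assumes "n \<ge> 1"
  shows "(1 / 4) ^ A \<le> (1 - 1 / (2 * real n)) ^ (A * (2 * n))"
proof -
  have "1 + real n * (- (1 / (2 * real n))) \<le> (1 + - (1 / (2 * real n))) ^ n"
    using assms by (intro Bernoulli_inequality) (simp add: field_simps)
  then have "1 / 2 \<le> (1 - 1 / (2 * real n)) ^ n" using assms by simp
  then have "(1 / 2)\<^sup>2 \<le> ((1 - 1 / (2 * real n)) ^ n)\<^sup>2" by (intro power_mono) auto
  then have "1 / 4 \<le> (1 - 1 / (2 * real n)) ^ (2 * n)"
    by (simp add: power_even_eq power2_eq_square)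
  then have "(1 / 4) ^ A \<le> ((1 - 1 / (2 * real n)) ^ (2 * n)) ^ A" by (intro power_mono) auto
  then show ?thesis by (simp add: power_mult[symmetric] mult.commute)
qed

text \<open>A curve of finite length along which \<open>r\<close> is at most proportional to \<open>F - Fs\<close> would have
  infinite length, by summing the assumed inequality along a geometric sequence of levels.\<close>

lemma no_linear_fibers:
  fixes K :: "(real ^ 'n) set" and F r :: "real ^ 'n \<Rightarrow> real" and i0 :: 'n
  assumes K: "bounded K" and c: "c > 0" "c0 > 0" "T > 0"
    and ineq: "\<And>x y. x \<in> K \<Longrightarrow> y \<in> K \<Longrightarrow> F x - F y \<le> c * (r x * norm (x - y) + (norm (x - y))\<^sup>2)"
    and def: "definable (\<lambda>s. s 2 \<in> K \<and> F (s 2) = Fs + s 0 $ i0 \<and> r (s 2) \<le> s 1 $ i0)"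
    and fibers: "\<And>t. 0 < t \<Longrightarrow> t \<le> T \<Longrightarrow> \<exists>x\<in>K. F x = Fs + t \<and> r x \<le> c0 * t"
  shows False
proof -
  define W where "W t x \<longleftrightarrow> x \<in> K \<and> F x = Fs + t \<and> r x \<le> c0 * t" for t x
  \<comment> \<open>Adapts the variables of \<open>def\<close>: the bound becomes \<open>c0\<close>
    times the level, and the point moves from variable 2 to variable 1.\<close>
  define \<tau> where "\<tau> s k = (if k = 1 then c0 *\<^sub>R s 0 else if k = 2 then s 1 else s 0)" for s :: "nat \<Rightarrow> real ^ 'n" and k :: nat
  have \<tau>: "(\<lambda>s. \<tau> s k $ i) \<in> coord_poly" for k i
    unfolding \<tau>_def by (cases "k = 1"; cases "k = 2") (auto intro: coord_poly.intros)
  have "definable (\<lambda>s. \<tau> s 2 \<in> K \<and> F (\<tau> s 2) = Fs + \<tau> s 0 $ i0 \<and> r (\<tau> s 2) \<le> \<tau> s 1 $ i0)"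
    by (rule cp.determined_comp[OF def coord_poly_comp]) (use \<tau> in auto)
  then have "definable (\<lambda>s. W (s 0 $ i0) (s 1))" by (simp add: \<tau>_def W_def)
  moreover have "\<exists>x. W t x" if "t \<in> {0<..T}" for t using fibers[of t] that by (auto simp: W_def)
  moreover have bW: "bounded {x. W t x}" for t
    by (rule bounded_subset[OF K]) (auto simp: W_def)
  ultimately have "\<exists>V \<xi>. definable (\<lambda>s. V (s 0 $ i0) (s 1)) \<and>
    (\<forall>t\<in>{0<..T}. \<xi> t \<in> closure {x. W t x} \<and> (\<forall>x. V t x \<longleftrightarrow> x = \<xi> t))"
    by (rule definable_selection)
  then obtain V \<xi> where V: "definable (\<lambda>s. V (s 0 $ i0) (s 1))"
    "\<And>t. t \<in> {0<..T} \<Longrightarrow> \<xi> t \<in> closure {x. W t x}" "\<And>t x. t \<in> {0<..T} \<Longrightarrow> V t x \<longleftrightarrow> x = \<xi> t"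
    by blast
  obtain b where b: "\<And>x. x \<in> closure K \<Longrightarrow> norm x \<le> b"
    using bounded_closure[OF K] unfolding bounded_iff by blast
  have nb: "norm (\<xi> t) \<le> b" if "t \<in> {0<..T}" for t
  proof (rule b)
    have "{x. W t x} \<subseteq> K" by (auto simp: W_def)
    then show "\<xi> t \<in> closure K" using V(2)[OF that] closure_mono by blast
  qed
  have "\<exists>B. \<forall>N t. (\<forall>j\<le>N. t j \<in> {0<..T}) \<longrightarrow> (\<forall>j<N. t (Suc j) < t j) \<longrightarrow>
    (\<Sum>j<N. norm (\<xi> (t j) - \<xi> (t (Suc j)))) \<le> B"
    by (rule definable_finite_variation[of V i0 "{0<..T}" \<xi> b]) (use V(1,3) nb in auto)
  then obtain B where B: "\<forall>N t. (\<forall>j\<le>N. t j \<in> {0<..T}) \<longrightarrow> (\<forall>j<N. t (Suc j) < t j) \<longrightarrow>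
    (\<Sum>j<N. norm (\<xi> (t j) - \<xi> (t (Suc j)))) \<le> B" by (elim exE)
  \<comment> \<open>The value comes from \<open>step\<close>: for neighbours at distance
    \<open>D <= t j\<close> the inequality yields
    \<open>t j / (2 * n) <= t j * c * (c0 + 1) * D\<close>, hence
    \<open>D >= \<kappa> / (2 * n)\<close>.\<close>
  define \<kappa> where "\<kappa> = 1 / (c * (c0 + 1))"
  have \<kappa>: "\<kappa> > 0" using c by (simp add: \<kappa>_def)
  \<comment> \<open>\<open>A\<close> is fixed first: \<open>N = 2 * n * A\<close> steps of length
    \<open>\<kappa> / (2 * n)\<close> add up to \<open>A * \<kappa> > B + 1\<close>, whatever
    \<open>n\<close> is. Only then is \<open>n\<close> taken so large that
    \<open>\<kappa> / (2 * n)\<close> stays below the lowest level, which settles neighbours at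
    distance \<open>D > t j\<close>.\<close>
  obtain A :: nat where A: "(B + 1) / \<kappa> < real A" using reals_Archimedean2 by blast
  obtain n :: nat where n: "\<kappa> / (T * (1 / 4) ^ A) < real n" "n \<ge> 1"
  proof -
    obtain n :: nat where "\<kappa> / (T * (1 / 4) ^ A) < real n" using reals_Archimedean2 by blast
    then show ?thesis by (intro that[of "max 1 n"]) auto
  qed
  define q where "q = 1 - 1 / (2 * real n)"
  define N where "N = A * (2 * n)"
  define t where "t j = T * q ^ j" for j
  have q: "0 < q" "q < 1" using n(2) by (auto simp: q_def field_simps)
  have tpos: "0 < t j" for j using q c by (simp add: t_def)
  have tT: "t j \<le> T" for j using q c by (simp add: t_def mult_le_cancel_left2 power_le_one)
  have tdec: "t (Suc j) < t j" for j using q c by (simp add: t_def)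
  have tlow: "\<kappa> / (2 * real n) \<le> t j" if "j \<le> N" for j
  proof -
    have "\<kappa> \<le> real n * (T * (1 / 4) ^ A)" using n(1) c by (simp add: field_simps)
    also have "\<dots> \<le> 2 * real n * (T * (1 / 4) ^ A)" using c by (intro mult_right_mono) auto
    finally have "\<kappa> / (2 * real n) \<le> T * (1 / 4) ^ A" using n(2) by (simp add: divide_le_eq mult.commute)
    also have "\<dots> \<le> T * q ^ N" unfolding q_def N_def using c quarter_power_le[OF n(2), of A] by simp
    also have "\<dots> \<le> T * q ^ j" using c q that by (simp add: power_decreasing)
    finally show ?thesis by (simp add: t_def)
  qed
  \<comment> \<open>The selected points lie only in the closures of the fibers. Replacing them by
    points of the fibers costs \<open>1 / (N + 1)\<close> per step, less than 1 in total.\<close>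
  have "\<exists>x. W (t j) x \<and> norm (x - \<xi> (t j)) < 1 / (2 * real N + 2)" for j
  proof -
    have "\<xi> (t j) \<in> closure {x. W (t j) x}" using V(2) tpos tT by simp
    then show ?thesis unfolding closure_approachable by (auto simp: dist_norm dest!: spec[of _ "1 / (2 * real N + 2)"])
  qed
  then obtain x where x: "\<And>j. W (t j) (x j)" "\<And>j. norm (x j - \<xi> (t j)) < 1 / (2 * real N + 2)" by metis
  have step: "\<kappa> / (2 * real n) \<le> norm (x j - x (Suc j))" if "j < N" for j
  proof (cases "norm (x j - x (Suc j)) \<le> t j")
    case False
    then show ?thesis using tlow[of j] that by simp
  next
    case True
    define D where "D = norm (x j - x (Suc j))"
    have xj: "x j \<in> K" "F (x j) = Fs + t j" "r (x j) \<le> c0 * t j"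
      and xs: "x (Suc j) \<in> K" "F (x (Suc j)) = Fs + t (Suc j)"
      using x(1)[of j] x(1)[of "Suc j"] by (auto simp: W_def)
    have "t j * (1 / (2 * real n)) = t j - t (Suc j)" by (simp add: t_def q_def algebra_simps)
    also have "\<dots> \<le> c * (r (x j) * D + D\<^sup>2)"
      using ineq[OF xj(1) xs(1)] xj(2) xs(2) by (simp add: D_def)
    also have "\<dots> \<le> c * (c0 * t j * D + t j * D)"
      using True c xj(3) by (intro mult_left_mono add_mono mult_right_mono) (auto simp: D_def power2_eq_square mult_right_mono)
    also have "\<dots> = t j * (c * (c0 + 1) * D)" by (simp add: algebra_simps)
    finally have "1 / (2 * real n) \<le> c * (c0 + 1) * D" by (rule mult_left_le_imp_le[OF _ tpos[of j]])
    moreover have "0 < c * (c0 + 1)" using c by simp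
    ultimately have "1 / (2 * real n) / (c * (c0 + 1)) \<le> D" by (simp only: pos_divide_le_eq mult.commute)
    then show ?thesis by (simp add: \<kappa>_def D_def mult.commute)
  qed
  have "real N * (\<kappa> / (2 * real n)) \<le> (\<Sum>j<N. norm (x j - x (Suc j)))"
    using sum_bounded_below[of "{..<N}" "\<kappa> / (2 * real n)" "\<lambda>j. norm (x j - x (Suc j))"] step by simp
  also have "\<dots> \<le> (\<Sum>j<N. norm (\<xi> (t j) - \<xi> (t (Suc j))) + 1 / (real N + 1))"
  proof (rule sum_mono)
    fix j
    have "x j - x (Suc j) = (x j - \<xi> (t j)) + (\<xi> (t j) - \<xi> (t (Suc j))) - (x (Suc j) - \<xi> (t (Suc j)))" by simp
    then have "norm (x j - x (Suc j)) \<le> norm (x j - \<xi> (t j)) + norm (\<xi> (t j) - \<xi> (t (Suc j))) + norm (x (Suc j) - \<xi> (t (Suc j)))"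
      using norm_triangle_ineq4[of "(x j - \<xi> (t j)) + (\<xi> (t j) - \<xi> (t (Suc j)))" "x (Suc j) - \<xi> (t (Suc j))"]
        norm_triangle_ineq[of "x j - \<xi> (t j)" "\<xi> (t j) - \<xi> (t (Suc j))"] by simp
    also have "\<dots> \<le> 1 / (2 * real N + 2) + norm (\<xi> (t j) - \<xi> (t (Suc j))) + 1 / (2 * real N + 2)"
      using x(2)[of j] x(2)[of "Suc j"] by simp
    also have "\<dots> = norm (\<xi> (t j) - \<xi> (t (Suc j))) + 1 / (real N + 1)" by (simp add: field_simps)
    finally show "norm (x j - x (Suc j)) \<le> norm (\<xi> (t j) - \<xi> (t (Suc j))) + 1 / (real N + 1)" .
  qed
  also have "\<dots> = (\<Sum>j<N. norm (\<xi> (t j) - \<xi> (t (Suc j)))) + real N / (real N + 1)"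
    by (simp add: sum.distrib)
  also have "\<dots> \<le> B + 1"
  proof (rule add_mono)
    show "(\<Sum>j<N. norm (\<xi> (t j) - \<xi> (t (Suc j)))) \<le> B"
      using tpos tT tdec by (intro B[rule_format]) auto
  qed simp
  finally have "real A * \<kappa> \<le> B + 1" using n(2) by (simp add: N_def)
  then show False using A \<kappa> by (simp add: field_simps)
qed

text \<open>\<open>no_linear_fibers\<close> along \<open>w = c0\<close> rules out that the predicate
  \<open>P\<close> is true on the sector of \<open>definable_region\<close>. It is false there, in
  particular at the \<open>w\<close> with \<open>t * w ^ m = \<eta>\<close>, which gives
  \<open>r x > t * w\<close>, a power of \<open>t\<close>.\<close>

theorem definable_lojasiewicz:
  fixes K :: "(real ^ 'n) set" and F r :: "real ^ 'n \<Rightarrow> real" and i0 :: 'n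
  assumes K: "bounded K" and c: "c > 0"
    and ineq: "\<And>x y. x \<in> K \<Longrightarrow> y \<in> K \<Longrightarrow> F x - F y \<le> c * (r x * norm (x - y) + (norm (x - y))\<^sup>2)"
    and def: "definable (\<lambda>s. s 2 \<in> K \<and> F (s 2) = Fs + s 0 $ i0 \<and> r (s 2) \<le> s 1 $ i0)"
  shows "\<exists>C>0. \<exists>\<theta>. 1 / 2 \<le> \<theta> \<and> \<theta> < 1 \<and> (\<exists>\<epsilon>>0. \<forall>x\<in>K. Fs < F x \<longrightarrow> F x < Fs + \<epsilon> \<longrightarrow> (F x - Fs) powr \<theta> \<le> C * r x)"
proof -
  define P where "P s \<longleftrightarrow> (\<exists>x. x \<in> K \<and> F x = Fs + s 0 $ i0 \<and> r x \<le> s 1 $ i0)" for s :: "nat \<Rightarrow> real ^ 'n"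
  have "definable P"
    unfolding P_def[abs_def] by (rule definable_ex[OF def, of 2]) simp
  from definable_region[OF this] obtain c0 n \<eta> b where reg: "c0 \<ge> 1" "\<eta> > 0"
    "\<And>t w. 0 < t \<Longrightarrow> w \<ge> c0 \<Longrightarrow> t * w ^ n \<le> \<eta> \<Longrightarrow> P (ray_state t w) = b" by blast
  have Pray: "P (ray_state t w) \<longleftrightarrow> (\<exists>x\<in>K. F x = Fs + t \<and> r x \<le> t * w)" for t w
    by (auto simp: P_def ray_state_def)
  have nb: "\<not> b"
  proof
    assume b
    have "\<exists>x\<in>K. F x = Fs + t \<and> r x \<le> c0 * t" if "0 < t" "t \<le> \<eta> / c0 ^ n" for t
    proof -
      have "t * c0 ^ n \<le> \<eta>" using that reg(1) by (simp add: field_simps)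
      then show ?thesis using reg(3)[OF that(1) order_refl] \<open>b\<close> Pray by (simp add: mult.commute)
    qed
    then show False
      using no_linear_fibers[OF K c _ _ ineq def, of c0 "\<eta> / c0 ^ n"] reg by simp
  qed
  \<comment> \<open>Passing from \<open>n\<close> to \<open>m\<close> shrinks the sector, as
    \<open>w >= 1\<close>; the value 2 secures \<open>\<theta> >= 1 / 2\<close>.\<close>
  define m where "m = max 2 n"
  define \<theta> where "\<theta> = 1 - 1 / real m"
  \<comment> \<open>\<open>\<epsilon>\<close> ensures \<open>w >= c0\<close> for the chosen
    \<open>w\<close>, and \<open>C\<close> cancels the factor \<open>\<eta> powr (1 / m)\<close> of
    \<open>t * w\<close>.\<close>
  define \<epsilon> where "\<epsilon> = \<eta> / c0 ^ m"
  define C where "C = \<eta> powr (- (1 / real m))"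
  have m: "m \<ge> 2" "m \<ge> n" by (auto simp: m_def)
  have "(F x - Fs) powr \<theta> \<le> C * r x" if x: "x \<in> K" "Fs < F x" "F x < Fs + \<epsilon>" for x
  proof -
    define t where "t = F x - Fs"
    define w where "w = (\<eta> / t) powr (1 / real m)"
    have t: "0 < t" "t < \<eta> / c0 ^ m" using x by (auto simp: t_def \<epsilon>_def)
    have "w ^ m = \<eta> / t" using t(1) reg(2) m(1) by (simp add: w_def powr_powr flip: powr_realpow)
    moreover have "c0 ^ m \<le> \<eta> / t" using t reg(1) by (simp add: field_simps)
    ultimately have w: "c0 \<le> w" using m(1) by (intro power_le_imp_le_base[of c0 "m - 1" w]) (auto simp: w_def)
    have "t * w ^ n \<le> t * w ^ m" using t(1) w reg(1) m(2) by (intro mult_left_mono power_increasing) auto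
    also have "\<dots> = \<eta>" using \<open>w ^ m = \<eta> / t\<close> t(1) by simp
    finally have "\<not> P (ray_state t w)" using reg(3)[OF t(1) w] nb by simp
    then have "t * w < r x" using x(1) unfolding Pray by (force simp: t_def)
    then have "C * (t * w) \<le> C * r x" by (intro mult_left_mono) (auto simp: C_def)
    moreover have "C * (t * w) = t powr \<theta>"
      using t(1) reg(2) by (simp add: C_def w_def \<theta>_def powr_divide powr_minus powr_diff field_simps)
    ultimately show ?thesis by (simp add: t_def)
  qed
  moreover have "C > 0" "1 / 2 \<le> \<theta>" "\<theta> < 1" "\<epsilon> > 0"
    using reg(1,2) m(1) by (auto simp: C_def \<theta>_def \<epsilon>_def field_simps)
  ultimately show ?thesis
    by (intro exI[of _ C] exI[of _ \<theta>] exI[of _ \<epsilon>] conjI) auto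
qed

section \<open>Definability of the quadratic models\<close>

lemma real_polynomial_function_coord_poly:
  fixes p :: "(real ^ 'n) \<times> real \<Rightarrow> real"
  assumes "real_polynomial_function p"
  shows "(\<lambda>s. p (s 0, s 1 $ i0)) \<in> coord_poly"
  using assms
proof (induction rule: real_polynomial_function.induct)
  case (linear f)
  interpret bounded_linear f by fact
  have *: "f (x, y) = (\<Sum>i\<in>UNIV. x $ i * f (axis i 1, 0)) + y * f (0, 1)" for x :: "real ^ 'n" and y
  proof -
    have x: "(x, 0) = (\<Sum>i\<in>UNIV. x $ i *\<^sub>R (axis i 1, 0 :: real))"
      using basis_expansion[of x] by (intro prod_eqI) (simp_all add: fst_sum snd_sum scalar_mult_eq_scaleR)
    have "f (x, y) = f ((x, 0) + y *\<^sub>R (0, 1))" by simp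
    also have "\<dots> = f (x, 0) + y * f (0, 1)" unfolding add scaleR by simp
    also have "f (x, 0) = (\<Sum>i\<in>UNIV. x $ i * f (axis i 1, 0))" unfolding x sum scaleR by simp
    finally show ?thesis .
  qed
  have e: "(\<lambda>s. f (s 0, s 1 $ i0)) = (\<lambda>s. (\<Sum>i\<in>UNIV. s 0 $ i * f (axis i 1, 0)) + s 1 $ i0 * f (0, 1))"
    by (rule ext) (rule *)
  show ?case
    by (rule ssubst[where P = "\<lambda>g. g \<in> coord_poly", OF e])
      (intro coord_poly.add coord_poly.mult coord_poly.coord coord_poly.const cp.sum)
qed (auto intro: coord_poly.intros)

lemma semialgebraic_definable:
  fixes S :: "((real ^ 'n) \<times> real) set"
  assumes "semialgebraic S"
  shows "definable (\<lambda>s. (s 0, s 1 $ i0) \<in> S)"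
proof -
  obtain C where C: "finite C" "\<forall>(P, Q)\<in>C. finite P \<and> finite Q \<and> (\<forall>p\<in>P \<union> Q. real_polynomial_function p)"
    "S = (\<Union>(P, Q)\<in>C. {x. (\<forall>p\<in>P. p x = 0) \<and> (\<forall>q\<in>Q. q x < 0)})"
    using assms unfolding semialgebraic_def by blast
  have "definable (\<lambda>s. \<exists>c\<in>C. (\<forall>p\<in>fst c. p (s 0, s 1 $ i0) = 0) \<and> (\<forall>q\<in>snd c. q (s 0, s 1 $ i0) < 0))"
    using C(1,2)
    by (intro cp.determined_bex cp.determined_conj cp.determined_ball cp.determined_eq cp.determined_less
        real_polynomial_function_coord_poly coord_poly.const) force+
  then show ?thesis unfolding C(3) by (simp add: case_prod_beta)
qed

lemma semialgebraic_fun_definable: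
  fixes f :: "real ^ 'n \<Rightarrow> real"
  assumes "semialgebraic_fun f"
  shows "definable (\<lambda>s. s b $ i0 = f (s a))"
  using definable_rename[OF semialgebraic_definable[OF assms[unfolded semialgebraic_fun_def], of i0], of "\<lambda>k. if k = 0 then a else b"] by simp

text \<open>The gradient is characterized by a quantified quadratic inequality between values of
  \<open>f\<close>, so no limit enters the formula.\<close>

lemma grad_definable:
  fixes f :: "real ^ 'n \<Rightarrow> real"
  assumes f: "semialgebraic_fun f"
    and grad: "\<And>x D. D = grad f x \<longleftrightarrow> (\<forall>y. \<bar>f y - f x - inner D (y - x)\<bar> \<le> L / 2 * (norm (y - x))\<^sup>2)"
  shows "definable (\<lambda>s. s b = grad f (s a))"
proof -
  \<comment> \<open>Scalars are stored in an arbitrary coordinate \<open>i0\<close>: variables 3 and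
    4 hold values of \<open>f\<close>, and the absolute value is split into two polynomial
    inequalities.\<close>
  fix i0 :: 'n
  have "definable (\<lambda>s. s 3 $ i0 = f (s 0) \<and> s 4 $ i0 = f (s 2) \<and>
      s 4 $ i0 - s 3 $ i0 - inner (s 1) (s 2 - s 0) \<le> L / 2 * inner (s 2 - s 0) (s 2 - s 0) \<and>
      0 \<le> s 4 $ i0 - s 3 $ i0 - inner (s 1) (s 2 - s 0) + L / 2 * inner (s 2 - s 0) (s 2 - s 0))"
    by (intro cp.determined_conj semialgebraic_fun_definable f)
      (intro cp.determined_le cp.diff coord_poly.add coord_poly.mult coord_poly.const coord_poly.coord coord_poly_inner;
        simp add: cp.diff coord_poly.coord)+
  then have "definable (\<lambda>s. \<exists>v. s 3 $ i0 = f (s 0) \<and> v $ i0 = f (s 2) \<and>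
      v $ i0 - s 3 $ i0 - inner (s 1) (s 2 - s 0) \<le> L / 2 * inner (s 2 - s 0) (s 2 - s 0) \<and>
      0 \<le> v $ i0 - s 3 $ i0 - inner (s 1) (s 2 - s 0) + L / 2 * inner (s 2 - s 0) (s 2 - s 0))"
    by (rule definable_ex[where k = 4]) simp
  then have "definable (\<lambda>s. \<exists>u v. u $ i0 = f (s 0) \<and> v $ i0 = f (s 2) \<and>
      v $ i0 - u $ i0 - inner (s 1) (s 2 - s 0) \<le> L / 2 * inner (s 2 - s 0) (s 2 - s 0) \<and>
      0 \<le> v $ i0 - u $ i0 - inner (s 1) (s 2 - s 0) + L / 2 * inner (s 2 - s 0) (s 2 - s 0))"
    by (rule definable_ex[where k = 3]) simp
  then have "definable (\<lambda>s. \<forall>y. \<exists>u v. u $ i0 = f (s 0) \<and> v $ i0 = f y \<and>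
      v $ i0 - u $ i0 - inner (s 1) (y - s 0) \<le> L / 2 * inner (y - s 0) (y - s 0) \<and>
      0 \<le> v $ i0 - u $ i0 - inner (s 1) (y - s 0) + L / 2 * inner (y - s 0) (y - s 0))"
    by (rule definable_all[where k = 2]) simp
  moreover have "(\<exists>u v. u $ i0 = f x \<and> v $ i0 = f y \<and>
      v $ i0 - u $ i0 - inner D (y - x) \<le> L / 2 * inner (y - x) (y - x) \<and>
      0 \<le> v $ i0 - u $ i0 - inner D (y - x) + L / 2 * inner (y - x) (y - x)) \<longleftrightarrow>
      \<bar>f y - f x - inner D (y - x)\<bar> \<le> L / 2 * (norm (y - x))\<^sup>2" for x y D
  proof -
    have "(\<exists>u v. u $ i0 = a \<and> v $ i0 = b \<and> v $ i0 - u $ i0 - c \<le> d \<and> 0 \<le> v $ i0 - u $ i0 - c + d)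
      \<longleftrightarrow> \<bar>b - a - c\<bar> \<le> d" for a b c d :: real
    proof
      assume "\<bar>b - a - c\<bar> \<le> d"
      then show "\<exists>u v. u $ i0 = a \<and> v $ i0 = b \<and> v $ i0 - u $ i0 - c \<le> d \<and> 0 \<le> v $ i0 - u $ i0 - c + d"
        by (intro exI[of _ "vec a"] exI[of _ "vec b"]) auto
    qed auto
    then show ?thesis by (simp only: power2_norm_eq_inner)
  qed
  ultimately have "definable (\<lambda>s. s 1 = grad f (s 0))" by (simp only: grad)
  from definable_rename[OF this, of "\<lambda>k. if k = 0 then a else b"] show ?thesis by simp
qed

lemma quad_model_definable:
  fixes f :: "real ^ 'n \<Rightarrow> real"
  assumes f: "semialgebraic_fun f"
    and grad: "\<And>x D. D = grad f x \<longleftrightarrow> (\<forall>y. \<bar>f y - f x - inner D (y - x)\<bar> \<le> L / 2 * (norm (y - x))\<^sup>2)"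
  shows "definable (\<lambda>s. s c $ i0 = quad_model f L (s a) (s b))"
proof -
  have "definable (\<lambda>s. s 3 $ i0 = f (s 0) \<and> s 4 = grad f (s 0) \<and>
      s 2 $ i0 = s 3 $ i0 + inner (s 4) (s 1 - s 0) + L / 2 * inner (s 1 - s 0) (s 1 - s 0))"
    by (intro cp.determined_conj semialgebraic_fun_definable[OF f] grad_definable[OF f grad])
      (intro cp.determined_eq coord_poly.add coord_poly.mult coord_poly.const coord_poly.coord coord_poly_inner;
        simp add: cp.diff coord_poly.coord)
  then have "definable (\<lambda>s. \<exists>D. s 3 $ i0 = f (s 0) \<and> D = grad f (s 0) \<and>
      s 2 $ i0 = s 3 $ i0 + inner D (s 1 - s 0) + L / 2 * inner (s 1 - s 0) (s 1 - s 0))"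
    by (rule definable_ex[where k = 4]) simp
  then have "definable (\<lambda>s. \<exists>u D. u $ i0 = f (s 0) \<and> D = grad f (s 0) \<and>
      s 2 $ i0 = u $ i0 + inner D (s 1 - s 0) + L / 2 * inner (s 1 - s 0) (s 1 - s 0))"
    by (rule definable_ex[where k = 3]) simp
  moreover have "(\<exists>u D. u $ i0 = f x \<and> D = grad f x \<and>
      v = u $ i0 + inner D (y - x) + L / 2 * inner (y - x) (y - x)) \<longleftrightarrow> v = quad_model f L x y" for x y v
  proof -
    have "\<exists>u :: real ^ 'n. u $ i0 = f x" by (rule exI[of _ "vec (f x)"]) simp
    then show ?thesis by (auto simp: quad_model_def power2_norm_eq_inner)
  qed
  ultimately have "definable (\<lambda>s. s 2 $ i0 = quad_model f L (s 0) (s 1))" by simp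
  from definable_rename[OF this, of "\<lambda>k. if k = 0 then a else if k = 1 then b else c"] show ?thesis by simp
qed

section \<open>The subproblems\<close>

lemma GDERIV_grad:
  fixes f :: "'a::euclidean_space \<Rightarrow> real"
  assumes "f differentiable (at x)"
  shows "GDERIV f x :> grad f x"
proof -
  obtain f' where f': "(f has_derivative f') (at x)" using assms unfolding differentiable_def by blast
  then interpret linear f' by (rule has_derivative_linear)
  have "f' h = inner h (\<Sum>b\<in>Basis. f' b *\<^sub>R b)" for h
  proof -
    have "f' h = f' (\<Sum>b\<in>Basis. inner h b *\<^sub>R b)" by (simp add: euclidean_representation)
    also have "\<dots> = (\<Sum>b\<in>Basis. inner h b * f' b)" unfolding sum scaleR by simp
    finally show ?thesis by (simp add: inner_sum_right mult.commute)
  qed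
  then have "f' = (\<lambda>h. inner h (\<Sum>b\<in>Basis. f' b *\<^sub>R b))" by (rule ext)
  then have "GDERIV f x :> (\<Sum>b\<in>Basis. f' b *\<^sub>R b)" using f' unfolding gderiv_def by simp
  then show ?thesis using grad_eq by metis
qed

text \<open>Along the segment from \<open>x\<close> to \<open>y\<close> the difference
  \<open>\<phi>\<close> between \<open>f\<close> and its bound has nonpositive derivative, by the
  Cauchy-Schwarz inequality and the Lipschitz condition.\<close>

lemma lipschitz_gradient_upper_bound:
  fixes f :: "'a::real_inner \<Rightarrow> real"
  assumes g: "\<And>x. GDERIV f x :> g x" and lip: "\<And>x y. norm (g x - g y) \<le> L * norm (x - y)"
  shows "f y - f x - inner (g x) (y - x) \<le> L / 2 * (norm (y - x))\<^sup>2"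
proof -
  define h where "h = y - x"
  define \<phi> where "\<phi> s = f (x + s *\<^sub>R h) - s * inner (g x) h - L / 2 * s\<^sup>2 * (norm h)\<^sup>2" for s
  have d: "(\<phi> has_real_derivative inner h (g (x + s *\<^sub>R h)) - inner (g x) h - L * s * (norm h)\<^sup>2) (at s)" for s
  proof -
    have "(f has_derivative (\<lambda>v. inner v (g (x + s *\<^sub>R h)))) (at (x + s *\<^sub>R h))"
      using g unfolding gderiv_def by simp
    moreover have "((\<lambda>s. x + s *\<^sub>R h) has_derivative (\<lambda>t. t *\<^sub>R h)) (at s)"
      by (auto intro!: derivative_eq_intros)
    ultimately have "((\<lambda>s. f (x + s *\<^sub>R h)) has_derivative (\<lambda>t. inner (t *\<^sub>R h) (g (x + s *\<^sub>R h)))) (at s)"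
      by (rule has_derivative_compose[rotated])
    then have "((\<lambda>s. f (x + s *\<^sub>R h)) has_real_derivative inner h (g (x + s *\<^sub>R h))) (at s)"
      unfolding has_field_derivative_def by (rule has_derivative_eq_rhs) (simp add: fun_eq_iff)
    then show ?thesis unfolding \<phi>_def by (auto intro!: derivative_eq_intros)
  qed
  have "\<phi> 1 \<le> \<phi> 0"
  proof (rule DERIV_nonpos_imp_nonincreasing[of 0 1 \<phi>])
    fix s :: real assume s: "0 \<le> s" "s \<le> 1"
    have "inner h (g (x + s *\<^sub>R h)) - inner (g x) h = inner (g (x + s *\<^sub>R h) - g x) h"
      by (simp add: inner_diff_right inner_commute)
    also have "\<dots> \<le> norm (g (x + s *\<^sub>R h) - g x) * norm h" by (rule norm_cauchy_schwarz)
    also have "\<dots> \<le> L * norm (s *\<^sub>R h) * norm h" using lip[of "x + s *\<^sub>R h" x] by (intro mult_right_mono) auto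
    also have "\<dots> = L * s * (norm h)\<^sup>2" using s by (simp add: power2_eq_square)
    finally show "\<exists>d. (\<phi> has_real_derivative d) (at s) \<and> d \<le> 0" using d by (intro exI conjI) auto
  qed simp
  then show ?thesis by (simp add: \<phi>_def h_def)
qed

lemma lipschitz_gradient_quadratic_bound:
  fixes f :: "'a::real_inner \<Rightarrow> real"
  assumes g: "\<And>x. GDERIV f x :> g x" and lip: "\<And>x y. norm (g x - g y) \<le> L * norm (x - y)"
  shows "\<bar>f y - f x - inner (g x) (y - x)\<bar> \<le> L / 2 * (norm (y - x))\<^sup>2"
proof -
  have "(- f y) - (- f x) - inner (- g x) (y - x) \<le> L / 2 * (norm (y - x))\<^sup>2"
    by (rule lipschitz_gradient_upper_bound[of "\<lambda>x. - f x" "\<lambda>x. - g x"])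
      (use g lip in \<open>auto intro: GDERIV_minus simp: norm_minus_commute\<close>)
  then have "- (f y - f x - inner (g x) (y - x)) \<le> L / 2 * (norm (y - x))\<^sup>2" by simp
  with lipschitz_gradient_upper_bound[OF g lip] show ?thesis by (rule abs_leI)
qed

text \<open>A displacement of size \<open>s\<close> in the direction \<open>D - E\<close> separates
  the two linear terms to first order in \<open>s\<close>, while both errors are of second order;
  this fails for small \<open>s\<close>.\<close>

lemma gradient_unique_quadratic:
  fixes f :: "'a::real_inner \<Rightarrow> real"
  assumes "\<And>y. \<bar>f y - f x - inner D (y - x)\<bar> \<le> B * (norm (y - x))\<^sup>2"
    and "\<And>y. \<bar>f y - f x - inner E (y - x)\<bar> \<le> B * (norm (y - x))\<^sup>2"
  shows "D = E"
proof (rule ccontr)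
  assume "D \<noteq> E"
  define h where "h = D - E"
  have h: "norm h > 0" using \<open>D \<noteq> E\<close> by (simp add: h_def)
  have le: "s * (norm h)\<^sup>2 \<le> 2 * B * s\<^sup>2 * (norm h)\<^sup>2" if "s > 0" for s
  proof -
    have "s * (norm h)\<^sup>2 = inner D (s *\<^sub>R h) - inner E (s *\<^sub>R h)"
      by (simp add: h_def power2_norm_eq_inner inner_diff_left inner_diff_right algebra_simps)
    also have "\<dots> \<le> 2 * (B * (norm (s *\<^sub>R h))\<^sup>2)"
      using assms(1)[of "x + s *\<^sub>R h"] assms(2)[of "x + s *\<^sub>R h"] by simp
    finally show ?thesis by (simp add: power_mult_distrib)
  qed
  have key: "1 \<le> 2 * B * s" if "s > 0" for s
  proof -
    have "(s * (norm h)\<^sup>2) * 1 \<le> (s * (norm h)\<^sup>2) * (2 * B * s)"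
      using le[OF that] by (simp add: power2_eq_square algebra_simps)
    moreover have "0 < s * (norm h)\<^sup>2" using that h by simp
    ultimately show ?thesis by (rule mult_left_le_imp_le)
  qed
  \<comment> \<open>This \<open>s\<close> is positive for every \<open>B\<close> and makes the right
    side at most one half.\<close>
  have "1 \<le> 2 * B * (1 / (4 * (\<bar>B\<bar> + 1)))" by (rule key) simp
  also have "\<dots> \<le> 2 * (\<bar>B\<bar> + 1) * (1 / (4 * (\<bar>B\<bar> + 1)))" by (intro mult_right_mono) auto
  also have "\<dots> = 1 / 2" by (simp add: field_simps)
  finally show False by simp
qed

text \<open>Otherwise a hyperplane strictly separates 0 from the compact convex hull of the vectors,
  and its negated normal is a common descent direction.\<close>

lemma gordan_alternative:
  fixes g :: "nat \<Rightarrow> 'a::euclidean_space"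
  assumes I: "finite I" "I \<noteq> {}" and no: "\<nexists>d. \<forall>i\<in>I. inner (g i) d < 0"
  obtains \<mu> where "\<And>i. i \<in> I \<Longrightarrow> \<mu> i \<ge> (0::real)" "sum \<mu> I = 1" "(\<Sum>i\<in>I. \<mu> i *\<^sub>R g i) = 0"
proof -
  define C where "C = {\<Sum>i\<in>I. \<mu> i *\<^sub>R g i | \<mu>. (\<forall>i\<in>I. \<mu> i \<ge> 0) \<and> sum \<mu> I = (1::real)}"
  have "convex C"
    unfolding convex_def
  proof (intro ballI allI impI)
    fix x y and u v :: real assume "x \<in> C" "y \<in> C" and uv: "0 \<le> u" "0 \<le> v" "u + v = 1"
    then obtain \<mu> \<nu> where \<mu>: "\<forall>i\<in>I. \<mu> i \<ge> 0" "sum \<mu> I = 1" "x = (\<Sum>i\<in>I. \<mu> i *\<^sub>R g i)"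
      and \<nu>: "\<forall>i\<in>I. \<nu> i \<ge> 0" "sum \<nu> I = 1" "y = (\<Sum>i\<in>I. \<nu> i *\<^sub>R g i)" unfolding C_def by blast
    have "u *\<^sub>R x + v *\<^sub>R y = (\<Sum>i\<in>I. (u * \<mu> i + v * \<nu> i) *\<^sub>R g i)"
      by (simp add: \<mu>(3) \<nu>(3) scaleR_sum_right sum.distrib scaleR_add_left)
    moreover have "(\<Sum>i\<in>I. u * \<mu> i + v * \<nu> i) = 1"
      using \<mu>(2) \<nu>(2) uv(3) by (simp add: sum.distrib flip: sum_distrib_left)
    ultimately show "u *\<^sub>R x + v *\<^sub>R y \<in> C"
      unfolding C_def using \<mu>(1) \<nu>(1) uv by (intro CollectI exI[of _ "\<lambda>i. u * \<mu> i + v * \<nu> i"]) auto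
  qed
  moreover have "g ` I \<subseteq> C"
  proof
    fix x assume "x \<in> g ` I"
    then obtain j where j: "j \<in> I" "x = g j" by blast
    have "(\<Sum>i\<in>I. (if i = j then 1 else 0) *\<^sub>R g i) = (\<Sum>i\<in>I. if i = j then g i else 0)"
      by (intro sum.cong) auto
    then show "x \<in> C" unfolding C_def using j I(1)
      by (intro CollectI exI[of _ "\<lambda>i. if i = j then 1 else 0"]) auto
  qed
  ultimately have hull: "convex hull (g ` I) \<subseteq> C" by (simp add: hull_minimal)
  have "0 \<in> convex hull (g ` I)"
  proof (rule ccontr)
    assume "0 \<notin> convex hull (g ` I)"
    moreover have "closed (convex hull (g ` I))"
      using I(1) by (intro compact_imp_closed finite_imp_compact_convex_hull) simp
    ultimately obtain a b where ab: "0 < b" "\<And>x. x \<in> convex hull (g ` I) \<Longrightarrow> b < inner a x"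
      using separating_hyperplane_closed_0[of "convex hull (g ` I)"] by (auto simp: convex_convex_hull)
    have "\<forall>i\<in>I. inner (g i) (- a) < 0"
      using ab(1) ab(2)[OF hull_inc] by (fastforce simp: inner_commute)
    then show False using no by blast
  qed
  then have "0 \<in> C" using hull by blast
  then obtain \<mu> where "\<forall>i\<in>I. \<mu> i \<ge> 0" "sum \<mu> I = 1" "0 = (\<Sum>i\<in>I. \<mu> i *\<^sub>R g i)" unfolding C_def by blast
  then show ?thesis using that by force
qed

text \<open>Along a ray an inactive constraint (\<open>a < 0\<close>) stays negative by continuity,
  an active one (\<open>a = 0\<close>) becomes negative by its slope \<open>b\<close>.\<close>

lemma eventually_quadratic_neg:
  fixes a b c :: real
  assumes "a \<le> 0" "a = 0 \<Longrightarrow> b < 0"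
  shows "\<forall>\<^sub>F \<tau> in at_right 0. a + \<tau> * b + c * \<tau>\<^sup>2 < 0"
proof (cases "a = 0")
  case True
  have "((\<lambda>\<tau>. b + c * \<tau>) \<longlongrightarrow> b + c * 0) (at_right 0)" by (intro tendsto_intros)
  then have "\<forall>\<^sub>F \<tau> in at_right 0. b + c * \<tau> < 0" using assms(2)[OF True] by (intro order_tendstoD) auto
  moreover have "\<forall>\<^sub>F \<tau> in at_right (0::real). \<tau> > 0" by (simp add: eventually_at_right_less)
  ultimately show ?thesis
  proof eventually_elim
    case (elim \<tau>)
    then have "\<tau> * (b + c * \<tau>) < 0" by (simp add: mult_pos_neg)
    then show ?case using True by (simp add: algebra_simps power2_eq_square)
  qed
next
  case False
  have "((\<lambda>\<tau>. a + \<tau> * b + c * \<tau>\<^sup>2) \<longlongrightarrow> a + 0 * b + c * 0\<^sup>2) (at_right 0)" by (intro tendsto_intros)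
  then show ?thesis using assms(1) False by (intro order_tendstoD) auto
qed

text \<open>The models have constant second derivative, so the expansion about any \<open>y\<close>
  is exact.\<close>

lemma quad_model_expand:
  "quad_model f L x z = quad_model f L x y + inner (grad f x + L *\<^sub>R (y - x)) (z - y) + L / 2 * (norm (z - y))\<^sup>2"
proof -
  have "(norm (u + v))\<^sup>2 = (norm u)\<^sup>2 + 2 * inner v u + (norm v)\<^sup>2" for u v :: 'a
    by (simp add: power2_norm_eq_inner inner_add_left inner_add_right inner_commute)
  from this[of "z - y" "y - x"]
  have A: "(norm (z - x))\<^sup>2 = (norm (z - y))\<^sup>2 + 2 * inner (y - x) (z - y) + (norm (y - x))\<^sup>2" by simp
  have B: "inner (grad f x) (z - x) = inner (grad f x) (z - y) + inner (grad f x) (y - x)"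
    by (simp add: inner_diff_right)
  show ?thesis
    unfolding quad_model_def inner_add_left inner_scaleR_left A B by (simp add: field_simps)
qed

lemma quad_model_line:
  "quad_model f L x (y + \<tau> *\<^sub>R d) = quad_model f L x y + \<tau> * inner (grad f x + L *\<^sub>R (y - x)) d + (L / 2 * (norm d)\<^sup>2) * \<tau>\<^sup>2"
  using quad_model_expand[of f L x "y + \<tau> *\<^sub>R d" y] by (simp add: power_mult_distrib)

lemma quad_model_self [simp]: "quad_model f L x x = f x"
  by (simp add: quad_model_def)

locale smooth_function =
  fixes f :: "'a::euclidean_space \<Rightarrow> real" and L :: real
  assumes L_pos: "L > 0" and deriv: "GDERIV f x :> grad f x"
    and lip: "norm (grad f x - grad f y) \<le> L * norm (x - y)"
begin

lemma quadratic_bound: "\<bar>f y - f x - inner (grad f x) (y - x)\<bar> \<le> L / 2 * (norm (y - x))\<^sup>2"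
  by (rule lipschitz_gradient_quadratic_bound[OF deriv lip])

lemma grad_iff: "D = grad f x \<longleftrightarrow> (\<forall>y. \<bar>f y - f x - inner D (y - x)\<bar> \<le> L / 2 * (norm (y - x))\<^sup>2)"
  using quadratic_bound[of _ x] gradient_unique_quadratic[of f x D "L / 2" "grad f x"] by blast

lemma majorant: "f y \<le> quad_model f L x y"
  using quadratic_bound[of y x, THEN abs_le_D1] by (simp add: quad_model_def)

lemma continuous: "continuous_on S f"
  using deriv unfolding gderiv_def
  by (intro continuous_at_imp_continuous_on ballI) (blast intro: has_derivative_continuous)

lemma continuous_grad: "continuous_on S (grad f)"
proof (rule continuous_on_subset[OF lipschitz_on_continuous_on])
  show "L-lipschitz_on UNIV (grad f)"
    using lip L_pos by (intro lipschitz_onI) (auto simp: dist_norm)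
qed simp

lemma continuous_model: "continuous_on S (\<lambda>x. quad_model f L x z)" "continuous_on S (\<lambda>z. quad_model f L x z)"
  unfolding quad_model_def by (intro continuous_intros continuous continuous_grad)+

lemma quad_model_shift:
  "quad_model f L x z - 2 * L * (norm (x' - x) * norm (z - x)) \<le> quad_model f L x' z"
proof -
  have a: "f x' - f x - inner (grad f x') (x' - x) \<ge> - (L / 2 * (norm (x' - x))\<^sup>2)"
    using quadratic_bound[of x x', THEN abs_le_D1] norm_minus_commute[of x x'] by (simp add: inner_diff_right)
  have "\<bar>inner (grad f x' - grad f x) (z - x)\<bar> \<le> L * norm (x' - x) * norm (z - x)"
    using Cauchy_Schwarz_ineq2 lip by (rule order_trans[OF _ mult_right_mono]) auto
  then have b: "inner (grad f x' - grad f x) (z - x) \<ge> - (L * (norm (x' - x) * norm (z - x)))"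
    by (simp add: abs_le_iff)
  have "z - x' = (z - x) - (x' - x)" by simp
  then have "(norm (z - x'))\<^sup>2 = (norm (z - x))\<^sup>2 - 2 * inner (z - x) (x' - x) + (norm (x' - x))\<^sup>2"
    by (simp add: power2_norm_eq_inner inner_diff_left inner_diff_right inner_commute)
  moreover have "inner (z - x) (x' - x) \<le> norm (x' - x) * norm (z - x)"
    using norm_cauchy_schwarz[of "z - x" "x' - x"] by (simp add: mult.commute)
  ultimately have "(norm (z - x'))\<^sup>2 - (norm (z - x))\<^sup>2 \<ge> (norm (x' - x))\<^sup>2 - 2 * (norm (x' - x) * norm (z - x))" by simp
  then have "L / 2 * ((norm (z - x'))\<^sup>2 - (norm (z - x))\<^sup>2) \<ge> L / 2 * ((norm (x' - x))\<^sup>2 - 2 * (norm (x' - x) * norm (z - x)))"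
    using L_pos by (intro mult_left_mono) auto
  moreover have "quad_model f L x' z - quad_model f L x z = (f x' - f x - inner (grad f x') (x' - x))
      + inner (grad f x' - grad f x) (z - x) + L / 2 * ((norm (z - x'))\<^sup>2 - (norm (z - x))\<^sup>2)"
    by (simp add: quad_model_def inner_diff_left inner_diff_right algebra_simps)
  ultimately show ?thesis using a b by (simp add: algebra_simps)
qed

end

locale moving_balls =
  fixes m :: nat and f :: "'a::euclidean_space \<Rightarrow> real" and fc :: "nat \<Rightarrow> 'a \<Rightarrow> real"
    and L :: real and Lc :: "nat \<Rightarrow> real" and K :: "'a set"
  assumes objective: "smooth_function f L"
    and constraints: "i \<in> {1..m} \<Longrightarrow> smooth_function (fc i) (Lc i)"
    and compact_K: "compact K" and K_feasible: "K \<subseteq> feasible_set m fc"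
    and mfcq: "MFCQ m fc"
begin

sublocale objective: smooth_function f L by (rule objective)

abbreviation obj :: "'a \<Rightarrow> 'a \<Rightarrow> real" where "obj \<equiv> quad_model f L"
abbreviation con :: "nat \<Rightarrow> 'a \<Rightarrow> 'a \<Rightarrow> real" where "con i \<equiv> quad_model (fc i) (Lc i)"

definition admissible :: "'a \<Rightarrow> 'a \<Rightarrow> bool" where
  "admissible x y \<longleftrightarrow> (\<forall>i\<in>{1..m}. con i x y \<le> 0)"

definition solution :: "'a \<Rightarrow> 'a \<Rightarrow> bool" where
  "solution x y \<longleftrightarrow> is_arg_min (obj x) (admissible x) y"

lemma solutionD: "solution x y \<Longrightarrow> admissible x y" "solution x y \<Longrightarrow> admissible x z \<Longrightarrow> obj x y \<le> obj x z"
  by (auto simp: solution_def is_arg_min_linorder)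

lemma solutionI: "admissible x y \<Longrightarrow> (\<And>z. admissible x z \<Longrightarrow> obj x y \<le> obj x z) \<Longrightarrow> solution x y"
  by (auto simp: solution_def is_arg_min_linorder)

lemma admissible_self: "x \<in> K \<Longrightarrow> admissible x x"
  using K_feasible by (auto simp: admissible_def feasible_set_def)

lemma step_bound:
  assumes "obj x y \<le> f x"
  shows "norm (y - x) \<le> 2 * norm (grad f x) / L"
proof (cases "y = x")
  case True
  then show ?thesis using objective.L_pos by simp
next
  case False
  have "L / 2 * (norm (y - x))\<^sup>2 \<le> - inner (grad f x) (y - x)"
    using assms by (simp add: quad_model_def)
  also have "\<dots> \<le> norm (grad f x) * norm (y - x)"
    using Cauchy_Schwarz_ineq2[of "grad f x" "y - x"] by (simp add: abs_le_iff)
  finally have "norm (y - x) * (L / 2 * norm (y - x)) \<le> norm (y - x) * norm (grad f x)"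
    by (simp add: power2_eq_square algebra_simps)
  then have "L / 2 * norm (y - x) \<le> norm (grad f x)"
    by (rule mult_left_le_imp_le) (use False in simp)
  then show ?thesis using objective.L_pos by (simp add: field_simps)
qed

lemma solution_step_bound: "x \<in> K \<Longrightarrow> solution x y \<Longrightarrow> norm (y - x) \<le> 2 * norm (grad f x) / L"
  using solutionD(2)[OF _ admissible_self] by (intro step_bound) simp

lemma solution_exists:
  assumes "x \<in> K"
  shows "\<exists>y. solution x y"
proof -
  define S where "S = {y. admissible x y} \<inter> cball x (2 * norm (grad f x) / L)"
  have "{y. admissible x y} = (\<Inter>i\<in>{1..m}. {y. con i x y \<le> 0})" by (auto simp: admissible_def)
  moreover have "closed (\<Inter>i\<in>{1..m}. {y. con i x y \<le> 0})"
    using smooth_function.continuous_model(2)[OF constraints]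
    by (intro closed_INT ballI closed_Collect_le) (auto intro: continuous_intros)
  ultimately have "compact S" unfolding S_def by (simp add: closed_Int_compact)
  moreover have xS: "x \<in> S" using admissible_self[OF assms] objective.L_pos by (simp add: S_def)
  ultimately obtain y where y: "y \<in> S" "\<And>z. z \<in> S \<Longrightarrow> obj x y \<le> obj x z"
    using continuous_attains_inf[of S "obj x"] objective.continuous_model(2) by blast
  have "solution x y"
  proof (rule solutionI)
    show "admissible x y" using y(1) by (simp add: S_def)
    fix z assume z: "admissible x z"
    show "obj x y \<le> obj x z"
    proof (cases "obj x z \<le> f x")
      case True
      then have "z \<in> S" using step_bound[OF True] z by (simp add: S_def dist_norm norm_minus_commute)
      then show ?thesis by (rule y(2))
    next
      case False
      then show ?thesis using y(2)[OF xS] by simp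
    qed
  qed
  then show ?thesis by blast
qed

lemma slater_point:
  assumes "x \<in> K"
  shows "\<exists>z. \<forall>i\<in>{1..m}. con i x z < 0"
proof -
  obtain d where d: "\<And>i. i \<in> active_set m fc x \<Longrightarrow> inner (grad (fc i) x) d < 0"
    using mfcq K_feasible assms unfolding MFCQ_def by blast
  have "\<forall>\<^sub>F \<tau> in at_right 0. \<forall>i\<in>{1..m}. con i x (x + \<tau> *\<^sub>R d) < 0"
  proof (intro eventually_ball_finite ballI)
    fix i assume i: "i \<in> {1..m}"
    then have "fc i x \<le> 0" using K_feasible assms by (auto simp: feasible_set_def)
    moreover have "inner (grad (fc i) x) d < 0" if "fc i x = 0" using d i that by (simp add: active_set_def)
    ultimately show "\<forall>\<^sub>F \<tau> in at_right 0. con i x (x + \<tau> *\<^sub>R d) < 0"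
      using eventually_quadratic_neg[of "fc i x" "inner (grad (fc i) x) d" "Lc i / 2 * (norm d)\<^sup>2"]
      by (simp add: quad_model_line)
  qed simp
  then obtain \<tau> where "\<forall>i\<in>{1..m}. con i x (x + \<tau> *\<^sub>R d) < 0"
    using eventually_happens'[OF trivial_limit_at_right_real] by blast
  then show ?thesis by blast
qed

lemma uniform_slater:
  obtains \<eta> B where "\<eta> > 0" "\<And>x. x \<in> K \<Longrightarrow> \<exists>z. norm z \<le> B \<and> (\<forall>i\<in>{1..m}. con i x z \<le> - \<eta>)"
proof -
  define U where "U z k = (\<Inter>i\<in>{1..m}. {x. con i x z < - 1 / real (Suc k)})" for z k
  have "open (U z k)" for z k
    unfolding U_def using smooth_function.continuous_model(1)[OF constraints]
    by (intro open_INT ballI open_Collect_less) (auto intro: continuous_intros)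
  moreover have "\<exists>z k. x \<in> U z k" if x: "x \<in> K" for x
  proof -
    obtain z where z: "\<forall>i\<in>{1..m}. con i x z < 0" using slater_point[OF x] by blast
    have "\<forall>\<^sub>F k in sequentially. \<forall>i\<in>{1..m}. con i x z < - 1 / real (Suc k)"
    proof (intro eventually_ball_finite ballI)
      fix i assume "i \<in> {1..m}"
      have "(\<lambda>k. - 1 / real (Suc k)) \<longlonglongrightarrow> 0"
        using tendsto_minus[OF LIMSEQ_inverse_real_of_nat] by (simp add: divide_inverse)
      then show "\<forall>\<^sub>F k in sequentially. con i x z < - 1 / real (Suc k)"
        using z \<open>i \<in> {1..m}\<close> by (intro order_tendstoD) auto
    qed simp
    then obtain k where "\<forall>i\<in>{1..m}. con i x z < - 1 / real (Suc k)"
      using eventually_happens'[OF sequentially_bot] by blast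
    then show ?thesis by (auto simp: U_def)
  qed
  ultimately obtain D where D: "D \<subseteq> (UNIV :: ('a \<times> nat) set)" "finite D" "K \<subseteq> (\<Union>c\<in>D. U (fst c) (snd c))"
    using compactE_image[OF compact_K, of UNIV "\<lambda>c. U (fst c) (snd c)"] by force
  define B where "B = (\<Sum>c\<in>D. norm (fst c))"
  define k where "k = (\<Sum>c\<in>D. snd c)"
  show ?thesis
  proof (rule that[of "1 / real (Suc k)" B])
    fix x assume "x \<in> K"
    then obtain c where c: "c \<in> D" "x \<in> U (fst c) (snd c)" using D(3) by blast
    have "norm (fst c) \<le> B" unfolding B_def using D(2) c(1) by (intro member_le_sum) auto
    moreover have "snd c \<le> k" unfolding k_def using D(2) c(1) by (intro member_le_sum) auto
    then have "1 / real (Suc k) \<le> 1 / real (Suc (snd c))" by (simp add: frac_le)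
    then have "con i x (fst c) \<le> - (1 / real (Suc k))" if "i \<in> {1..m}" for i
      using c(2) that by (force simp: U_def)
    ultimately show "\<exists>z. norm z \<le> B \<and> (\<forall>i\<in>{1..m}. con i x z \<le> - (1 / real (Suc k)))" by blast
  qed simp
qed

lemma fritz_john:
  assumes "solution x y"
  obtains \<mu>0 \<mu> where "\<mu>0 \<ge> 0" "\<And>i. i \<in> {1..m} \<Longrightarrow> \<mu> i \<ge> (0::real)" "\<mu>0 + (\<Sum>i=1..m. \<mu> i) = 1"
    "\<And>i. i \<in> {1..m} \<Longrightarrow> \<mu> i * con i x y = 0"
    "\<mu>0 *\<^sub>R (grad f x + L *\<^sub>R (y - x)) + (\<Sum>i=1..m. \<mu> i *\<^sub>R (grad (fc i) x + Lc i *\<^sub>R (y - x))) = 0"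
proof -
  define J where "J = {i\<in>{1..m}. con i x y = 0}"
  define g where "g i = (if i = 0 then grad f x + L *\<^sub>R (y - x) else grad (fc i) x + Lc i *\<^sub>R (y - x))" for i
  have fin: "finite J" "0 \<notin> J" by (auto simp: J_def)
  have "\<nexists>d. \<forall>i\<in>insert 0 J. inner (g i) d < 0"
  proof
    assume "\<exists>d. \<forall>i\<in>insert 0 J. inner (g i) d < 0"
    then obtain d where d: "inner (g 0) d < 0" "\<And>i. i \<in> J \<Longrightarrow> inner (g i) d < 0" by auto
    have "\<forall>\<^sub>F \<tau> in at_right 0. \<forall>i\<in>{1..m}. con i x (y + \<tau> *\<^sub>R d) < 0"
    proof (intro eventually_ball_finite ballI)
      fix i assume i: "i \<in> {1..m}"
      then have "con i x y \<le> 0" using solutionD(1)[OF assms] by (simp add: admissible_def)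
      moreover have "inner (g i) d < 0" if "con i x y = 0" using d(2) i that by (simp add: J_def)
      ultimately show "\<forall>\<^sub>F \<tau> in at_right 0. con i x (y + \<tau> *\<^sub>R d) < 0"
        using eventually_quadratic_neg[of "con i x y" "inner (g i) d" "Lc i / 2 * (norm d)\<^sup>2"] i
        by (simp add: quad_model_line g_def)
    qed simp
    moreover have "\<forall>\<^sub>F \<tau> in at_right 0. obj x (y + \<tau> *\<^sub>R d) < obj x y"
      using eventually_quadratic_neg[of 0 "inner (g 0) d" "L / 2 * (norm d)\<^sup>2"] d(1)
      by (simp add: quad_model_line g_def)
    ultimately have "\<forall>\<^sub>F \<tau> in at_right 0. (\<forall>i\<in>{1..m}. con i x (y + \<tau> *\<^sub>R d) < 0) \<and> obj x (y + \<tau> *\<^sub>R d) < obj x y"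
      by (rule eventually_conj)
    then obtain \<tau> where "\<forall>i\<in>{1..m}. con i x (y + \<tau> *\<^sub>R d) < 0" "obj x (y + \<tau> *\<^sub>R d) < obj x y"
      using eventually_happens'[OF trivial_limit_at_right_real] by blast
    then show False using solutionD(2)[OF assms, of "y + \<tau> *\<^sub>R d"] by (force simp: admissible_def)
  qed
  then obtain \<mu> where \<mu>: "\<And>i. i \<in> insert 0 J \<Longrightarrow> \<mu> i \<ge> (0::real)" "sum \<mu> (insert 0 J) = 1"
    "(\<Sum>i\<in>insert 0 J. \<mu> i *\<^sub>R g i) = 0"
    using gordan_alternative[of "insert 0 J" g] fin by auto
  define \<nu> where "\<nu> i = (if i \<in> J then \<mu> i else 0)" for i
  have JI: "J \<subseteq> {1..m}" by (auto simp: J_def)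
  have "(\<Sum>i=1..m. \<nu> i) = sum \<mu> J"
    unfolding \<nu>_def using JI by (intro sum.mono_neutral_cong_right) auto
  moreover have "(\<Sum>i=1..m. \<nu> i *\<^sub>R (grad (fc i) x + Lc i *\<^sub>R (y - x))) = (\<Sum>i\<in>J. \<mu> i *\<^sub>R g i)"
    unfolding \<nu>_def using JI fin(2) by (intro sum.mono_neutral_cong_right) (auto simp: g_def)
  ultimately show ?thesis
    using \<mu> fin by (intro that[of "\<mu> 0" \<nu>]) (auto simp: \<nu>_def J_def g_def)
qed

lemma bounded_multipliers:
  obtains \<Lambda> where "\<Lambda> \<ge> 0" "\<And>x y. x \<in> K \<Longrightarrow> solution x y \<Longrightarrow>
    \<exists>lam. (\<forall>i\<in>{1..m}. lam i \<ge> 0) \<and> (\<forall>i\<in>{1..m}. lam i * con i x y = 0) \<and> (\<Sum>i=1..m. lam i) \<le> \<Lambda> \<and>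
      grad f x + L *\<^sub>R (y - x) + (\<Sum>i=1..m. lam i *\<^sub>R (grad (fc i) x + Lc i *\<^sub>R (y - x))) = 0"
proof -
  obtain \<eta> B where \<eta>: "\<eta> > 0" "\<And>x. x \<in> K \<Longrightarrow> \<exists>z. norm z \<le> B \<and> (\<forall>i\<in>{1..m}. con i x z \<le> - \<eta>)"
    by (rule uniform_slater) blast
  obtain G where G: "G > 0" "\<And>x. x \<in> K \<Longrightarrow> norm (grad f x) \<le> G"
    using compact_imp_bounded[OF compact_continuous_image[OF objective.continuous_grad compact_K]]
    unfolding bounded_pos by auto
  obtain B' where B': "\<And>x. x \<in> K \<Longrightarrow> norm x \<le> B'"
    using compact_imp_bounded[OF compact_K] unfolding bounded_iff by blast
  define b where "b = \<bar>B\<bar> + \<bar>B'\<bar> + 2 * G / L"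
  define \<Lambda> where "\<Lambda> = 3 * G * b / \<eta>"
  have "b \<ge> 0" using G(1) objective.L_pos by (simp add: b_def)
  show ?thesis
  proof (rule that[of \<Lambda>])
    show "\<Lambda> \<ge> 0" using \<open>b \<ge> 0\<close> G(1) \<eta>(1) by (simp add: \<Lambda>_def)
    fix x y assume x: "x \<in> K" and sol: "solution x y"
    obtain z where z: "norm z \<le> B" "\<And>i. i \<in> {1..m} \<Longrightarrow> con i x z \<le> - \<eta>" using \<eta>(2)[OF x] by blast
    obtain \<mu>0 \<mu> where \<mu>: "\<mu>0 \<ge> 0" "\<And>i. i \<in> {1..m} \<Longrightarrow> \<mu> i \<ge> (0::real)" "\<mu>0 + (\<Sum>i=1..m. \<mu> i) = 1"
      "\<And>i. i \<in> {1..m} \<Longrightarrow> \<mu> i * con i x y = 0"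
      "\<mu>0 *\<^sub>R (grad f x + L *\<^sub>R (y - x)) + (\<Sum>i=1..m. \<mu> i *\<^sub>R (grad (fc i) x + Lc i *\<^sub>R (y - x))) = 0"
      by (rule fritz_john[OF sol]) blast
    have descent: "\<mu> i * inner (grad (fc i) x + Lc i *\<^sub>R (y - x)) (z - y) \<le> \<mu> i * (- \<eta>)" if i: "i \<in> {1..m}" for i
    proof (cases "\<mu> i = 0")
      case False
      then have "con i x y = 0" using \<mu>(4)[OF i] by simp
      moreover have "Lc i / 2 * (norm (z - y))\<^sup>2 \<ge> 0" using smooth_function.L_pos[OF constraints[OF i]] by simp
      ultimately have "inner (grad (fc i) x + Lc i *\<^sub>R (y - x)) (z - y) \<le> - \<eta>"
        using quad_model_expand[of "fc i" "Lc i" x z y] z(2)[OF i] by linarith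
      then show ?thesis using \<mu>(2)[OF i] by (rule mult_left_mono)
    qed simp
    have zero: "\<mu>0 * inner (grad f x + L *\<^sub>R (y - x)) (z - y) + (\<Sum>i=1..m. \<mu> i * inner (grad (fc i) x + Lc i *\<^sub>R (y - x)) (z - y)) = 0"
      using arg_cong[OF \<mu>(5), of "\<lambda>v. inner v (z - y)"] by (simp add: inner_add_left[of "\<mu>0 *\<^sub>R _"] inner_sum_left)
    have "(\<Sum>i=1..m. \<mu> i * inner (grad (fc i) x + Lc i *\<^sub>R (y - x)) (z - y)) \<le> (\<Sum>i=1..m. \<mu> i * (- \<eta>))"
      by (rule sum_mono) (rule descent)
    also have "\<dots> = - (\<eta> * (\<Sum>i=1..m. \<mu> i))" by (simp add: sum_negf sum_distrib_left mult.commute)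
    finally have slack: "\<eta> * (\<Sum>i=1..m. \<mu> i) \<le> \<mu>0 * inner (grad f x + L *\<^sub>R (y - x)) (z - y)" using zero by simp
    have \<mu>0: "\<mu>0 > 0"
    proof (rule ccontr)
      assume "\<not> \<mu>0 > 0"
      then have "\<mu>0 = 0" using \<mu>(1) by simp
      then show False using slack \<mu>(3) \<eta>(1) by simp
    qed
    define lam where "lam i = \<mu> i / \<mu>0" for i
    have "\<eta> * (\<Sum>i=1..m. lam i) = \<eta> * (\<Sum>i=1..m. \<mu> i) / \<mu>0" by (simp add: lam_def flip: sum_divide_distrib)
    also have "\<dots> \<le> inner (grad f x + L *\<^sub>R (y - x)) (z - y)" using slack \<mu>0 by (simp add: field_simps)
    also have "\<dots> \<le> norm (grad f x + L *\<^sub>R (y - x)) * norm (z - y)" by (rule norm_cauchy_schwarz)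
    also have "\<dots> \<le> (3 * G) * b"
    proof (rule mult_mono)
      have r: "norm (y - x) \<le> 2 * G / L"
        using solution_step_bound[OF x sol] G(2)[OF x] objective.L_pos
        by (elim order_trans) (intro divide_right_mono; simp)
      have "norm (grad f x + L *\<^sub>R (y - x)) \<le> norm (grad f x) + L * norm (y - x)"
        using norm_triangle_ineq[of "grad f x" "L *\<^sub>R (y - x)"] objective.L_pos by simp
      also have "\<dots> \<le> G + 2 * G" using G(2)[OF x] r objective.L_pos by (intro add_mono) (auto simp: field_simps)
      finally show "norm (grad f x + L *\<^sub>R (y - x)) \<le> 3 * G" by simp
      have "norm (z - y) \<le> norm z + norm x + norm (y - x)"
        using norm_triangle_ineq4[of z y] norm_triangle_sub[of y x] by simp
      also have "\<dots> \<le> b" using z(1) B'[OF x] r by (simp add: b_def)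
      finally show "norm (z - y) \<le> b" .
    qed (use G(1) in auto)
    finally have "(\<Sum>i=1..m. lam i) \<le> \<Lambda>" using \<eta>(1) by (simp add: \<Lambda>_def field_simps)
    moreover have "grad f x + L *\<^sub>R (y - x) + (\<Sum>i=1..m. lam i *\<^sub>R (grad (fc i) x + Lc i *\<^sub>R (y - x))) = 0"
    proof -
      have "(1 / \<mu>0) *\<^sub>R (\<mu>0 *\<^sub>R (grad f x + L *\<^sub>R (y - x)) + (\<Sum>i=1..m. \<mu> i *\<^sub>R (grad (fc i) x + Lc i *\<^sub>R (y - x)))) = 0"
        unfolding \<mu>(5) by simp
      then show ?thesis using \<mu>0 unfolding scaleR_right_distrib[of "1 / \<mu>0"] by (simp only: scaleR_scaleR scaleR_sum_right lam_def) simp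
    qed
    ultimately show "\<exists>lam. (\<forall>i\<in>{1..m}. lam i \<ge> 0) \<and> (\<forall>i\<in>{1..m}. lam i * con i x y = 0) \<and> (\<Sum>i=1..m. lam i) \<le> \<Lambda> \<and>
      grad f x + L *\<^sub>R (y - x) + (\<Sum>i=1..m. lam i *\<^sub>R (grad (fc i) x + Lc i *\<^sub>R (y - x))) = 0"
      using \<mu>(2,4) \<mu>0 by (intro exI[of _ lam] conjI ballI) (simp_all add: lam_def)
  qed
qed

definition lagrangian :: "(nat \<Rightarrow> real) \<Rightarrow> 'a \<Rightarrow> 'a \<Rightarrow> real" where
  "lagrangian lam x z = obj x z + (\<Sum>i=1..m. lam i * con i x z)"

definition curvature :: "(nat \<Rightarrow> real) \<Rightarrow> real" where
  "curvature lam = L + (\<Sum>i=1..m. lam i * Lc i)"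

lemma lagrangian_expand:
  assumes "grad f x + L *\<^sub>R (y - x) + (\<Sum>i=1..m. lam i *\<^sub>R (grad (fc i) x + Lc i *\<^sub>R (y - x))) = 0"
    and "\<forall>i\<in>{1..m}. lam i * con i x y = 0"
  shows "lagrangian lam x z = obj x y + curvature lam / 2 * (norm (z - y))\<^sup>2"
proof -
  define s where "s = (norm (z - y))\<^sup>2"
  have zero: "inner (grad f x + L *\<^sub>R (y - x)) (z - y) + (\<Sum>i=1..m. lam i * inner (grad (fc i) x + Lc i *\<^sub>R (y - x)) (z - y)) = 0"
    using arg_cong[OF assms(1), of "\<lambda>v. inner v (z - y)"] by (simp add: inner_add_left[of "_ + _"] inner_sum_left)
  have "lam i * con i x z = lam i * inner (grad (fc i) x + Lc i *\<^sub>R (y - x)) (z - y) + lam i * Lc i / 2 * s"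
    if "i \<in> {1..m}" for i
    using quad_model_expand[of "fc i" "Lc i" x z y] assms(2) that by (simp only: s_def distrib_left) simp
  then have "(\<Sum>i=1..m. lam i * con i x z) = (\<Sum>i=1..m. lam i * inner (grad (fc i) x + Lc i *\<^sub>R (y - x)) (z - y))
      + (\<Sum>i=1..m. lam i * Lc i) / 2 * s"
    by (simp add: sum.distrib sum_distrib_right sum_divide_distrib)
  then show ?thesis
    using zero quad_model_expand[of f L x z y] unfolding lagrangian_def curvature_def s_def[symmetric]
    by (simp add: add_divide_distrib distrib_right)
qed

lemma lagrangian_le:
  assumes "\<forall>i\<in>{1..m}. lam i \<ge> 0" "admissible x z"
  shows "lagrangian lam x z \<le> obj x z"
  using assms unfolding lagrangian_def admissible_def
  by (auto intro!: sum_nonpos mult_nonneg_nonpos)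

lemma curvature_ge: "\<forall>i\<in>{1..m}. lam i \<ge> 0 \<Longrightarrow> L \<le> curvature lam"
  using smooth_function.L_pos[OF constraints] unfolding curvature_def
  by (auto intro!: sum_nonneg mult_nonneg_nonneg intro: less_imp_le)

lemma lagrangian_shift:
  assumes "\<forall>i\<in>{1..m}. lam i \<ge> 0"
  shows "lagrangian lam x z - 2 * curvature lam * (norm (x' - x) * norm (z - x)) \<le> lagrangian lam x' z"
proof -
  define s where "s = norm (x' - x) * norm (z - x)"
  have "(\<Sum>i=1..m. lam i * (con i x z - 2 * Lc i * s)) \<le> (\<Sum>i=1..m. lam i * con i x' z)"
    using smooth_function.quad_model_shift[OF constraints] assms unfolding s_def
    by (intro sum_mono mult_left_mono) auto
  moreover have "(\<Sum>i=1..m. lam i * (con i x z - 2 * Lc i * s)) = (\<Sum>i=1..m. lam i * con i x z) - 2 * (\<Sum>i=1..m. lam i * Lc i) * s"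
    by (simp add: right_diff_distrib sum_subtractf sum_distrib_left sum_distrib_right algebra_simps)
  ultimately show ?thesis
    using objective.quad_model_shift[of x z x'] unfolding lagrangian_def curvature_def s_def[symmetric]
    by (simp add: algebra_simps)
qed

lemma solution_growth:
  assumes "x \<in> K" "solution x y" "admissible x z"
  shows "obj x y + L / 2 * (norm (z - y))\<^sup>2 \<le> obj x z"
proof -
  obtain lam where lam: "\<forall>i\<in>{1..m}. lam i \<ge> 0" "\<forall>i\<in>{1..m}. lam i * con i x y = 0"
      "grad f x + L *\<^sub>R (y - x) + (\<Sum>i=1..m. lam i *\<^sub>R (grad (fc i) x + Lc i *\<^sub>R (y - x))) = 0"
    by (rule bounded_multipliers) (use assms in blast)
  have "L / 2 * (norm (z - y))\<^sup>2 \<le> curvature lam / 2 * (norm (z - y))\<^sup>2"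
    using curvature_ge[OF lam(1)] by (intro mult_right_mono) auto
  then show ?thesis using lagrangian_expand[OF lam(3,2), of z] lagrangian_le[OF lam(1) assms(3)] by simp
qed

lemma solution_unique:
  assumes "x \<in> K" "solution x y" "solution x y'"
  shows "y = y'"
proof -
  have "L / 2 * (norm (y' - y))\<^sup>2 \<le> 0"
    using solution_growth[OF assms(1,2) solutionD(1)[OF assms(3)]] solutionD(2)[OF assms(3) solutionD(1)[OF assms(2)]] by simp
  then show ?thesis using objective.L_pos by (simp add: mult_le_0_iff)
qed

text \<open>The multipliers at \<open>x\<close> are feasible for the dual of the subproblem at \<open>x'\<close>; this bounds the
  optimal value at \<open>x'\<close> from below without differentiating the solution map.\<close>

lemma value_decrease_bound:
  obtains c where "c > 0" "\<And>x y x' y'. x \<in> K \<Longrightarrow> x' \<in> K \<Longrightarrow> solution x y \<Longrightarrow> solution x' y' \<Longrightarrow>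
    obj x y - obj x' y' \<le> c * (norm (y - x) * norm (x - x') + (norm (x - x'))\<^sup>2)"
proof -
  obtain \<Lambda> where \<Lambda>: "\<Lambda> \<ge> 0" "\<And>x y. x \<in> K \<Longrightarrow> solution x y \<Longrightarrow>
    \<exists>lam. (\<forall>i\<in>{1..m}. lam i \<ge> 0) \<and> (\<forall>i\<in>{1..m}. lam i * con i x y = 0) \<and> (\<Sum>i=1..m. lam i) \<le> \<Lambda> \<and>
      grad f x + L *\<^sub>R (y - x) + (\<Sum>i=1..m. lam i *\<^sub>R (grad (fc i) x + Lc i *\<^sub>R (y - x))) = 0"
    by (rule bounded_multipliers) blast
  define M where "M = L + \<Lambda> * (\<Sum>i=1..m. Lc i)"
  have Lc: "Lc i > 0" if "i \<in> {1..m}" for i using smooth_function.L_pos[OF constraints[OF that]] .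
  show ?thesis
  proof (rule that[of "2 * M"])
    have "\<Lambda> * (\<Sum>i=1..m. Lc i) \<ge> 0" using \<Lambda>(1) Lc by (intro mult_nonneg_nonneg sum_nonneg) (auto intro: less_imp_le)
    then show "2 * M > 0" using objective.L_pos by (simp add: M_def)
    fix x y x' y' assume x: "x \<in> K" "x' \<in> K" and sol: "solution x y" "solution x' y'"
    obtain lam where lam: "\<forall>i\<in>{1..m}. lam i \<ge> 0" "\<forall>i\<in>{1..m}. lam i * con i x y = 0" "(\<Sum>i=1..m. lam i) \<le> \<Lambda>"
      "grad f x + L *\<^sub>R (y - x) + (\<Sum>i=1..m. lam i *\<^sub>R (grad (fc i) x + Lc i *\<^sub>R (y - x))) = 0"
      using \<Lambda>(2)[OF x(1) sol(1)] by blast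
    define C where "C = curvature lam"
    define \<delta> where "\<delta> = norm (x - x')"
    define e where "e = norm (y' - y)"
    define \<rho> where "\<rho> = norm (y - x)"
    have "(\<Sum>i=1..m. lam i * Lc i) \<le> (\<Sum>i=1..m. \<Lambda> * Lc i)"
    proof (intro sum_mono mult_right_mono)
      fix i assume i: "i \<in> {1..m}"
      have "lam i \<le> (\<Sum>i=1..m. lam i)" using lam(1) i by (intro member_le_sum) auto
      then show "lam i \<le> \<Lambda>" using lam(3) by simp
    qed (use Lc in \<open>auto simp: less_imp_le\<close>)
    then have CM: "C \<le> M" by (simp add: C_def curvature_def M_def sum_distrib_left)
    have C: "C > 0" using curvature_ge[OF lam(1)] objective.L_pos by (simp add: C_def)
    have "obj x y + C / 2 * e\<^sup>2 - 2 * C * (\<delta> * norm (y' - x)) \<le> obj x' y'"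
      using lagrangian_expand[OF lam(4,2), of y'] lagrangian_shift[OF lam(1), of x y' x'] lagrangian_le[OF lam(1) solutionD(1)[OF sol(2)]]
      by (simp add: C_def e_def \<delta>_def norm_minus_commute)
    moreover have "2 * C * (\<delta> * norm (y' - x)) \<le> 2 * C * (\<delta> * (e + \<rho>))"
      using norm_triangle_ineq[of "y' - y" "y - x"] C by (intro mult_left_mono) (auto simp: \<delta>_def e_def \<rho>_def)
    moreover have "C / 2 * (e - 2 * \<delta>)\<^sup>2 \<ge> 0" using C by simp
    then have "2 * C * (\<delta> * (e + \<rho>)) - C / 2 * e\<^sup>2 \<le> 2 * C * (\<rho> * \<delta> + \<delta>\<^sup>2)"
      by (simp add: power2_eq_square algebra_simps)
    moreover have "2 * C * (\<rho> * \<delta> + \<delta>\<^sup>2) \<le> 2 * M * (\<rho> * \<delta> + \<delta>\<^sup>2)"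
      using CM by (intro mult_right_mono) (auto simp: \<rho>_def \<delta>_def)
    ultimately show "obj x y - obj x' y' \<le> 2 * M * (norm (y - x) * norm (x - x') + (norm (x - x'))\<^sup>2)"
      unfolding \<rho>_def[symmetric] \<delta>_def[symmetric] by linarith
  qed
qed

lemma stationary_imp_KKT:
  assumes "x \<in> K" "solution x x"
  shows "KKT_point m f fc x"
proof -
  obtain lam where lam: "\<forall>i\<in>{1..m}. lam i \<ge> 0" "\<forall>i\<in>{1..m}. lam i * con i x x = 0"
      "grad f x + L *\<^sub>R (x - x) + (\<Sum>i=1..m. lam i *\<^sub>R (grad (fc i) x + Lc i *\<^sub>R (x - x))) = 0"
    by (rule bounded_multipliers) (use assms in blast)
  then show ?thesis
    unfolding KKT_point_def using K_feasible assms(1) by (intro conjI exI[of _ lam]) auto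
qed

end

section \<open>Convergence rate\<close>

lemma powr_diff_ge:
  fixes u v \<theta> :: real
  assumes "0 < u" "u \<le> v" "0 \<le> \<theta>" "\<theta> < 1"
  shows "(1 - \<theta>) * (v - u) \<le> v powr \<theta> * (v powr (1 - \<theta>) - u powr (1 - \<theta>))"
proof (cases "u = v")
  case False
  then have "u < v" using assms by simp
  have "((\<lambda>s. s powr (1 - \<theta>)) has_real_derivative (1 - \<theta>) * s powr (- \<theta>)) (at s)" if "u \<le> s" for s
    using has_real_derivative_powr[of s "1 - \<theta>"] that assms(1) by simp
  then obtain s where s: "u < s" "s < v" "v powr (1 - \<theta>) - u powr (1 - \<theta>) = (v - u) * ((1 - \<theta>) * s powr (- \<theta>))"
    using MVT2[OF \<open>u < v\<close>, of "\<lambda>s. s powr (1 - \<theta>)" "\<lambda>s. (1 - \<theta>) * s powr (- \<theta>)"] by blast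
  have "1 \<le> v powr \<theta> * s powr (- \<theta>)"
    using s(1,2) assms powr_mono2[of \<theta> s v] by (simp add: powr_minus field_simps)
  then have "(1 - \<theta>) * (v - u) * 1 \<le> (1 - \<theta>) * (v - u) * (v powr \<theta> * s powr (- \<theta>))"
    using assms by (intro mult_left_mono) auto
  then show ?thesis unfolding s(3) by (simp add: mult_ac)
qed simp

lemma inverse_decay:
  fixes e :: "nat \<Rightarrow> real"
  assumes e: "\<And>k. 0 < e k" "\<And>k. e k \<le> 1" and c: "0 < c"
    and dec: "\<And>k. e (Suc k) + c * (e (Suc k))\<^sup>2 \<le> e k"
  shows "e k * real k \<le> 1 / min (c / 2) 1"
proof -
  define d where "d = min (c / 2) 1"
  have d: "0 < d" "d \<le> 1" "d \<le> c / 2" using c by (auto simp: d_def)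
  have "1 / e k + d \<le> 1 / e (Suc k)" for k
  proof (cases "e k \<le> 2 * e (Suc k)")
    case True
    have "(1 + d * e k) * e (Suc k) \<le> e (Suc k) + c / 2 * e k * e (Suc k)"
      using d e[of k] e[of "Suc k"] by (simp add: distrib_right mult_right_mono)
    also have "c / 2 * e k * e (Suc k) \<le> c * (e (Suc k))\<^sup>2"
    proof -
      have "c / 2 * e (Suc k) * e k \<le> c / 2 * e (Suc k) * (2 * e (Suc k))"
        using True c e[of "Suc k"] by (intro mult_left_mono) auto
      then show ?thesis by (simp add: power2_eq_square mult_ac)
    qed
    finally have "(1 + d * e k) * e (Suc k) \<le> e k" using dec[of k] by simp
    then show ?thesis using e[of k] e[of "Suc k"] by (simp add: field_simps)
  next
    case False
    have "d * e k \<le> 1" using d e[of k] by (intro mult_le_one) auto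
    then have "1 / e k + d \<le> 1 / e k + 1 / e k" using e(1)[of k] by (simp add: field_simps)
    also have "\<dots> \<le> 1 / e (Suc k)" using False e[of k] e[of "Suc k"] by (simp add: field_simps)
    finally show ?thesis .
  qed
  then have "d * real k \<le> 1 / e k"
  proof (induction k)
    case (Suc k)
    then have "d * real k + d \<le> 1 / e (Suc k)" by (meson add_right_mono order_trans)
    then show ?case by (simp add: algebra_simps)
  qed (use e(1)[of 0] in simp)
  then show ?thesis using e(1)[of k] d(1) unfolding d_def[symmetric] by (simp add: field_simps)
qed

lemma descent_rate:
  fixes x :: "nat \<Rightarrow> 'a::banach" and e :: "nat \<Rightarrow> real"
  assumes pos: "a > 0" "C > 0" and \<theta>: "1 / 2 \<le> \<theta>" "\<theta> < 1"
    and e: "\<And>k. 0 < e k" "\<And>k. e k \<le> 1"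
    and dec: "\<And>k. e (Suc k) + a * (norm (x (Suc (Suc k)) - x (Suc k)))\<^sup>2 \<le> e k"
    and loja: "\<And>k. e k powr \<theta> \<le> C * norm (x (Suc k) - x k)"
  shows "\<exists>l E. x \<longlonglongrightarrow> l \<and> (\<forall>k\<ge>1. norm (x (k + 2) - l) \<le> E * real k powr (- (1 - \<theta>)))"
proof -
  define r where "r k = norm (x (Suc k) - x k)" for k
  define \<phi> where "\<phi> k = e k powr (1 - \<theta>)" for k
  define D where "D = C / ((1 - \<theta>) * a)"
  define S where "S k = r k + D * \<phi> k" for k
  have D: "D > 0" using pos \<theta> by (simp add: D_def)
  have mono: "e (Suc k) \<le> e k" for k using dec[of k] pos(1) by (smt (verit) mult_nonneg_nonneg zero_le_power2)
  have rpos: "r k > 0" for k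
    using loja[of k] e(1)[of k] pos(2) unfolding r_def
    by (metis less_le_trans powr_gt_zero zero_less_mult_pos less_irrefl)
  have step: "r (Suc k) \<le> S k - S (Suc k)" for k
  proof -
    define \<Delta> where "\<Delta> = D * (\<phi> k - \<phi> (Suc k))"
    have "(1 - \<theta>) * (a * (r (Suc k))\<^sup>2) \<le> (1 - \<theta>) * (e k - e (Suc k))"
      using dec[of k] \<theta>(2) by (intro mult_left_mono) (auto simp: r_def)
    also have "\<dots> \<le> e k powr \<theta> * (\<phi> k - \<phi> (Suc k))"
      unfolding \<phi>_def using powr_diff_ge[OF e(1) mono] \<theta> by simp
    also have "\<dots> \<le> (C * r k) * (\<phi> k - \<phi> (Suc k))"
    proof (rule mult_right_mono)
      show "e k powr \<theta> \<le> C * r k" using loja by (simp add: r_def)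
      have "\<phi> (Suc k) \<le> \<phi> k"
        unfolding \<phi>_def using mono[of k] e(1)[of "Suc k"] \<theta> by (intro powr_mono2) auto
      then show "0 \<le> \<phi> k - \<phi> (Suc k)" by simp
    qed
    finally have "(r (Suc k))\<^sup>2 \<le> (C * r k) * (\<phi> k - \<phi> (Suc k)) / ((1 - \<theta>) * a)"
      using pos \<theta>(2) by (simp add: pos_le_divide_eq mult_ac)
    also have "\<dots> = r k * \<Delta>" by (simp add: \<Delta>_def D_def)
    finally have sq: "(r (Suc k))\<^sup>2 \<le> r k * \<Delta>" .
    then have \<Delta>: "\<Delta> \<ge> 0" using rpos[of k] by (meson order_trans zero_le_power2 zero_le_mult_iff not_le)
    have "(2 * r (Suc k))\<^sup>2 \<le> (r k + \<Delta>)\<^sup>2"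
    proof -
      have "(2 * r (Suc k))\<^sup>2 \<le> 4 * (r k * \<Delta>)" using sq by (simp add: power_mult_distrib)
      also have "\<dots> \<le> 4 * (r k * \<Delta>) + (r k - \<Delta>)\<^sup>2" by simp
      also have "\<dots> = (r k + \<Delta>)\<^sup>2" by (simp add: power2_eq_square algebra_simps)
      finally show ?thesis .
    qed
    then have "2 * r (Suc k) \<le> r k + \<Delta>" by (rule power2_le_imp_le) (use \<Delta> rpos[of k] in simp)
    then show ?thesis by (simp add: S_def \<Delta>_def algebra_simps)
  qed
  have S0: "S k \<ge> 0" for k using D rpos[of k] by (simp add: S_def \<phi>_def)
  have dist: "norm (x (Suc k + n) - x (Suc k)) \<le> S k - S (k + n)" for k n
  proof (induction n)
    case (Suc n)
    have "norm (x (Suc k + Suc n) - x (Suc k)) \<le> norm (x (Suc k + Suc n) - x (Suc k + n)) + norm (x (Suc k + n) - x (Suc k))"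
      using norm_triangle_ineq[of "x (Suc k + Suc n) - x (Suc k + n)" "x (Suc k + n) - x (Suc k)"] by simp
    also have "norm (x (Suc k + Suc n) - x (Suc k + n)) = r (Suc (k + n))" by (simp add: r_def)
    finally show ?case using step[of "k + n"] Suc.IH by simp
  qed simp
  define E where "E = 1 / sqrt a + D"
  have Sle: "S (Suc k) \<le> E * \<phi> k" for k
  proof -
    have "a * (r (Suc k))\<^sup>2 \<le> e k" using dec[of k] e(1)[of "Suc k"] by (simp add: r_def)
    also have "e k = e k powr 1" using e(1)[of k] by simp
    also have "\<dots> \<le> e k powr (2 * (1 - \<theta>))" using e[of k] \<theta> by (intro powr_mono') auto
    also have "\<dots> = (\<phi> k)\<^sup>2" using e(1)[of k] by (simp add: \<phi>_def power2_eq_square flip: powr_add)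
    finally have "(sqrt a * r (Suc k))\<^sup>2 \<le> (\<phi> k)\<^sup>2" using pos(1) by (simp add: power_mult_distrib)
    then have "sqrt a * r (Suc k) \<le> \<phi> k" by (rule power2_le_imp_le) (simp add: \<phi>_def)
    then have "r (Suc k) \<le> 1 / sqrt a * \<phi> k" using pos(1) by (simp add: field_simps)
    moreover have "\<phi> (Suc k) \<le> \<phi> k"
      unfolding \<phi>_def using mono[of k] e(1)[of "Suc k"] \<theta> by (intro powr_mono2) auto
    then have "D * \<phi> (Suc k) \<le> D * \<phi> k" using D by simp
    ultimately show ?thesis by (simp add: S_def E_def distrib_right)
  qed
  define c where "c = a / C\<^sup>2"
  have c: "c > 0" using pos by (simp add: c_def)
  have "e (Suc k) + c * (e (Suc k))\<^sup>2 \<le> e k" for k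
  proof -
    have "e (Suc k) \<le> e (Suc k) powr \<theta>"
      using powr_mono'[of \<theta> 1 "e (Suc k)"] e[of "Suc k"] \<theta> by simp
    also have "\<dots> \<le> C * r (Suc k)" using loja by (simp add: r_def)
    finally have "(e (Suc k))\<^sup>2 \<le> (C * r (Suc k))\<^sup>2" using e(1)[of "Suc k"] by (intro power_mono) auto
    then have "c * (e (Suc k))\<^sup>2 \<le> a * (r (Suc k))\<^sup>2"
      using pos by (simp add: c_def power_mult_distrib field_simps)
    then show ?thesis using dec[of k] by (simp add: r_def)
  qed
  then have decay: "e k * real k \<le> 1 / min (c / 2) 1" for k by (intro inverse_decay e c)
  define B where "B = 1 / min (c / 2) 1"
  have B: "B > 0" using c by (simp add: B_def)
  have Sk: "S (Suc k) \<le> E * B powr (1 - \<theta>) * real k powr (- (1 - \<theta>))" if "k \<ge> 1" for k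
  proof -
    have "e k \<le> B / real k" using decay[of k] that unfolding B_def[symmetric] by (simp add: pos_le_divide_eq)
    then have "\<phi> k \<le> (B / real k) powr (1 - \<theta>)"
      unfolding \<phi>_def using e(1)[of k] \<theta> by (intro powr_mono2) auto
    also have "\<dots> = B powr (1 - \<theta>) * real k powr (- (1 - \<theta>))"
      using B that powr_divide[of B "real k" "1 - \<theta>"] powr_minus_divide[of "real k" "1 - \<theta>"] by simp
    finally have "E * \<phi> k \<le> E * (B powr (1 - \<theta>) * real k powr (- (1 - \<theta>)))"
      using pos D by (intro mult_left_mono) (auto simp: E_def)
    then show ?thesis using Sle[of k] by (simp add: mult.assoc)
  qed
  have "(\<lambda>k. real k powr (- (1 - \<theta>))) \<longlonglongrightarrow> 0"
    using tendsto_neg_powr[of "- (1 - \<theta>)" real sequentially] \<theta> filterlim_real_sequentially by simp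
  then have lim: "(\<lambda>k. E * B powr (1 - \<theta>) * real k powr (- (1 - \<theta>))) \<longlonglongrightarrow> 0"
    by (rule tendsto_mult_right_zero)
  have "Cauchy x"
    unfolding Cauchy_altdef2
  proof (intro allI impI)
    fix \<epsilon> :: real assume "\<epsilon> > 0"
    then obtain k where k: "k \<ge> 1" "E * B powr (1 - \<theta>) * real k powr (- (1 - \<theta>)) < \<epsilon>"
      using eventually_conj[OF order_tendstoD(2)[OF lim \<open>\<epsilon> > 0\<close>] eventually_ge_at_top[of "1::nat"]]
      by (auto dest: eventually_happens'[OF sequentially_bot])
    have "dist (x n) (x (k + 2)) < \<epsilon>" if "n \<ge> k + 2" for n
    proof -
      have n: "Suc (Suc k) + (n - (k + 2)) = n" using that by simp
      have "norm (x n - x (Suc (Suc k))) \<le> S (Suc k)"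
        using dist[of "Suc k" "n - (k + 2)"] S0[of "Suc k + (n - (k + 2))"] unfolding n by linarith
      then show ?thesis using Sk[OF k(1)] k(2) that by (simp add: dist_norm)
    qed
    then show "\<exists>N. \<forall>n\<ge>N. dist (x n) (x N) < \<epsilon>" by blast
  qed
  then obtain l where l: "x \<longlonglongrightarrow> l" using Cauchy_convergent convergent_def by blast
  have "norm (x (k + 2) - l) \<le> E * B powr (1 - \<theta>) * real k powr (- (1 - \<theta>))" if "k \<ge> 1" for k
  proof (rule order_trans[OF _ Sk[OF that]])
    have "(\<lambda>n. norm (x (Suc (Suc k) + n) - x (Suc (Suc k)))) \<longlonglongrightarrow> norm (l - x (Suc (Suc k)))"
      using LIMSEQ_ignore_initial_segment[OF l, of "Suc (Suc k)"]
      by (intro tendsto_intros) (simp add: add.commute)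
    moreover have "norm (x (Suc (Suc k) + n) - x (Suc (Suc k))) \<le> S (Suc k)" for n
      using dist[of "Suc k" n] S0[of "Suc k + n"] by linarith
    ultimately have "norm (l - x (Suc (Suc k))) \<le> S (Suc k)" by (intro LIMSEQ_le_const2) auto
    then show "norm (x (k + 2) - l) \<le> S (Suc k)" by (simp add: norm_minus_commute)
  qed
  then show ?thesis using l by blast
qed

lemma shifted_powr_bigo:
  fixes u :: "nat \<Rightarrow> real"
  assumes "\<And>k. 0 \<le> u k" "\<gamma> > 0" and le: "\<And>k. k \<ge> 1 \<Longrightarrow> u (k + n) \<le> E * real k powr (- \<gamma>)"
  shows "u \<in> O(\<lambda>k. 1 / real k powr \<gamma>)"
proof (rule bigoI[of _ "\<bar>E\<bar> * 2 powr \<gamma>"])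
  have "norm (u k) \<le> \<bar>E\<bar> * 2 powr \<gamma> * norm (1 / real k powr \<gamma>)" if "k \<ge> 2 * n + 2" for k
  proof -
    have k: "k - n \<ge> 1" "real k / 2 \<le> real (k - n)" "real k > 0" using that by (auto simp: of_nat_diff)
    have "u k \<le> E * real (k - n) powr (- \<gamma>)" using le[OF k(1)] that by simp
    also have "\<dots> \<le> \<bar>E\<bar> * real (k - n) powr (- \<gamma>)" by (intro mult_right_mono) auto
    also have "\<dots> \<le> \<bar>E\<bar> * (real k / 2) powr (- \<gamma>)"
      using k assms(2) by (intro mult_left_mono powr_mono2') auto
    also have "\<dots> = \<bar>E\<bar> * 2 powr \<gamma> * (1 / real k powr \<gamma>)"
      using k(3) by (simp add: powr_minus powr_divide)
    finally show ?thesis using assms(1)[of k] by simp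
  qed
  then show "\<forall>\<^sub>F k in sequentially. norm (u k) \<le> \<bar>E\<bar> * 2 powr \<gamma> * norm (1 / real k powr \<gamma>)"
    by (auto simp: eventually_sequentially)
qed

lemma (in moving_balls) feasible_step:
  assumes "admissible x y"
  shows "y \<in> feasible_set m fc"
proof -
  have "fc i y \<le> 0" if "i \<in> {1..m}" for i
    using smooth_function.majorant[OF constraints[OF that], of y x] assms that by (force simp: admissible_def)
  then show ?thesis by (simp add: feasible_set_def)
qed

lemma (in moving_balls) descent_step:
  assumes "x \<in> K" "solution x y"
  shows "f y \<le> obj x y" "obj x y + L / 2 * (norm (y - x))\<^sup>2 \<le> f x"
  using objective.majorant[of y x] solution_growth[OF assms admissible_self[OF assms(1)]]
  by (simp_all add: norm_minus_commute)

lemma (in moving_balls) limit_stationary: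
  assumes x: "\<And>k. x k \<in> K" "\<And>k. solution (x k) (x (Suc k))" "x \<longlonglongrightarrow> l"
    and lim: "(\<lambda>k. obj (x k) (x (Suc k))) \<longlonglongrightarrow> f l"
  shows "solution l l"
proof -
  have l: "l \<in> K" using compact_imp_closed[OF compact_K] x(1,3) closed_sequentially by blast
  obtain y where y: "solution l y" using solution_exists[OF l] by blast
  obtain c where c: "\<And>x y x' y'. x \<in> K \<Longrightarrow> x' \<in> K \<Longrightarrow> solution x y \<Longrightarrow> solution x' y' \<Longrightarrow>
    obj x y - obj x' y' \<le> c * (norm (y - x) * norm (x - x') + (norm (x - x'))\<^sup>2)"
    by (rule value_decrease_bound) blast
  have "(\<lambda>k. c * (norm (x (Suc k) - x k) * norm (x k - l) + (norm (x k - l))\<^sup>2)) \<longlonglongrightarrow>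
      c * (norm (l - l) * norm (l - l) + (norm (l - l))\<^sup>2)"
    using x(3) LIMSEQ_Suc[OF x(3)] by (intro tendsto_intros)
  moreover have "(\<lambda>k. obj (x k) (x (Suc k)) - obj l y) \<longlonglongrightarrow> f l - obj l y"
    using lim by (intro tendsto_intros)
  ultimately have "f l - obj l y \<le> c * (norm (l - l) * norm (l - l) + (norm (l - l))\<^sup>2)"
    using c[OF x(1) l x(2) y] by (intro LIMSEQ_le) auto
  then have "L / 2 * (norm (y - l))\<^sup>2 \<le> 0" using descent_step(2)[OF l y] by simp
  then show ?thesis using y objective.L_pos by (simp add: mult_le_0_iff)
qed

locale semialgebraic_moving_balls = moving_balls m f fc L Lc K
  for m :: nat and f :: "real ^ 'n \<Rightarrow> real" and fc L Lc K +
  assumes semialgebraic_objective: "semialgebraic_fun f"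
    and semialgebraic_constraints: "i \<in> {1..m} \<Longrightarrow> semialgebraic_fun (fc i)"
begin

lemma obj_definable: "definable (\<lambda>s. s c $ i0 = obj (s a) (s b))"
  by (rule quad_model_definable[OF semialgebraic_objective objective.grad_iff])

lemma admissible_definable: "definable (\<lambda>s. admissible (s a) (s b))"
proof -
  fix i0 :: 'n
  have "definable (\<lambda>s. con i (s 0) (s 1) \<le> 0)" if i: "i \<in> {1..m}" for i
  proof -
    have "definable (\<lambda>s. s 2 $ i0 = con i (s 0) (s 1) \<and> s 2 $ i0 \<le> 0)"
      by (intro cp.determined_conj cp.determined_le coord_poly.coord coord_poly.const
          quad_model_definable[OF semialgebraic_constraints[OF i] smooth_function.grad_iff[OF constraints[OF i]]])
    then have "definable (\<lambda>s. \<exists>v. v $ i0 = con i (s 0) (s 1) \<and> v $ i0 \<le> 0)"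
      by (rule definable_ex[where k = 2]) simp
    moreover have "(\<exists>v :: real ^ 'n. v $ i0 = c \<and> v $ i0 \<le> 0) \<longleftrightarrow> c \<le> 0" for c
      by (auto intro: exI[of _ "vec c"])
    ultimately show ?thesis by simp
  qed
  then have "definable (\<lambda>s. admissible (s 0) (s 1))"
    unfolding admissible_def by (intro cp.determined_ball) auto
  from definable_rename[OF this, of "\<lambda>k. if k = 0 then a else b"] show ?thesis by simp
qed

lemma solution_definable: "definable (\<lambda>s. solution (s a) (s b))"
proof -
  fix i0 :: 'n
  have "definable (\<lambda>s. s 3 $ i0 = obj (s 0) (s 1) \<and> s 4 $ i0 = obj (s 0) (s 2) \<and> s 3 $ i0 \<le> s 4 $ i0)"
    by (intro cp.determined_conj cp.determined_le coord_poly.coord obj_definable)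
  then have "definable (\<lambda>s. \<exists>w. s 3 $ i0 = obj (s 0) (s 1) \<and> w $ i0 = obj (s 0) (s 2) \<and> s 3 $ i0 \<le> w $ i0)"
    by (rule definable_ex[where k = 4]) simp
  then have "definable (\<lambda>s. \<exists>v w. v $ i0 = obj (s 0) (s 1) \<and> w $ i0 = obj (s 0) (s 2) \<and> v $ i0 \<le> w $ i0)"
    by (rule definable_ex[where k = 3]) simp
  moreover have "(\<exists>v w :: real ^ 'n. v $ i0 = c \<and> w $ i0 = d \<and> v $ i0 \<le> w $ i0) \<longleftrightarrow> c \<le> d" for c d
  proof
    show "\<exists>v w :: real ^ 'n. v $ i0 = c \<and> w $ i0 = d \<and> v $ i0 \<le> w $ i0" if "c \<le> d"
      by (intro exI[of _ "vec c"] exI[of _ "vec d"]) (simp add: that)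
  qed auto
  ultimately have "definable (\<lambda>s. obj (s 0) (s 1) \<le> obj (s 0) (s 2))" by simp
  then have "definable (\<lambda>s. admissible (s 0) (s 2) \<longrightarrow> obj (s 0) (s 1) \<le> obj (s 0) (s 2))"
    by (intro cp.determined_imp admissible_definable)
  then have "definable (\<lambda>s. \<forall>z. admissible (s 0) z \<longrightarrow> obj (s 0) (s 1) \<le> obj (s 0) z)"
    by (rule definable_all[where k = 2]) simp
  then have "definable (\<lambda>s. admissible (s 0) (s 1) \<and> (\<forall>z. admissible (s 0) z \<longrightarrow> obj (s 0) (s 1) \<le> obj (s 0) z))"
    by (intro cp.determined_conj admissible_definable)
  moreover have "solution x y \<longleftrightarrow> admissible x y \<and> (\<forall>z. admissible x z \<longrightarrow> obj x y \<le> obj x z)" for x y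
    using solutionI solutionD by blast
  ultimately have "definable (\<lambda>s. solution (s 0) (s 1))" by simp
  from definable_rename[OF this, of "\<lambda>k. if k = 0 then a else b"] show ?thesis by simp
qed

lemma value_lojasiewicz:
  assumes K: "definable (\<lambda>s. s 0 \<in> K)"
  shows "\<exists>C>0. \<exists>\<theta>. 1 / 2 \<le> \<theta> \<and> \<theta> < 1 \<and> (\<exists>\<epsilon>>0. \<forall>x\<in>K. \<forall>y. solution x y \<longrightarrow> v < obj x y \<longrightarrow> obj x y < v + \<epsilon> \<longrightarrow>
    (obj x y - v) powr \<theta> \<le> C * norm (y - x))"
proof -
  fix i0 :: 'n
  define P where "P x = (SOME y. solution x y)" for x
  have P: "solution x (P x)" if "x \<in> K" for x
    unfolding P_def using solution_exists[OF that] by (rule someI_ex)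
  have P_eq: "solution x y \<longleftrightarrow> y = P x" if "x \<in> K" for x y
    using solution_unique[OF that] P[OF that] by blast
  define F where "F x = obj x (P x)" for x
  define r where "r x = norm (P x - x)" for x
  obtain c where c: "c > 0" "\<And>x y x' y'. x \<in> K \<Longrightarrow> x' \<in> K \<Longrightarrow> solution x y \<Longrightarrow> solution x' y' \<Longrightarrow>
    obj x y - obj x' y' \<le> c * (norm (y - x) * norm (x - x') + (norm (x - x'))\<^sup>2)"
    by (rule value_decrease_bound) blast
  have ineq: "F x - F y \<le> c * (r x * norm (x - y) + (norm (x - y))\<^sup>2)" if "x \<in> K" "y \<in> K" for x y
    unfolding F_def r_def using c(2)[OF that P P] that by simp
  have "definable (\<lambda>s. s 2 \<in> K)"
    using definable_rename[OF K, of "\<lambda>_. 2"] by simp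
  moreover have "definable (\<lambda>s. \<exists>y w. solution (s 2) y \<and> w $ i0 = obj (s 2) y \<and> w $ i0 = v + s 0 $ i0 \<and>
      0 \<le> s 1 $ i0 \<and> inner (y - s 2) (y - s 2) \<le> s 1 $ i0 * s 1 $ i0)"
  proof -
    have "definable (\<lambda>s. solution (s 2) (s 3) \<and> s 4 $ i0 = obj (s 2) (s 3) \<and> s 4 $ i0 = v + s 0 $ i0 \<and>
        0 \<le> s 1 $ i0 \<and> inner (s 3 - s 2) (s 3 - s 2) \<le> s 1 $ i0 * s 1 $ i0)"
      by (intro cp.determined_conj solution_definable obj_definable)
        (intro cp.determined_eq cp.determined_le coord_poly.add coord_poly.mult coord_poly.const coord_poly.coord coord_poly_inner;
          simp add: cp.diff coord_poly.coord)+
    then have "definable (\<lambda>s. \<exists>w. solution (s 2) (s 3) \<and> w $ i0 = obj (s 2) (s 3) \<and> w $ i0 = v + s 0 $ i0 \<and>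
        0 \<le> s 1 $ i0 \<and> inner (s 3 - s 2) (s 3 - s 2) \<le> s 1 $ i0 * s 1 $ i0)"
      by (rule definable_ex[where k = 4]) simp
    then show ?thesis
      by (rule definable_ex[where k = 3]) simp
  qed
  ultimately have "definable (\<lambda>s. s 2 \<in> K \<and> (\<exists>y w. solution (s 2) y \<and> w $ i0 = obj (s 2) y \<and> w $ i0 = v + s 0 $ i0 \<and>
      0 \<le> s 1 $ i0 \<and> inner (y - s 2) (y - s 2) \<le> s 1 $ i0 * s 1 $ i0))"
    by (rule cp.determined_conj)
  moreover have "x \<in> K \<and> (\<exists>y w :: real ^ 'n. solution x y \<and> w $ i0 = obj x y \<and> w $ i0 = t \<and>
      0 \<le> \<rho> \<and> inner (y - x) (y - x) \<le> \<rho> * \<rho>) \<longleftrightarrow> x \<in> K \<and> F x = t \<and> r x \<le> \<rho>" for x t \<rho>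
  proof (cases "x \<in> K")
    case True
    have "\<exists>w :: real ^ 'n. w $ i0 = F x" by (rule exI[of _ "vec (F x)"]) simp
    moreover have "0 \<le> \<rho> \<and> inner (P x - x) (P x - x) \<le> \<rho> * \<rho> \<longleftrightarrow> r x \<le> \<rho>"
      unfolding r_def using abs_le_square_iff[of "norm (P x - x)" \<rho>] order_trans[OF norm_ge_zero[of "P x - x"], of \<rho>]
      by (auto simp: power2_norm_eq_inner power2_eq_square[of \<rho>])
    ultimately show ?thesis using True P_eq[OF True] by (auto simp: F_def)
  qed simp
  ultimately have "definable (\<lambda>s. s 2 \<in> K \<and> F (s 2) = v + s 0 $ i0 \<and> r (s 2) \<le> s 1 $ i0)"
    by simp
  from definable_lojasiewicz[OF compact_imp_bounded[OF compact_K] c(1) ineq this]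
  show ?thesis using P_eq unfolding F_def r_def by simp
qed

theorem moving_balls_rate:
  assumes K: "definable (\<lambda>s. s 0 \<in> K)" and x: "\<And>k. x k \<in> K" "\<And>k. solution (x k) (x (Suc k))"
  shows "\<exists>l. x \<longlonglongrightarrow> l \<and> l \<in> K \<and> solution l l \<and>
    ((\<forall>\<^sub>F k in sequentially. x k = l) \<or> (\<exists>\<gamma>>0. (\<lambda>k. norm (x k - l)) \<in> O(\<lambda>k. 1 / real k powr \<gamma>)))"
proof -
  define F where "F k = obj (x k) (x (Suc k))" for k
  have low: "f (x (Suc k)) \<le> F k" and up: "F k + L / 2 * (norm (x (Suc k) - x k))\<^sup>2 \<le> f (x k)" for k
    using descent_step[OF x] unfolding F_def by auto
  have nn: "0 \<le> L / 2 * (norm (x (Suc k) - x k))\<^sup>2" for k using objective.L_pos by simp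
  have "decseq (\<lambda>k. f (x k))"
    by (rule decseq_SucI) (use low up nn in \<open>meson add_increasing2 order_trans order_refl\<close>)
  moreover have "bounded (f ` K)"
    by (rule compact_imp_bounded[OF compact_continuous_image[OF objective.continuous compact_K]])
  then obtain b where "\<And>k. \<bar>f (x k)\<bar> \<le> b" using x(1) unfolding bounded_iff by auto
  then have "- b \<le> f (x k)" for k by (simp add: abs_le_iff minus_le_iff)
  ultimately obtain v where v: "(\<lambda>k. f (x k)) \<longlonglongrightarrow> v" "\<And>k. v \<le> f (x k)"
    using decseq_convergent by blast
  have vF: "v \<le> F k" for k using v(2)[of "Suc k"] low[of k] by simp
  have Flim: "F \<longlonglongrightarrow> v"
  proof (rule tendsto_sandwich[OF _ _ tendsto_const v(1)])
    show "\<forall>\<^sub>F k in sequentially. F k \<le> f (x k)" using up nn by (intro always_eventually allI) (meson add_increasing2 order_trans order_refl)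
  qed (use vF in simp)
  have fin: "l \<in> K \<and> solution l l" if l: "x \<longlonglongrightarrow> l" for l
  proof
    show lK: "l \<in> K" using compact_imp_closed[OF compact_K] x(1) l closed_sequentially by blast
    have "(\<lambda>k. f (x k)) \<longlonglongrightarrow> f l"
      by (rule continuous_on_tendsto_compose[OF objective.continuous[of UNIV] l]) auto
    then have "v = f l" using v(1) LIMSEQ_unique by blast
    then show "solution l l" using limit_stationary[OF x l] Flim unfolding F_def by simp
  qed
  show ?thesis
  proof (cases "\<exists>k. F k = v")
    case True
    then obtain k0 where k0: "F k0 = v" by blast
    have dec: "f (x n) \<le> v" if "n \<ge> Suc k0" for n
      using decseqD[OF \<open>decseq (\<lambda>k. f (x k))\<close> that] low[of k0] k0 by simp
    have stay: "x (Suc n) = x n" if "n \<ge> Suc k0" for n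
    proof -
      have "L / 2 * (norm (x (Suc n) - x n))\<^sup>2 \<le> 0" using up[of n] vF[of n] dec[OF that] by simp
      then show ?thesis using objective.L_pos by (simp add: mult_le_0_iff)
    qed
    have const: "x n = x (Suc k0)" if "n \<ge> Suc k0" for n
      using that
    proof (induction n rule: dec_induct)
      case (step n)
      then show ?case using stay[of n] by simp
    qed simp
    then have ev: "\<forall>\<^sub>F k in sequentially. x k = x (Suc k0)" unfolding eventually_sequentially by blast
    then have "x \<longlonglongrightarrow> x (Suc k0)" by (rule tendsto_eventually)
    then show ?thesis using ev fin by blast
  next
    case False
    then have Fpos: "v < F k" for k using vF[of k] by (metis order_le_less)
    obtain C \<theta> \<epsilon> where C: "C > 0" "1 / 2 \<le> \<theta>" "\<theta> < 1" "\<epsilon> > 0"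
      "\<And>x y. x \<in> K \<Longrightarrow> solution x y \<Longrightarrow> v < obj x y \<Longrightarrow> obj x y < v + \<epsilon> \<Longrightarrow> (obj x y - v) powr \<theta> \<le> C * norm (y - x)"
      using value_lojasiewicz[OF K, of v] by blast
    have "\<forall>\<^sub>F k in sequentially. F k < v + min \<epsilon> 1"
      using Flim C(4) by (intro order_tendstoD(2)) auto
    then obtain k0 where k0: "\<And>k. k \<ge> k0 \<Longrightarrow> F k < v + min \<epsilon> 1" unfolding eventually_sequentially by blast
    define e where "e k = F (k + k0) - v" for k
    define z where "z k = x (k + k0)" for k
    have "\<exists>l E. z \<longlonglongrightarrow> l \<and> (\<forall>k\<ge>1. norm (z (k + 2) - l) \<le> E * real k powr (- (1 - \<theta>)))"
    proof (rule descent_rate[of "L / 2" C \<theta> e])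
      show "L / 2 > 0" using objective.L_pos by simp
      show "0 < e k" "e k \<le> 1" for k using Fpos[of "k + k0"] k0[of "k + k0"] by (simp_all add: e_def)
      show "e (Suc k) + L / 2 * (norm (z (Suc (Suc k)) - z (Suc k)))\<^sup>2 \<le> e k" for k
        using up[of "Suc (k + k0)"] low[of "k + k0"] by (simp add: e_def z_def)
      show "e k powr \<theta> \<le> C * norm (z (Suc k) - z k)" for k
        using C(5)[OF x(1) x(2), of "k + k0"] Fpos[of "k + k0"] k0[of "k + k0"]
        by (simp add: e_def z_def F_def)
    qed (use C in auto)
    then obtain l E where l: "z \<longlonglongrightarrow> l" "\<And>k. k \<ge> 1 \<Longrightarrow> norm (z (k + 2) - l) \<le> E * real k powr (- (1 - \<theta>))" by blast
    have "x \<longlonglongrightarrow> l" using l(1) unfolding z_def by (rule LIMSEQ_offset)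
    moreover have "(\<lambda>k. norm (x k - l)) \<in> O(\<lambda>k. 1 / real k powr (1 - \<theta>))"
      by (rule shifted_powr_bigo[of _ _ "2 + k0" E]) (use l(2) C(3) in \<open>auto simp: z_def add.assoc\<close>)
    ultimately show ?thesis using fin C(3) by (metis diff_gt_0_iff_gt)
  qed
qed

end

lemma smooth_functionI:
  assumes "C2_fun f" "L > 0" "L-lipschitz_on UNIV (grad f)"
  shows "smooth_function f L"
proof
  show "GDERIV f x :> grad f x" for x using assms(1) by (intro GDERIV_grad) (simp add: C2_fun_def)
  show "norm (grad f x - grad f y) \<le> L * norm (x - y)" for x y
    using lipschitz_onD[OF assms(3), of x y] by (simp add: dist_norm)
qed (rule assms)

theorem theorem2p1:
  fixes f :: "real ^ 'n \<Rightarrow> real"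
    and fc :: "nat \<Rightarrow> real ^ 'n \<Rightarrow> real"
    and m :: nat
    and L :: real
    and Lc :: "nat \<Rightarrow> real"
    and x0 :: "real ^ 'n"
    and x :: "nat \<Rightarrow> real ^ 'n"
  assumes "semialgebraic_fun f" and "C2_fun f"
    and "\<And>i. i \<in> {1..m} \<Longrightarrow> semialgebraic_fun (fc i)"
    and "\<And>i. i \<in> {1..m} \<Longrightarrow> C2_fun (fc i)"
    and "L > 0" and "L-lipschitz_on UNIV (grad f)"
    and "\<And>i. i \<in> {1..m} \<Longrightarrow> Lc i > 0"
    and "\<And>i. i \<in> {1..m} \<Longrightarrow> (Lc i)-lipschitz_on UNIV (grad (fc i))"
    and "MFCQ m fc"
    and "x0 \<in> feasible_set m fc"
    and "bounded {y. f y \<le> f x0}"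
    and "moving_balls_sequence m f fc L Lc x0 x"
  shows "\<exists>x_inf.
      x \<longlonglongrightarrow> x_inf \<and> x_inf \<in> feasible_set m fc \<and> KKT_point m f fc x_inf \<and>
      ((\<forall>\<^sub>F k in sequentially. x k = x_inf) \<or>
       (\<exists>q. 0 < q \<and> q < 1 \<and> (\<lambda>k. norm (x k - x_inf)) \<in> O(\<lambda>k. q ^ k)) \<or>
       (\<exists>\<gamma>>0. (\<lambda>k. norm (x k - x_inf)) \<in> O(\<lambda>k. 1 / real k powr \<gamma>)))"
proof -
  fix i0 :: 'n
  define K where "K = {y. (\<forall>i\<in>{1..m}. fc i y \<le> 0) \<and> f y \<le> f x0}"
  have sm: "smooth_function f L" by (rule smooth_functionI) fact+
  have smc: "smooth_function (fc i) (Lc i)" if "i \<in> {1..m}" for i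
    by (rule smooth_functionI) (use assms that in blast)+
  have "K = (\<Inter>i\<in>{1..m}. {y. fc i y \<le> 0}) \<inter> {y. f y \<le> f x0}" by (auto simp: K_def)
  moreover have "closed \<dots>"
    using smooth_function.continuous[OF sm] smooth_function.continuous[OF smc]
    by (intro closed_Int closed_INT ballI closed_Collect_le) (auto intro: continuous_intros)
  moreover have "bounded K" by (rule bounded_subset[OF assms(11)]) (auto simp: K_def)
  ultimately have "compact K" by (simp add: compact_eq_bounded_closed)
  then interpret semialgebraic_moving_balls m f fc L Lc K
    by unfold_locales (use sm smc assms in \<open>auto simp: K_def feasible_set_def smooth_function_def\<close>)
  have sol: "solution (x k) (x (Suc k))" for k
    using assms(12) unfolding moving_balls_sequence_def solution_def admissible_def[abs_def] by blast
  have xK: "x k \<in> K" for k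
  proof (induction k)
    case 0
    then show ?case using assms(10,12) by (simp add: K_def feasible_set_def moving_balls_sequence_def)
  next
    case (Suc k)
    have "f (x (Suc k)) \<le> f x0"
      using descent_step(1)[OF Suc sol] solutionD(2)[OF sol admissible_self[OF Suc]] Suc by (simp add: K_def)
    then show ?case using feasible_step[OF solutionD(1)[OF sol]] by (simp add: K_def feasible_set_def)
  qed
  have le_definable: "definable (\<lambda>s. g (s 0) \<le> c)" if g: "semialgebraic_fun g" for g :: "real ^ 'n \<Rightarrow> real" and c
  proof -
    have "definable (\<lambda>s. s 1 $ i0 = g (s 0) \<and> s 1 $ i0 \<le> c)"
      by (intro cp.determined_conj cp.determined_le coord_poly.coord coord_poly.const semialgebraic_fun_definable g)
    then have "definable (\<lambda>s. \<exists>v. v $ i0 = g (s 0) \<and> v $ i0 \<le> c)"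
      by (rule definable_ex[where k = 1]) simp
    moreover have "(\<exists>v :: real ^ 'n. v $ i0 = b \<and> v $ i0 \<le> c) \<longleftrightarrow> b \<le> c" for b
      by (auto intro: exI[of _ "vec b"])
    ultimately show ?thesis by simp
  qed
  have "definable (\<lambda>s. s 0 \<in> K)"
    unfolding K_def mem_Collect_eq
    by (intro cp.determined_conj cp.determined_ball le_definable assms finite_atLeastAtMost)
  from moving_balls_rate[of x, OF this xK sol] obtain l where l: "x \<longlonglongrightarrow> l" "l \<in> K" "solution l l"
    "(\<forall>\<^sub>F k in sequentially. x k = l) \<or> (\<exists>\<gamma>>0. (\<lambda>k. norm (x k - l)) \<in> O(\<lambda>k. 1 / real k powr \<gamma>))" by blast
  then show ?thesis using stationary_imp_KKT[OF l(2,3)] K_feasible by blast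
qed

end
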